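(* Let $\alpha>1/2$, $\tau>0$, let $R>1$ be an odd integer, let $1\le p\le\infty$, let $d\in\mathbb{N}$, and let $(\gamma_j)_{j\ge1}$ be a non-increasing sequence with $\gamma_j\in(0,1]$ for all $j$. Then for every $\beta>0$ there is a constant $C_\beta=C_{d,\alpha,\beta,\boldsymbol{\gamma},\tau,R,p}>0$, independent of $N$ (but possibly dependent on $d$), such that the following holds. Let $N$ be an odd prime with $N_2>1$, and assume that $$\varepsilon_2:=\frac{|\mathcal{A}_{d,\alpha,\boldsymbol{\gamma}}(N_2)|}{2}\left(\frac{8}{1+\tau\log N_2}\right)^{\lceil R/2\rceil}\le 1 .$$ Let $A=A_{N,\boldsymbol{z}_{\{1:R\}},\mathcal{A}_{d,\alpha,\boldsymbol{\gamma}}(N_2)}$ be the median lattice algorithm with parameters $\tau,R,N$. Then, with probability at least $1-\varepsilon_2$ over the random generating vectors $\boldsymbol{z}_1,\dots,\boldsymbol{z}_R$, $$\mathrm{err}(\mathcal{H}_{d,\alpha,\boldsymbol{\gamma}},L_p,A)\le C_{\beta}\,N^{-\alpha+(\frac12-\frac1p)_+ +\beta}\qquad\text{for any }\beta>0,$$ where $(x)_+=\max\{x,0\}$ and $1/p=0$ for $p=\infty$. Moreover, for $p=\infty$, the constant is independent of the dimension $d$ if $\sum_{j=1}^\infty\gamma_j^{1/(2\alpha)}<\infty$.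
   Context: Weights and frequency function: for $\boldsymbol{h}=(h_1,\dots,h_d)\in\mathbb{Z}^d$ let $\mathrm{supp}(\boldsymbol{h})=\{j\in\{1,\dots,d\}: h_j\ne0\}$. With product weights $\gamma_{\mathfrak u}=\prod_{j\in\mathfrak u}\gamma_j$, $\gamma_\emptyset=1$, set $r_{2\alpha,\boldsymbol{\gamma}}(\boldsymbol{h})=\gamma_{\mathrm{supp}(\boldsymbol{h})}^{-1}\prod_{j\in\mathrm{supp}(\boldsymbol{h})}|h_j|^{2\alpha}$, so $r_{2\alpha,\boldsymbol{\gamma}}(\boldsymbol{0})=1$. For real $L\ge0$ let $\mathcal{A}_{d,\alpha,\boldsymbol{\gamma}}(L)=\{\boldsymbol{h}\in\mathbb{Z}^d: r_{2\alpha,\boldsymbol{\gamma}}(\boldsymbol{h})<L^{2\alpha}\}$. Korobov space: for $f\in L_2([0,1]^d)$ let $\widehat f(\boldsymbol{h})=\int_{[0,1]^d}f(\boldsymbol{x})e^{-2\pi \mathtt{i}\,\boldsymbol{h}\cdot\boldsymbol{x}}\,\mathrm{d}\boldsymbol{x}$. The weighted periodic Korobov space $\mathcal{H}_{d,\alpha,\boldsymbol{\gamma}}$ consists of all $f:[0,1]^d\to\mathbb{R}$ in $L_2([0,1]^d)$ with $\|f\|_{d,\alpha,\boldsymbol{\gamma}}^2:=\sum_{\boldsymbol{h}\in\mathbb{Z}^d}|\widehat f(\boldsymbol{h})|^2r_{2\alpha,\boldsymbol{\gamma}}(\boldsymbol{h})<\infty$ (for $\alpha>1/2$ its elements are identified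 with continuous one-periodic functions, given by their absolutely convergent Fourier series). For a map $A:\mathcal{H}_{d,\alpha,\boldsymbol{\gamma}}\to L_p([0,1]^d)$, the worst-case error is $\mathrm{err}(\mathcal{H}_{d,\alpha,\boldsymbol{\gamma}},L_p,A)=\sup\{\|f-A(f)\|_{L_p}: f\in\mathcal{H}_{d,\alpha,\boldsymbol{\gamma}},\ \|f\|_{d,\alpha,\boldsymbol{\gamma}}\le1\}$. Threshold: $P_{N,d}(\tau,\alpha,\boldsymbol{\gamma})=\prod_{j=1}^d\bigl(1+2\gamma_j^{1/(2\alpha)}(1+\tau\log N)\bigr)$ and $N_2=\dfrac{N-1}{\exp(\tau^{-1})\,P_{N,d}(\tau,\alpha,\boldsymbol{\gamma})}$. Median: for odd $R$ and complex $Z_1,\dots,Z_R$, $\mathrm{median}_{r}(Z_r)=\mathrm{median}_r\Re(Z_r)+\mathtt{i}\cdot\mathrm{median}_r\Im(Z_r)$. Median lattice algorithm: draw $\boldsymbol{z}_1,\dots,\boldsymbol{z}_R$ independently and uniformly from $\{1,\dots,N-1\}^d$. For $\boldsymbol{h}\in\mathcal{A}_{d,\alpha,\boldsymbol{\gamma}}(N_2)$ put $\widehat f_{N,\boldsymbol{z}_r}(\boldsymbol{h})=\frac1N\sum_{k=0}^{N-1}f(\{k\boldsymbol{z}_r/N\})\exp(-2\pi\mathtt{i}\,\boldsymbol{h}\cdot(k\boldsymbol{z}_r/N))$, where $\{\cdot\}$ is the componentwise fractional part, and $\widehat f_{N,\boldsymbol{z}_{\{1:R\}}}(\boldsymbol{h})=\mathrm{median}_{r\in\{1,\dots,R\}}\bigl(\widehat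 f_{N,\boldsymbol{z}_r}(\boldsymbol{h})\bigr)$. The output is $(A_{N,\boldsymbol{z}_{\{1:R\}},\mathcal{A}_{d,\alpha,\boldsymbol{\gamma}}(N_2)}(f))(\boldsymbol{x})=\sum_{\boldsymbol{h}\in\mathcal{A}_{d,\alpha,\boldsymbol{\gamma}}(N_2)}\widehat f_{N,\boldsymbol{z}_{\{1:R\}}}(\boldsymbol{h})\exp(2\pi\mathtt{i}\,\boldsymbol{h}\cdot\boldsymbol{x})$. *)

theory Defs
  imports "HOL-Probability.Probability" "HOL-Number_Theory.Number_Theory"
begin

text \<open>
  The dimension \<open>d\<close> varies inside the theorem, so a vector indexed by \<open>{1..d}\<close> is an
  extensional function on \<open>{1..d}\<close>. The sequence of weights is \<open>\<gamma> 1, \<gamma> 2, \<dots>\<close>;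
  the value \<open>\<gamma> 0\<close> is never used.
\<close>

section \<open>Weights and frequencies\<close>

definition int_vecs :: "nat \<Rightarrow> (nat \<Rightarrow> int) set" where
  "int_vecs d = {1..d} \<rightarrow>\<^sub>E UNIV"

definition supp :: "nat \<Rightarrow> (nat \<Rightarrow> int) \<Rightarrow> nat set" where
  "supp d h = {j \<in> {1..d}. h j \<noteq> 0}"

definition weight :: "(nat \<Rightarrow> real) \<Rightarrow> nat set \<Rightarrow> real" where
  "weight \<gamma> u = (\<Prod>j\<in>u. \<gamma> j)"

definition freq_fun :: "nat \<Rightarrow> real \<Rightarrow> (nat \<Rightarrow> real) \<Rightarrow> (nat \<Rightarrow> int) \<Rightarrow> real" where
  "freq_fun d \<alpha> \<gamma> h =
     inverse (weight \<gamma> (supp d h)) * (\<Prod>j\<in>supp d h. \<bar>real_of_int (h j)\<bar> powr (2 * \<alpha>))"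

definition freq_set :: "nat \<Rightarrow> real \<Rightarrow> (nat \<Rightarrow> real) \<Rightarrow> real \<Rightarrow> (nat \<Rightarrow> int) set" where
  "freq_set d \<alpha> \<gamma> L = {h \<in> int_vecs d. freq_fun d \<alpha> \<gamma> h < L powr (2 * \<alpha>)}"

text \<open>
  The cardinality of a frequency set and the sum over it are used below. For weights in
  \<open>(0,1]\<close> they are meaningful, because the set is finite.
\<close>

lemma finite_freq_set:
  assumes "\<alpha> > 0" and "L \<ge> 0" and \<gamma>: "\<And>j. j \<ge> 1 \<Longrightarrow> 0 < \<gamma> j \<and> \<gamma> j \<le> 1"
  shows "finite (freq_set d \<alpha> \<gamma> L)"
proof (rule finite_subset)
  let ?B = "{1..d} \<rightarrow>\<^sub>E {- \<lceil>L\<rceil>..\<lceil>L\<rceil>}"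
  show "finite ?B"
    by (intro finite_PiE) auto
  show "freq_set d \<alpha> \<gamma> L \<subseteq> ?B"
  proof
    fix h assume h: "h \<in> freq_set d \<alpha> \<gamma> L"
    have ext: "h \<in> extensional {1..d}"
      using h by (auto simp: freq_set_def int_vecs_def PiE_def)
    have "h j \<in> {- \<lceil>L\<rceil>..\<lceil>L\<rceil>}" if j: "j \<in> {1..d}" for j
    proof (cases "h j = 0")
      case True
      then show ?thesis using \<open>L \<ge> 0\<close> by simp
    next
      case False
      let ?g = "\<lambda>i. \<bar>real_of_int (h i)\<bar> powr (2 * \<alpha>)"
      have fin: "finite (supp d h)" by (simp add: supp_def)
      have js: "j \<in> supp d h" using False j by (simp add: supp_def)
      have g1: "1 \<le> ?g i" if "i \<in> supp d h" for i
      proof -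
        have "h i \<noteq> 0" using that by (simp add: supp_def)
        then have "1 \<le> \<bar>real_of_int (h i)\<bar>" by linarith
        then show ?thesis using \<open>\<alpha> > 0\<close> by (simp add: ge_one_powr_ge_zero)
      qed
      have "1 \<le> prod ?g (supp d h - {j})"
        using g1 by (intro prod_ge_1) auto
      then have "?g j \<le> ?g j * prod ?g (supp d h - {j})"
        using mult_left_mono[of 1 "prod ?g (supp d h - {j})" "?g j"] by simp
      also have "\<dots> = prod ?g (supp d h)"
        using prod.remove[OF fin js] by metis
      finally have 1: "?g j \<le> prod ?g (supp d h)" .
      have w: "0 < weight \<gamma> (supp d h)" "weight \<gamma> (supp d h) \<le> 1"
        unfolding weight_def using \<gamma> by (auto simp: supp_def less_imp_le intro!: prod_pos prod_le_1)
      have "prod ?g (supp d h) \<le> freq_fun d \<alpha> \<gamma> h"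
        unfolding freq_fun_def
        using mult_right_mono[of 1 "inverse (weight \<gamma> (supp d h))" "prod ?g (supp d h)"] w
        by (simp add: one_le_inverse prod_nonneg)
      with 1 h have "?g j < L powr (2 * \<alpha>)"
        by (simp add: freq_set_def)
      then have "\<bar>real_of_int (h j)\<bar> < L"
        using \<open>L \<ge> 0\<close> \<open>\<alpha> > 0\<close> powr_mono2[of "2 * \<alpha>" L "\<bar>real_of_int (h j)\<bar>"] by (cases "\<bar>real_of_int (h j)\<bar> < L") auto
      then show ?thesis by (simp add: abs_less_iff) linarith
    qed
    then show "h \<in> ?B" using ext by (auto simp: PiE_def)
  qed
qed

section \<open>The weighted Korobov space\<close>

definition cube :: "nat \<Rightarrow> (nat \<Rightarrow> real) set" where
  "cube d = {1..d} \<rightarrow>\<^sub>E {0..1}"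

definition cube_measure :: "nat \<Rightarrow> (nat \<Rightarrow> real) measure" where
  "cube_measure d = (\<Pi>\<^sub>M j\<in>{1..d}. restrict_space lborel {0..1})"

definition dot :: "nat \<Rightarrow> (nat \<Rightarrow> int) \<Rightarrow> (nat \<Rightarrow> real) \<Rightarrow> real" where
  "dot d h x = (\<Sum>j=1..d. real_of_int (h j) * x j)"

definition fourier_coeff :: "nat \<Rightarrow> ((nat \<Rightarrow> real) \<Rightarrow> real) \<Rightarrow> (nat \<Rightarrow> int) \<Rightarrow> complex" where
  "fourier_coeff d f h =
     (\<integral>x. complex_of_real (f x) * exp (- 2 * of_real pi * \<i> * of_real (dot d h x)) \<partial>cube_measure d)"

text \<open>
  As \<open>\<alpha> > 1/2\<close>, every class of functions in the space has a unique continuous one-periodic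
  representative on the cube, and the algorithm evaluates this representative. The space is
  therefore the set of these representatives. The topology on the cube is the product topology.
\<close>

definition one_periodic :: "nat \<Rightarrow> ((nat \<Rightarrow> real) \<Rightarrow> real) \<Rightarrow> bool" where
  "one_periodic d f \<longleftrightarrow>
     (\<forall>x\<in>cube d. \<forall>y\<in>cube d. (\<forall>j\<in>{1..d}. x j - y j \<in> \<int>) \<longrightarrow> f x = f y)"

definition korobov_space :: "nat \<Rightarrow> real \<Rightarrow> (nat \<Rightarrow> real) \<Rightarrow> ((nat \<Rightarrow> real) \<Rightarrow> real) set" where
  "korobov_space d \<alpha> \<gamma> =
     {f. f \<in> borel_measurable (cube_measure d) \<and>
         integrable (cube_measure d) (\<lambda>x. (f x)\<^sup>2) \<and>
         continuous_on (cube d) f \<and> one_periodic d f \<and>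
         (\<lambda>h. (cmod (fourier_coeff d f h))\<^sup>2 * freq_fun d \<alpha> \<gamma> h) summable_on int_vecs d}"

definition korobov_norm :: "nat \<Rightarrow> real \<Rightarrow> (nat \<Rightarrow> real) \<Rightarrow> ((nat \<Rightarrow> real) \<Rightarrow> real) \<Rightarrow> real" where
  "korobov_norm d \<alpha> \<gamma> f =
     sqrt (\<Sum>\<^sub>\<infinity>h\<in>int_vecs d. (cmod (fourier_coeff d f h))\<^sup>2 * freq_fun d \<alpha> \<gamma> h)"

section \<open>Lp norms and the worst-case error\<close>

definition Lp_norm :: "nat \<Rightarrow> ennreal \<Rightarrow> ((nat \<Rightarrow> real) \<Rightarrow> complex) \<Rightarrow> ennreal" where
  "Lp_norm d p g =
     (if p = \<infinity> then esssup (cube_measure d) (\<lambda>x. ennreal (cmod (g x)))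
      else let I = (\<integral>\<^sup>+x. ennreal (cmod (g x) powr enn2real p) \<partial>cube_measure d)
           in if I = \<infinity> then \<infinity> else ennreal (enn2real I powr (1 / enn2real p)))"

definition worst_case_error ::
  "nat \<Rightarrow> real \<Rightarrow> (nat \<Rightarrow> real) \<Rightarrow> ennreal
     \<Rightarrow> (((nat \<Rightarrow> real) \<Rightarrow> real) \<Rightarrow> (nat \<Rightarrow> real) \<Rightarrow> complex) \<Rightarrow> ennreal" where
  "worst_case_error d \<alpha> \<gamma> p A =
     (SUP f \<in> {f \<in> korobov_space d \<alpha> \<gamma>. korobov_norm d \<alpha> \<gamma> f \<le> 1}.
        Lp_norm d p (\<lambda>x. complex_of_real (f x) - A f x))"

section \<open>The median lattice algorithm\<close>

definition P_fac :: "nat \<Rightarrow> nat \<Rightarrow> real \<Rightarrow> real \<Rightarrow> (nat \<Rightarrow> real) \<Rightarrow> real" where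
  "P_fac N d \<tau> \<alpha> \<gamma> =
     (\<Prod>j=1..d. 1 + 2 * \<gamma> j powr (1 / (2 * \<alpha>)) * (1 + \<tau> * ln (real N)))"

definition N2 :: "nat \<Rightarrow> nat \<Rightarrow> real \<Rightarrow> real \<Rightarrow> (nat \<Rightarrow> real) \<Rightarrow> real" where
  "N2 N d \<tau> \<alpha> \<gamma> = (real N - 1) / (exp (1 / \<tau>) * P_fac N d \<tau> \<alpha> \<gamma>)"

text \<open>The middle order statistic of \<open>Z 1, \<dots>, Z R\<close>, for odd \<open>R\<close>.\<close>

definition real_median :: "nat \<Rightarrow> (nat \<Rightarrow> real) \<Rightarrow> real" where
  "real_median R Z = sort (map Z [1..<Suc R]) ! (R div 2)"

definition complex_median :: "nat \<Rightarrow> (nat \<Rightarrow> complex) \<Rightarrow> complex" where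
  "complex_median R Z =
     of_real (real_median R (\<lambda>r. Re (Z r))) + \<i> * of_real (real_median R (\<lambda>r. Im (Z r)))"

definition lattice_point :: "nat \<Rightarrow> nat \<Rightarrow> (nat \<Rightarrow> nat) \<Rightarrow> nat \<Rightarrow> nat \<Rightarrow> real" where
  "lattice_point d N z k = (\<lambda>j\<in>{1..d}. frac (real k * real (z j) / real N))"

definition lattice_coeff ::
  "nat \<Rightarrow> nat \<Rightarrow> (nat \<Rightarrow> nat) \<Rightarrow> ((nat \<Rightarrow> real) \<Rightarrow> real) \<Rightarrow> (nat \<Rightarrow> int) \<Rightarrow> complex" where
  "lattice_coeff d N z f h =
     1 / of_nat N *
       (\<Sum>k<N. complex_of_real (f (lattice_point d N z k)) *
          exp (- 2 * of_real pi * \<i> * of_real (dot d h (\<lambda>j. real k * real (z j) / real N))))"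

definition median_coeff ::
  "nat \<Rightarrow> nat \<Rightarrow> nat \<Rightarrow> (nat \<Rightarrow> nat \<Rightarrow> nat) \<Rightarrow> ((nat \<Rightarrow> real) \<Rightarrow> real) \<Rightarrow> (nat \<Rightarrow> int) \<Rightarrow> complex" where
  "median_coeff d N R z f h = complex_median R (\<lambda>r. lattice_coeff d N (z r) f h)"

definition median_lattice ::
  "nat \<Rightarrow> nat \<Rightarrow> nat \<Rightarrow> (nat \<Rightarrow> nat \<Rightarrow> nat) \<Rightarrow> (nat \<Rightarrow> int) set
     \<Rightarrow> ((nat \<Rightarrow> real) \<Rightarrow> real) \<Rightarrow> (nat \<Rightarrow> real) \<Rightarrow> complex" where
  "median_lattice d N R z H f x =
     (\<Sum>h\<in>H. median_coeff d N R z f h * exp (2 * of_real pi * \<i> * of_real (dot d h x)))"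

text \<open>\<open>R\<close> independent generating vectors, each uniform on \<open>{1,\<dots>,N-1}\<^sup>d\<close>.\<close>

definition generating_vectors :: "nat \<Rightarrow> nat \<Rightarrow> nat \<Rightarrow> (nat \<Rightarrow> nat \<Rightarrow> nat) pmf" where
  "generating_vectors d N R =
     Pi_pmf {1..R} undefined (\<lambda>_. pmf_of_set ({1..d} \<rightarrow>\<^sub>E {1..N - 1}))"

definition eps2 :: "nat \<Rightarrow> nat \<Rightarrow> nat \<Rightarrow> real \<Rightarrow> real \<Rightarrow> (nat \<Rightarrow> real) \<Rightarrow> real" where
  "eps2 N d R \<tau> \<alpha> \<gamma> =
     real (card (freq_set d \<alpha> \<gamma> (N2 N d \<tau> \<alpha> \<gamma>))) / 2 *
       (8 / (1 + \<tau> * ln (N2 N d \<tau> \<alpha> \<gamma>))) ^ nat \<lceil>real R / 2\<rceil>"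

end

theory Submission
  imports Defs "HOL-Library.Real_Mod"
begin

text \<open>
  A function of the space equals its absolutely convergent Fourier series at every point
  (Stone--Weierstrass on the torus), so the error of a lattice coefficient at \<open>h\<close> is the sum of
  the Fourier coefficients over the coset of the dual lattice of \<open>z\<close> through \<open>h\<close>, without \<open>h\<close>.
  Call \<open>z\<close> bad for \<open>h\<close> in the frequency set \<open>A\<close> if this coset contains another point of \<open>A\<close>, or
  if the sum of \<open>r(k) powr - ((1 + e) / (2 * \<alpha>))\<close> over the coset without \<open>h\<close> exceeds
  \<open>x = 1 + \<tau> * ln N2\<close> times a bound on its mean. Counting \<open>A\<close> (one logarithm better than the
  product bound) and Markov's inequality show that each of the two events has probability at most
  \<open>1 / x\<close>. The median fails only if more than half of the \<open>R\<close> vectors are bad, which gives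
  \<open>eps2\<close> after a union bound over \<open>A\<close>.

  With \<open>e = (2 * \<alpha> - 1) / ln N\<close> the threshold is of order \<open>1 / N\<close> up to logarithms, and neither
  it nor the event depends on \<open>\<beta>\<close>. As good cosets are disjoint, Cauchy--Schwarz bounds the
  \<open>\<ell>\<^sub>2\<close> norm of the coefficient errors by about \<open>N powr - \<alpha>\<close>; this bounds the \<open>L\<^sub>2\<close> error, a
  further factor \<open>sqrt N\<close> from \<open>card A \<le> N\<close> bounds the uniform error, and interpolation gives
  the other \<open>L\<^sub>p\<close> norms.
\<close>

section \<open>Weights and counting of frequencies\<close>

text \<open>The stated probability leaves no slack in constants: with \<open>R = 2 * m - 1\<close>,
  the product \<open>2 ^ R * (2 / x) ^ m\<close> is exactly half of \<open>(8 / x) ^ m\<close>, so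
  each frequency may be bad with probability at most \<open>2 / x\<close>. A Rankin-type count of
  \<open>A\<close> by \<open>L powr (1 + \<delta>)\<close> times a product would only bound the
  collision probability by 1. Gaining the factor \<open>1 + 1 / \<delta>\<close> and taking
  \<open>\<delta> = 1 / (\<tau> * ln L)\<close> repairs this: then
  \<open>1 + 1 / \<delta> = x\<close>, and \<open>L powr \<delta> = exp (1 / \<tau>)\<close> is the
  factor built into \<open>N2\<close>.

  One event must serve all \<beta>, so the tail exponent may depend on \<open>N\<close> only. As
  \<open>e\<close> is proportional to \<open>1 / ln N\<close>, the power \<open>N powr e\<close> is
  constant and \<open>1 + 1 / e\<close> is affine in \<open>ln N\<close>; the mean tail is governed
  by a product of the shape of \<open>P_fac\<close>. Such products stay below
  \<open>K * N powr b\<close> for each \<open>b > 0\<close>, uniformly in \<open>d\<close> for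
  summable weights.

  Frequencies congruent to \<open>h\<close> modulo \<open>N\<close> in every coordinate lie in the
  coset for every generating vector, so averaging gains nothing there. They are small
  deterministically, because \<open>A\<close> lies in the box of coordinates below
  \<open>N / 2\<close>.\<close>

text \<open>A discrete substitute for comparison with the integral of
  \<open>t powr - (1 + e)\<close>: the right-hand side telescopes. With
  \<open>t = 1 / (n + 1)\<close> the claim is the Bernoulli-type inequality
  \<open>1 + e * t \<le> (1 - t) powr - e\<close>.\<close>

lemma powr_neg_step:
  fixes e :: real
  assumes e: "e > 0" and n: "n \<ge> 1"
  shows "real (Suc n) powr - (1 + e) \<le> (real n powr - e - real (Suc n) powr - e) / e"
proof -
  define t where "t = 1 / real (Suc n)"
  have t: "0 < t" "t < 1" using n by (auto simp: t_def)
  have nt: "real n = real (Suc n) * (1 - t)" by (simp add: t_def field_simps)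
  have "1 + e * t \<le> 1 + (- e) * ln (1 - t)"
    using mult_left_mono[of "ln (1 - t)" "- t" e] ln_le_minus_one[of "1 - t"] t e by simp
  also have "\<dots> \<le> exp ((- e) * ln (1 - t))" by (rule exp_ge_add_one_self)
  also have "\<dots> = (1 - t) powr - e" using t by (simp add: powr_def)
  finally have 1: "1 + e * t \<le> (1 - t) powr - e" .
  have "real n powr - e = real (Suc n) powr - e * (1 - t) powr - e"
    unfolding nt using t by (subst powr_mult) auto
  moreover have "\<dots> \<ge> real (Suc n) powr - e * (1 + e * t)"
    using 1 by (intro mult_left_mono) auto
  moreover have "real (Suc n) powr - (1 + e) = real (Suc n) powr - e * t"
    unfolding t_def by (simp add: powr_diff powr_minus powr_add field_simps)
  ultimately show ?thesis using e by (simp add: field_simps)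
qed

lemma sum_powr_neg_le:
  fixes e :: real
  assumes "e > 0"
  shows "(\<Sum>n=1..M. real n powr - (1 + e)) \<le> 1 + 1 / e"
proof (cases "M = 0")
  case False
  \<comment> \<open>The subtracted term strengthens the claim so that the telescoping step closes
    the induction.\<close>
  have "(\<Sum>n=1..M. real n powr - (1 + e)) \<le> 1 + 1 / e - real M powr - e / e" if "M \<ge> 1" for M
    using that
  proof (induction M rule: dec_induct)
    case (step n)
    then show ?case using powr_neg_step[OF assms, of n] by (simp add: diff_divide_distrib)
  qed simp
  from this[of M] False assms show ?thesis
    by (smt (verit) divide_nonneg_pos powr_ge_zero One_nat_def Suc_leI bot_nat_0.not_eq_extremum)
qed (use assms in simp)

lemma sum_int_powr_neg_le:
  fixes e :: real
  assumes "e > 0" and "finite F"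
  shows "(\<Sum>n\<in>F - {0}. \<bar>real_of_int n\<bar> powr - (1 + e)) \<le> 2 * (1 + 1 / e)"
proof -
  obtain M where M: "\<And>n. n \<in> F \<Longrightarrow> nat \<bar>n\<bar> \<le> M"
    using assms(2) by (metis finite_nat_set_iff_bounded_le finite_imageI imageI)
  let ?w = "\<lambda>n. \<bar>real_of_int n\<bar> powr - (1 + e)"
  have "(\<Sum>n\<in>F - {0}. ?w n) \<le> (\<Sum>n\<in>int ` {1..M} \<union> (\<lambda>n. - int n) ` {1..M}. ?w n)"
  proof (rule sum_mono2)
    show "F - {0} \<subseteq> int ` {1..M} \<union> (\<lambda>n. - int n) ` {1..M}"
    proof
      fix n assume n: "n \<in> F - {0}"
      then have "nat \<bar>n\<bar> \<in> {1..M}" using M[of n] by auto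
      moreover have "n = int (nat \<bar>n\<bar>) \<or> n = - int (nat \<bar>n\<bar>)" by auto
      ultimately show "n \<in> int ` {1..M} \<union> (\<lambda>n. - int n) ` {1..M}" by blast
    qed
  qed auto
  also have "\<dots> \<le> (\<Sum>n\<in>int ` {1..M}. ?w n) + (\<Sum>n\<in>(\<lambda>n. - int n) ` {1..M}. ?w n)"
    by (subst sum_Un) (auto intro!: sum_nonneg)
  also have "(\<Sum>n\<in>int ` {1..M}. ?w n) = (\<Sum>n=1..M. real n powr - (1 + e))"
    by (subst sum.reindex) (auto simp: inj_on_def)
  also have "(\<Sum>n\<in>(\<lambda>n. - int n) ` {1..M}. ?w n) = (\<Sum>n=1..M. real n powr - (1 + e))"
    by (subst sum.reindex) (auto simp: inj_on_def)
  finally show ?thesis using sum_powr_neg_le[OF assms(1), of M] by (simp only: mult_2)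
qed

text \<open>
  With \<open>g j = \<gamma> j powr (1 / (2 * \<alpha>))\<close>, the frequency function is \<open>decay d g h powr - (2 * \<alpha>)\<close>.
\<close>

definition decay1 :: "real \<Rightarrow> int \<Rightarrow> real" where
  "decay1 c n = (if n = 0 then 1 else c / \<bar>real_of_int n\<bar>)"

definition decay :: "nat \<Rightarrow> (nat \<Rightarrow> real) \<Rightarrow> (nat \<Rightarrow> int) \<Rightarrow> real" where
  "decay d g h = (\<Prod>j=1..d. decay1 (g j) (h j))"

lemma decay1_pos: "0 < c \<Longrightarrow> 0 < decay1 c n"
  by (simp add: decay1_def)

lemma decay1_le1: "0 < c \<Longrightarrow> c \<le> 1 \<Longrightarrow> decay1 c n \<le> 1"
  by (auto simp: decay1_def divide_le_eq)

lemma decay_pos: "(\<And>j. 1 \<le> j \<Longrightarrow> 0 < g j) \<Longrightarrow> 0 < decay d g h"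
  unfolding decay_def by (intro prod_pos) (auto intro: decay1_pos)

lemma decay_le1: "(\<And>j. 1 \<le> j \<Longrightarrow> 0 < g j \<and> g j \<le> 1) \<Longrightarrow> decay d g h \<le> 1"
  unfolding decay_def by (intro prod_le_1) (auto intro: less_imp_le decay1_pos decay1_le1)

lemma decay_le_decay1:
  assumes "\<And>j. 1 \<le> j \<Longrightarrow> 0 < g j \<and> g j \<le> 1" and "j \<in> {1..d}"
  shows "decay d g h \<le> decay1 (g j) (h j)"
proof -
  have "decay d g h = decay1 (g j) (h j) * (\<Prod>i\<in>{1..d} - {j}. decay1 (g i) (h i))"
    unfolding decay_def using assms(2) by (simp add: prod.remove)
  also have "\<dots> \<le> decay1 (g j) (h j) * 1"
    using assms by (intro mult_left_mono prod_le_1) (auto intro: less_imp_le decay1_pos decay1_le1)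
  finally show ?thesis by simp
qed

lemma decay_Suc: "decay (Suc d) g h = decay d g h * decay1 (g (Suc d)) (h (Suc d))"
  by (simp add: decay_def)

lemma decay_restrict: "decay d g (restrict h {1..d}) = decay d g h"
  unfolding decay_def by (intro prod.cong) auto

lemma freq_fun_eq_decay:
  assumes a: "\<alpha> > 0" and \<gamma>: "\<And>j. 1 \<le> j \<Longrightarrow> 0 < \<gamma> j \<and> \<gamma> j \<le> (1::real)"
  defines "g \<equiv> \<lambda>j. \<gamma> j powr (1 / (2 * \<alpha>))"
  shows "freq_fun d \<alpha> \<gamma> h = decay d g h powr - (2 * \<alpha>)"
proof -
  have g: "0 < g j" "g j powr - (2 * \<alpha>) = inverse (\<gamma> j)" if "1 \<le> j" for j
    using \<gamma>[OF that] a by (auto simp: g_def powr_powr powr_minus)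
  have "decay d g h powr - (2 * \<alpha>) = (\<Prod>j=1..d. decay1 (g j) (h j) powr - (2 * \<alpha>))"
    unfolding decay_def by (rule prod_powr_distrib)
  also have "\<dots> = (\<Prod>j\<in>supp d h. decay1 (g j) (h j) powr - (2 * \<alpha>))"
    by (rule prod.mono_neutral_right) (auto simp: supp_def decay1_def)
  also have "\<dots> = (\<Prod>j\<in>supp d h. inverse (\<gamma> j) * \<bar>real_of_int (h j)\<bar> powr (2 * \<alpha>))"
  proof (rule prod.cong)
    fix j assume "j \<in> supp d h"
    then have j: "1 \<le> j" "h j \<noteq> 0" by (auto simp: supp_def)
    then have "(g j / \<bar>real_of_int (h j)\<bar>) powr - (2 * \<alpha>)
        = g j powr - (2 * \<alpha>) * \<bar>real_of_int (h j)\<bar> powr (2 * \<alpha>)"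
      using g(1)[OF j(1)] by (subst powr_divide) (auto simp: powr_minus field_simps)
    then show "decay1 (g j) (h j) powr - (2 * \<alpha>) = inverse (\<gamma> j) * \<bar>real_of_int (h j)\<bar> powr (2 * \<alpha>)"
      using j g by (simp add: decay1_def)
  qed simp
  finally show ?thesis
    by (simp add: freq_fun_def weight_def prod.distrib prod_inversef [symmetric])
qed

text \<open>Taking roots of order \<open>2 * \<alpha>\<close> turns the frequency set into a
  weighted hyperbolic cross; \<alpha> survives only inside \<open>g\<close>.\<close>

lemma freq_set_eq_decay:
  assumes a: "\<alpha> > 0" and \<gamma>: "\<And>j. 1 \<le> j \<Longrightarrow> 0 < \<gamma> j \<and> \<gamma> j \<le> (1::real)" and L: "L > 0"
  defines "g \<equiv> \<lambda>j. \<gamma> j powr (1 / (2 * \<alpha>))"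
  shows "freq_set d \<alpha> \<gamma> L = {h \<in> int_vecs d. 1 < L * decay d g h}"
proof -
  have "freq_fun d \<alpha> \<gamma> h < L powr (2 * \<alpha>) \<longleftrightarrow> 1 < L * decay d g h" for h
  proof -
    have k: "0 < decay d g h" using \<gamma> by (intro decay_pos) (force simp: g_def)
    have r: "freq_fun d \<alpha> \<gamma> h = decay d g h powr - (2 * \<alpha>)"
      unfolding g_def by (rule freq_fun_eq_decay[OF a \<gamma>])
    have "freq_fun d \<alpha> \<gamma> h = (1 / decay d g h) powr (2 * \<alpha>)"
      using k r by (simp add: powr_minus powr_divide inverse_eq_divide)
    also have "\<dots> < L powr (2 * \<alpha>) \<longleftrightarrow> 1 / decay d g h < L"
      using k L a powr_less_mono2[of "2*\<alpha>" "1 / decay d g h" L] powr_mono2[of "2*\<alpha>" L "1 / decay d g h"]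
      by (smt (verit) zero_less_divide_1_iff)
    also have "\<dots> \<longleftrightarrow> 1 < L * decay d g h" using k by (simp add: field_simps)
    finally show ?thesis .
  qed
  then show ?thesis by (simp add: freq_set_def)
qed

text \<open>At \<open>x = 1 + \<tau> * ln N\<close> this is \<open>P_fac\<close>. The argument stays
  free because \<open>x = 1 + 1 / e\<close>, a bound for the zeta function at \<open>1 + e\<close>,
  is the other value that occurs.\<close>

definition Pi_fac :: "nat \<Rightarrow> (nat \<Rightarrow> real) \<Rightarrow> real \<Rightarrow> real" where
  "Pi_fac d g x = (\<Prod>j=1..d. 1 + 2 * g j * x)"

lemma Pi_fac_ge1: "(\<And>j. 1 \<le> j \<Longrightarrow> 0 < g j) \<Longrightarrow> 0 \<le> x \<Longrightarrow> 1 \<le> Pi_fac d g x"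
  unfolding Pi_fac_def by (intro prod_ge_1) (auto simp: less_imp_le)

lemma Pi_fac_mono:
  "(\<And>j. 1 \<le> j \<Longrightarrow> 0 < g j) \<Longrightarrow> 0 \<le> x \<Longrightarrow> x \<le> y \<Longrightarrow> Pi_fac d g x \<le> Pi_fac d g y"
  unfolding Pi_fac_def by (intro prod_mono) (auto simp: less_imp_le intro!: add_nonneg_nonneg mult_left_mono)

text \<open>Enlarging \<open>F\<close> to the box of its coordinate projections makes the sum
  factorise. The factor of coordinate \<open>j\<close> is at most 1 plus
  \<open>g j powr (1 + e)\<close> times a two-sided zeta sum, and \<open>g j \<le> 1\<close> lets
  the power be replaced by \<open>g j\<close>.\<close>

lemma sum_decay_powr_le:
  assumes g: "\<And>j. 1 \<le> j \<Longrightarrow> 0 < g j \<and> g j \<le> 1" and e: "e > 0"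
    and F: "finite F" "F \<subseteq> int_vecs d"
  shows "(\<Sum>h\<in>F. decay d g h powr (1 + e)) \<le> Pi_fac d g (1 + 1 / e)"
proof -
  define B where "B = (\<lambda>j. (\<lambda>h. h j) ` F)"
  have finB: "finite (B j)" for j using F by (simp add: B_def)
  have "F \<subseteq> PiE {1..d} B" using F by (auto simp: int_vecs_def B_def PiE_def Pi_def)
  then have "(\<Sum>h\<in>F. decay d g h powr (1 + e)) \<le> (\<Sum>h\<in>PiE {1..d} B. decay d g h powr (1 + e))"
    by (intro sum_mono2) (auto intro!: finite_PiE finB)
  also have "\<dots> = (\<Sum>h\<in>PiE {1..d} B. \<Prod>j\<in>{1..d}. decay1 (g j) (h j) powr (1 + e))"
    unfolding decay_def
    by (intro sum.cong refl prod_powr_distrib)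
  also have "\<dots> = (\<Prod>j\<in>{1..d}. \<Sum>n\<in>B j. decay1 (g j) n powr (1 + e))"
    by (intro prod_sum_PiE [symmetric] finB) auto
  also have "\<dots> \<le> (\<Prod>j\<in>{1..d}. 1 + 2 * g j * (1 + 1 / e))"
  proof (intro prod_mono conjI sum_nonneg)
    fix j assume "j \<in> {1..d}"
    then have gj: "0 < g j" "g j \<le> 1" using g by auto
    have "(\<Sum>n\<in>B j. decay1 (g j) n powr (1 + e)) \<le> (\<Sum>n\<in>insert 0 (B j). decay1 (g j) n powr (1 + e))"
      by (intro sum_mono2) (auto simp: finB)
    also have "\<dots> = 1 + (\<Sum>n\<in>B j - {0}. decay1 (g j) n powr (1 + e))"
      by (simp add: sum.insert_remove finB decay1_def)
    also have "(\<Sum>n\<in>B j - {0}. decay1 (g j) n powr (1 + e))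
        = g j powr (1 + e) * (\<Sum>n\<in>B j - {0}. \<bar>real_of_int n\<bar> powr - (1 + e))"
      unfolding sum_distrib_left
    proof (rule sum.cong)
      fix n assume "n \<in> B j - {0}"
      then show "decay1 (g j) n powr (1 + e) = g j powr (1 + e) * \<bar>real_of_int n\<bar> powr - (1 + e)"
        using gj by (simp add: decay1_def powr_divide) (simp add: powr_minus powr_diff powr_add field_simps)
    qed simp
    also have "\<dots> \<le> g j powr 1 * (2 * (1 + 1 / e))"
      using gj e by (intro mult_mono sum_int_powr_neg_le finB powr_mono') (auto intro!: sum_nonneg)
    finally show "(\<Sum>n\<in>B j. decay1 (g j) n powr (1 + e)) \<le> 1 + 2 * g j * (1 + 1 / e)"
      using gj by (simp add: algebra_simps)
  qed auto
  finally show ?thesis by (simp add: Pi_fac_def)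
qed

text \<open>There are about \<open>2 * M\<close> such integers, and none at all for
  \<open>M \<le> 1\<close>; this is why the exponent may be raised from 1 to \<open>1 + e\<close> at
  no cost.\<close>

lemma card_int_less_le:
  assumes M: "0 \<le> M" and e: "0 \<le> e"
  shows "finite {n::int. n \<noteq> 0 \<and> \<bar>real_of_int n\<bar> < M}"
    and "real (card {n::int. n \<noteq> 0 \<and> \<bar>real_of_int n\<bar> < M}) \<le> 2 * M powr (1 + e)"
proof -
  let ?S = "{n::int. n \<noteq> 0 \<and> \<bar>real_of_int n\<bar> < M}"
  have sub: "?S \<subseteq> {- \<lfloor>M\<rfloor>..\<lfloor>M\<rfloor>} - {0}"
    by (auto simp: le_floor_iff minus_le_iff) 
  show fin: "finite ?S" by (rule finite_subset[OF sub]) auto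
  show "real (card ?S) \<le> 2 * M powr (1 + e)"
  proof (cases "M \<le> 1")
    case True
    then have "?S = {}" by auto
    then show ?thesis by (simp only:) simp
  next
    case False
    have "card ?S \<le> card ({- \<lfloor>M\<rfloor>..\<lfloor>M\<rfloor>} - {0})" by (rule card_mono) (use sub in auto)
    also have "\<dots> = nat (2 * \<lfloor>M\<rfloor>)" using M by (subst card_Diff_singleton) auto
    finally have "real (card ?S) \<le> 2 * M powr 1" using M by simp linarith
    also have "\<dots> \<le> 2 * M powr (1 + e)" using False e by (intro mult_left_mono powr_mono) auto
    finally show ?thesis .
  qed
qed

text \<open>Each nonzero frequency is classified by its last nonzero coordinate. That coordinate is
  counted directly, giving \<open>2 * M powr (1 + e)\<close>, while the earlier ones are summed by
  zeta bounds; so one factor \<open>1 + 1 / e\<close> is saved against the plain product bound. The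
  zero frequency has no such coordinate and is removed.\<close>

lemma card_decay_set_le:
  assumes g: "\<And>j. 1 \<le> j \<Longrightarrow> 0 < g j \<and> g j \<le> 1" and e: "e > 0" and L: "L > 0"
  defines "A \<equiv> \<lambda>d. {h \<in> int_vecs d. 1 < L * decay d g h}"
  shows "finite (A d) \<and> real (card (A d - {\<lambda>j\<in>{1..d}. 0}))
      \<le> L powr (1 + e) * (Pi_fac d g (1 + 1 / e) - 1) / (1 + 1 / e)"
proof (induction d)
  case 0
  have *: "int_vecs 0 = {\<lambda>j\<in>{1..0}. 0}" by (auto simp: int_vecs_def)
  have "A 0 - {\<lambda>j\<in>{1..0}. 0} = {}" using * by (auto simp: A_def)
  moreover have "finite (A 0)" by (rule finite_subset[of _ "int_vecs 0"]) (auto simp: A_def *)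
  ultimately show ?case by (simp only:) (simp add: Pi_fac_def)
next
  case (Suc d)
  define \<phi> where "\<phi> = (\<lambda>h::nat \<Rightarrow> int. (restrict h {1..d}, h (Suc d)))"
  define c where "c = g (Suc d)"
  have c: "0 < c" "c \<le> 1" using g by (auto simp: c_def)
  define W where "W = (\<lambda>h. {n::int. n \<noteq> 0 \<and> \<bar>real_of_int n\<bar> < L * decay d g h * c})"
  let ?o = "\<lambda>d. \<lambda>j\<in>{1..d}. 0::int"
  have kp: "0 < decay d g h" "0 \<le> decay d g h" for d h using g decay_pos[of g d h] by (auto simp: less_imp_le)
  have inj: "inj_on \<phi> (int_vecs (Suc d))"
  proof (rule inj_onI)
    fix h k assume hk: "h \<in> int_vecs (Suc d)" "k \<in> int_vecs (Suc d)" "\<phi> h = \<phi> k"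
    show "h = k"
    proof (rule PiE_ext)
      show "h \<in> PiE {1..Suc d} (\<lambda>_. UNIV)" "k \<in> PiE {1..Suc d} (\<lambda>_. UNIV)"
        using hk by (auto simp: int_vecs_def)
      fix i assume i: "i \<in> {1..Suc d}"
      show "h i = k i"
      proof (cases "i = Suc d")
        case False
        then have "i \<in> {1..d}" using i by auto
        have "restrict h {1..d} i = restrict k {1..d} i" using hk(3) by (simp add: \<phi>_def)
        then show ?thesis using \<open>i \<in> {1..d}\<close> by simp
      qed (use hk(3) in \<open>simp add: \<phi>_def\<close>)
    qed
  qed
  have A1: "restrict h {1..d} \<in> A d" if "h \<in> A (Suc d)" for h
  proof -
    have "decay (Suc d) g h \<le> decay d g h * 1" unfolding decay_Suc
      using kp decay1_le1[of "g (Suc d)"] g[of "Suc d"] by (intro mult_left_mono) auto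
    then have "L * decay (Suc d) g h \<le> L * decay d g h" using L by simp
    moreover have "1 < L * decay (Suc d) g h" using that by (simp add: A_def)
    ultimately show ?thesis by (simp add: A_def int_vecs_def decay_restrict del: One_nat_def)
  qed
  \<comment> \<open>Splitting off the last coordinate: if it vanishes, a nonzero frequency of
    dimension \<open>d\<close> remains; otherwise it lies in the fibre \<open>W\<close> over a point
    of \<open>A d\<close>.\<close>
  have img: "\<phi> ` (A (Suc d) - {?o (Suc d)}) \<subseteq> (A d - {?o d}) \<times> {0} \<union> Sigma (A d) W"
  proof
    fix y assume "y \<in> \<phi> ` (A (Suc d) - {?o (Suc d)})"
    then obtain h where h: "h \<in> A (Suc d)" "h \<noteq> ?o (Suc d)" "y = \<phi> h" by auto
    have hA: "restrict h {1..d} \<in> A d" by (rule A1[OF h(1)])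
    show "y \<in> (A d - {?o d}) \<times> {0} \<union> Sigma (A d) W"
    proof (cases "h (Suc d) = 0")
      case True
      have "restrict h {1..d} \<noteq> ?o d"
      proof
        assume *: "restrict h {1..d} = ?o d"
        have "\<phi> h = \<phi> (?o (Suc d))" unfolding \<phi>_def using True * by (auto simp: restrict_def fun_eq_iff)
        moreover have "h \<in> int_vecs (Suc d)" "?o (Suc d) \<in> int_vecs (Suc d)"
          using h(1) by (auto simp: A_def int_vecs_def)
        ultimately show False using inj h(2) by (blast dest: inj_onD)
      qed
      then show ?thesis using True hA h(3) by (simp add: \<phi>_def)
    next
      case False
      have "1 < L * (decay d g h * (c / \<bar>real_of_int (h (Suc d))\<bar>))"
        using h(1) False by (simp add: A_def decay_Suc decay1_def c_def)
      then have "h (Suc d) \<in> W (restrict h {1..d})"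
        using False by (simp add: W_def decay_restrict field_simps del: One_nat_def)
      then show ?thesis using hA h(3) by (simp add: \<phi>_def)
    qed
  qed
  have finA: "finite (A d)" using Suc by simp
  have finW: "finite (W h)" for h unfolding W_def using kp c L by (intro card_int_less_le(1)[where e=0]) auto
  have fin: "finite ((A d - {?o d}) \<times> {0::int} \<union> Sigma (A d) W)" using finA finW by auto
  have inj': "inj_on \<phi> (A (Suc d) - {?o (Suc d)})" by (rule inj_on_subset[OF inj]) (auto simp: A_def)
  have "finite (A (Suc d) - {?o (Suc d)})" by (rule inj_on_finite[OF inj' img fin])
  then have f1: "finite (A (Suc d))" by simp
  have "card (A (Suc d) - {?o (Suc d)}) \<le> card ((A d - {?o d}) \<times> {0::int} \<union> Sigma (A d) W)"
    by (rule card_inj_on_le[OF inj' img fin])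
  also have "\<dots> \<le> card ((A d - {?o d}) \<times> {0::int}) + card (Sigma (A d) W)"
    by (rule card_Un_le)
  also have "card (Sigma (A d) W) = (\<Sum>h\<in>A d. card (W h))" using finA finW by (simp add: card_SigmaI)
  finally have "real (card (A (Suc d) - {?o (Suc d)})) \<le> real (card (A d - {?o d})) + (\<Sum>h\<in>A d. real (card (W h)))"
    unfolding card_cartesian_product by (simp only: of_nat_add [symmetric] of_nat_sum [symmetric] of_nat_le_iff card.empty finite.intros card_insert_disjoint empty_iff not_False_eq_True mult_1_right One_nat_def [symmetric])
  also have "(\<Sum>h\<in>A d. real (card (W h))) \<le> (\<Sum>h\<in>A d. 2 * c * L powr (1 + e) * decay d g h powr (1 + e))"
  proof (rule sum_mono)
    fix h
    have "real (card (W h)) \<le> 2 * (L * decay d g h * c) powr (1 + e)"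
      unfolding W_def using kp c L e by (intro card_int_less_le) auto
    also have "\<dots> = 2 * c powr (1 + e) * L powr (1 + e) * decay d g h powr (1 + e)"
      using kp c L by (simp add: powr_mult)
    also have "\<dots> \<le> 2 * c powr 1 * L powr (1 + e) * decay d g h powr (1 + e)"
      using c e by (intro mult_right_mono mult_left_mono powr_mono') auto
    finally show "real (card (W h)) \<le> 2 * c * L powr (1 + e) * decay d g h powr (1 + e)" using c by simp
  qed
  also have "\<dots> = 2 * c * L powr (1 + e) * (\<Sum>h\<in>A d. decay d g h powr (1 + e))"
    by (simp add: sum_distrib_left)
  also have "\<dots> \<le> 2 * c * L powr (1 + e) * Pi_fac d g (1 + 1 / e)"
    using c by (intro mult_left_mono sum_decay_powr_le g e finA) (auto simp: A_def)
  finally have "real (card (A (Suc d) - {?o (Suc d)}))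
     \<le> L powr (1 + e) * (Pi_fac d g (1 + 1 / e) - 1) / (1 + 1 / e)
        + 2 * c * L powr (1 + e) * Pi_fac d g (1 + 1 / e)"
    using conjunct2[OF Suc] by linarith
  also have "\<dots> = L powr (1 + e) * ((Pi_fac d g (1 + 1 / e) - 1) / (1 + 1 / e) + 2 * c * Pi_fac d g (1 + 1 / e))"
    by (simp add: distrib_left)
  \<comment> \<open>The recursion telescopes: \<open>Pi_fac\<close> grows by
    \<open>2 * c * (1 + 1 / e) * Pi_fac d g (1 + 1 / e)\<close> from \<open>d\<close> to
    \<open>Suc d\<close>, and the division by \<open>1 + 1 / e\<close> leaves the contribution of
    the fibres.\<close>
  also have "(Pi_fac d g (1 + 1 / e) - 1) / (1 + 1 / e) + 2 * c * Pi_fac d g (1 + 1 / e)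
     = (Pi_fac (Suc d) g (1 + 1 / e) - 1) / (1 + 1 / e)"
  proof -
    have S: "Pi_fac (Suc d) g x = Pi_fac d g x * (1 + 2 * c * x)" for x by (simp add: Pi_fac_def c_def)
    have "(1 + 1 / e) > 0" using e by (simp add: add_pos_pos)
    then show ?thesis unfolding S by (simp add: field_simps del: distrib_right_numeral) 
  qed
  finally show ?case using f1 by simp
qed

text \<open>Summability gives a \<open>J\<close> beyond which the sum of the \<open>g j\<close> is
  at most \<open>b / (4 * \<tau>)\<close>; by \<open>1 + t \<le> exp t\<close> these factors
  contribute at most a constant times \<open>x powr (b / 2)\<close>. The first \<open>J\<close>
  factors are logarithmic in \<open>x\<close> and together contribute another
  \<open>x powr (b / 2)\<close>. Neither \<open>J\<close> nor the constants depend on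
  \<open>d\<close>.\<close>

lemma Pi_fac_log_le:
  assumes g: "\<And>j. 1 \<le> j \<Longrightarrow> 0 \<le> g j \<and> g j \<le> (1::real)" and sm: "summable (\<lambda>j. g (Suc j))"
    and \<tau>: "\<tau> > 0" and b: "b > 0"
  shows "\<exists>K\<ge>1. \<forall>x\<ge>1. \<forall>d. Pi_fac d g (1 + \<tau> * ln x) \<le> K * x powr b"
proof -
  define S where "S = (\<Sum>j. g (Suc j))"
  have "(\<lambda>n. \<Sum>i. g (Suc (i + n))) \<longlonglongrightarrow> 0"
    using suminf_exist_split2[OF sm] by simp
  then have "\<forall>\<^sub>F n in sequentially. (\<Sum>i. g (Suc (i + n))) < b / (4 * \<tau>)"
    by (rule order_tendstoD) (use \<tau> b in simp)
  then obtain J0 where J0: "(\<Sum>i. g (Suc (i + J0))) < b / (4 * \<tau>)"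
    by (auto simp: eventually_sequentially)
  define J where "J = J0"
  have tail: "(\<Sum>j\<in>{J<..d}. g j) \<le> b / (4 * \<tau>)" for d
  proof -
    have "(\<Sum>j\<in>{J<..d}. g j) \<le> (\<Sum>j\<in>(\<lambda>i. Suc (i + J)) ` {..<d}. g j)"
    proof (rule sum_mono2)
      show "{J<..d} \<subseteq> (\<lambda>i. Suc (i + J)) ` {..<d}"
      proof
        fix j assume "j \<in> {J<..d}"
        then have "j = Suc ((j - Suc J) + J)" "j - Suc J < d" by auto
        then show "j \<in> (\<lambda>i. Suc (i + J)) ` {..<d}" by blast
      qed
    qed (use g in auto)
    also have "\<dots> = (\<Sum>i<d. g (Suc (i + J)))" by (subst sum.reindex) (auto simp: inj_on_def)
    also have "\<dots> \<le> (\<Sum>i. g (Suc (i + J)))"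
      using sm g by (intro sum_le_suminf) (auto simp: summable_iff_shift[of "\<lambda>j. g (Suc j)" J])
    finally show ?thesis using J0 J_def by simp
  qed
  \<comment> \<open>Ensures \<open>J * e \<le> b / 2\<close>; the added 1 covers
    \<open>J = 0\<close>.\<close>
  define e where "e = b / (2 * (real J + 1))"
  have e: "e > 0" using b by (simp add: e_def)
  define C where "C = 1 + 2 * (1 + \<tau> / e)"
  have C: "C \<ge> 1" using e \<tau> by (simp add: C_def)
  show ?thesis
  proof (intro exI[of _ "C ^ J * exp (b / (2 * \<tau>))"] conjI allI impI)
    show "1 \<le> C ^ J * exp (b / (2 * \<tau>))"
      using C b \<tau> mult_mono[of 1 "C^J" 1 "exp (b / (2 * \<tau>))"] by (simp add: one_le_power)
    fix x :: real and d assume x: "1 \<le> x"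
    define y where "y = 1 + \<tau> * ln x"
    have y: "y \<ge> 1" using x \<tau> by (simp add: y_def)
    let ?F = "\<lambda>j. 1 + 2 * g j * y"
    have F1: "1 \<le> ?F j" if "1 \<le> j" for j using g[OF that] y by simp
    \<comment> \<open>For \<open>d < J\<close> the product is padded up to \<open>J\<close>; all
      added factors are at least 1.\<close>
    have "Pi_fac d g y \<le> (\<Prod>j\<in>{1..J} \<union> {J<..d}. ?F j)"
      unfolding Pi_fac_def by (rule prod_mono2) (use F1 in \<open>auto simp: less_imp_le order_trans[OF zero_le_one]\<close>)
    also have "\<dots> = (\<Prod>j\<in>{1..J}. ?F j) * (\<Prod>j\<in>{J<..d}. ?F j)"
      by (rule prod.union_disjoint) auto
    also have "\<dots> \<le> (C ^ J * x powr (b / 2)) * (exp (b / (2 * \<tau>)) * x powr (b / 2))"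
    proof (rule mult_mono)
      have lnx: "ln x \<le> x powr e / e" using ln_powr_bound[OF x e] .
      have xe: "1 \<le> x powr e" using x e by (simp add: ge_one_powr_ge_zero)
      have yb: "y \<le> (1 + \<tau> / e) * x powr e"
        using mult_left_mono[OF lnx, of \<tau>] xe \<tau> by (simp add: y_def algebra_simps)
      have "?F j \<le> C * x powr e" if "j \<in> {1..J}" for j
      proof -
        have "g j * y \<le> 1 * ((1 + \<tau> / e) * x powr e)" using g[of j] that y yb by (intro mult_mono) auto
        then have "1 + 2 * (g j * y) \<le> 1 * x powr e + 2 * ((1 + \<tau> / e) * x powr e)" using xe by linarith
        also have "\<dots> = C * x powr e" unfolding C_def by (simp only: distrib_right mult.assoc)
        finally show ?thesis by (simp add: mult.assoc)
      qed
      then have "(\<Prod>j\<in>{1..J}. ?F j) \<le> (\<Prod>j\<in>{1..J}. C * x powr e)"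
        using F1 by (intro prod_mono) (auto intro: order_trans[OF zero_le_one])
      also have "\<dots> = C ^ J * x powr (real J * e)" using x by (simp add: power_mult_distrib powr_realpow [symmetric] powr_powr mult.commute)
      also have "\<dots> \<le> C ^ J * x powr (b / 2)"
        using x C b by (intro mult_left_mono powr_mono) (auto simp: e_def field_simps)
      finally show "(\<Prod>j\<in>{1..J}. ?F j) \<le> C ^ J * x powr (b / 2)" .
      have "(\<Prod>j\<in>{J<..d}. ?F j) \<le> (\<Prod>j\<in>{J<..d}. exp (2 * g j * y))"
        using F1 by (intro prod_mono) (auto intro: order_trans[OF zero_le_one])
      also have "\<dots> = exp (2 * y * (\<Sum>j\<in>{J<..d}. g j))" by (simp add: exp_sum [symmetric] sum_distrib_left mult_ac)
      also have "\<dots> \<le> exp (2 * y * (b / (4 * \<tau>)))"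
        unfolding exp_le_cancel_iff using tail[of d] y by (intro mult_left_mono) auto
      also have "\<dots> = exp (b / (2 * \<tau>)) * x powr (b / 2)"
        using x \<tau> by (simp add: y_def powr_def exp_add [symmetric] field_simps)
      finally show "(\<Prod>j\<in>{J<..d}. ?F j) \<le> exp (b / (2 * \<tau>)) * x powr (b / 2)" .
    next
      show "0 \<le> C ^ J * x powr (b / 2)" using C by simp
      show "0 \<le> (\<Prod>j\<in>{J<..d}. ?F j)" using F1 by (intro prod_nonneg) (auto intro: order_trans[OF zero_le_one])
    qed
    also have "\<dots> = C ^ J * exp (b / (2 * \<tau>)) * x powr b"
      using x by (simp add: powr_add [symmetric])
    finally show "Pi_fac d g (1 + \<tau> * ln x) \<le> C ^ J * exp (b / (2 * \<tau>)) * x powr b" by (simp add: y_def)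
  qed
qed

section \<open>Fourier series on the torus\<close>

definition echar :: "nat \<Rightarrow> (nat \<Rightarrow> int) \<Rightarrow> (nat \<Rightarrow> real) \<Rightarrow> complex" where
  "echar d h x = cis (2 * pi * dot d h x)"

lemma exp_eq_echar: "exp (2 * of_real pi * \<i> * of_real (dot d h x)) = echar d h x"
  "exp (- 2 * of_real pi * \<i> * of_real (dot d h x)) = cnj (echar d h x)"
proof -
  show "exp (2 * of_real pi * \<i> * of_real (dot d h x)) = echar d h x"
    by (simp add: echar_def cis_conv_exp mult_ac)
  show "exp (- 2 * of_real pi * \<i> * of_real (dot d h x)) = cnj (echar d h x)"
    unfolding echar_def cis_cnj unfolding cis_conv_exp by (simp add: mult_ac)
qed

lemma norm_echar [simp]: "cmod (echar d h x) = 1"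
  by (simp add: echar_def)

text \<open>The restriction keeps the new frequency extensional, hence inside
  \<open>int_vecs d\<close>.\<close>

lemma echar_mult: "echar d h x * echar d k x = echar d (\<lambda>j\<in>{1..d}. h j + k j) x"
  unfolding echar_def cis_mult dot_def
  by (rule arg_cong[of _ _ cis]) (simp add: sum.distrib ring_distribs)

lemma cnj_echar: "cnj (echar d h x) = echar d (\<lambda>j\<in>{1..d}. - h j) x"
  unfolding echar_def cis_cnj dot_def
  by (rule arg_cong[of _ _ cis]) (simp add: sum_negf)

lemma echar_prod: "echar d h x = (\<Prod>j\<in>{1..d}. cis (2 * pi * real_of_int (h j) * x j))"
  unfolding echar_def dot_def by (simp add: cis_conv_exp exp_sum [symmetric] sum_distrib_left mult_ac)

section \<open>The probability space of the cube and orthonormality of the characters\<close>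

abbreviation unit_measure :: "real measure" where
  "unit_measure \<equiv> restrict_space lborel {0..1}"

lemma prob_space_unit: "prob_space unit_measure"
  by (rule prob_space_restrict_space) auto

lemma prob_space_cube: "prob_space (cube_measure d)"
  unfolding cube_measure_def by (rule prob_space_PiM) (rule prob_space_unit)

lemma space_cube: "space (cube_measure d) = cube d"
  by (simp add: cube_measure_def cube_def space_PiM space_restrict_space)

lemma product_sigma_finite_unit: "product_sigma_finite (\<lambda>_::nat. unit_measure)"
  using prob_space_unit by (simp add: product_sigma_finite_def prob_space_imp_sigma_finite)

lemma component_measurable_cube:
  "j \<in> {1..d} \<Longrightarrow> (\<lambda>x. x j) \<in> borel_measurable (cube_measure d)"
  unfolding cube_measure_def
  by (rule measurable_compose[OF measurable_component_singleton])
     (auto intro!: measurable_restrict_space1)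

lemma cis_measurable [measurable]: "cis \<in> borel_measurable borel"
  unfolding cis_conv_exp by (intro borel_measurable_continuous_onI continuous_intros)

lemma echar_measurable [measurable]: "echar d h \<in> borel_measurable (cube_measure d)"
  unfolding echar_def dot_def
  by (intro measurable_compose[OF _ cis_measurable] borel_measurable_times borel_measurable_const
        borel_measurable_sum component_measurable_cube) auto

lemma cnj_measurable [measurable]: "cnj \<in> borel_measurable borel"
  by (intro borel_measurable_continuous_onI continuous_intros)

lemma integrable_cubeI:
  fixes u :: "_ \<Rightarrow> 'b::{banach, second_countable_topology}"
  assumes "u \<in> borel_measurable (cube_measure d)" and "\<And>x. x \<in> cube d \<Longrightarrow> norm (u x) \<le> B"
  shows "integrable (cube_measure d) u"
proof -
  interpret prob_space "cube_measure d" by (rule prob_space_cube)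
  show ?thesis using assms by (intro integrable_const_bound[of _ B]) (auto simp: space_cube intro!: AE_I2)
qed

lemma integral_cis_unit:
  "(\<integral>x. cis (2 * pi * real_of_int n * x) \<partial>unit_measure) = (if n = 0 then 1 else 0)"
proof (cases "n = 0")
  case True
  then show ?thesis using prob_space.prob_space[OF prob_space_unit] by simp
next
  case False
  define c where "c = 2 * pi * real_of_int n"
  have c: "c \<noteq> 0" using False by (simp add: c_def)
  have "(\<integral>x. cis (c * x) \<partial>unit_measure) = (\<integral>x. indicator {0..1} x *\<^sub>R cis (c * x) \<partial>lborel)"
    by (rule integral_restrict_space) simp
  also have "\<dots> = exp (\<i> * of_real (c * 1)) / (\<i> * of_real c) - exp (\<i> * of_real (c * 0)) / (\<i> * of_real c)"
  proof (rule integral_FTC_Icc)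
    fix x :: real
    have "((\<lambda>z. exp (\<i> * (of_real c * z)) / (\<i> * of_real c)) has_field_derivative cis (c * x)) (at (of_real x))"
      using c by (auto intro!: derivative_eq_intros simp: cis_conv_exp field_simps)
    from has_vector_derivative_real_field[OF this]
    show "((\<lambda>x. exp (\<i> * of_real (c * x)) / (\<i> * of_real c)) has_vector_derivative cis (c * x)) (at x within {0..1})"
      by (simp add: has_vector_derivative_at_within)
  qed (auto intro!: continuous_intros simp: cis_conv_exp)
  also have "exp (\<i> * of_real (c * 1)) = cis c" by (simp add: cis_conv_exp)
  also have "cis c = 1" unfolding c_def by (rule cis_multiple_2pi) auto
  finally show ?thesis using False by (simp add: c_def)
qed

lemma integral_echar:
  "(\<integral>x. echar d h x \<partial>cube_measure d) = (if \<forall>j\<in>{1..d}. h j = 0 then 1 else 0)"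
proof -
  interpret product_sigma_finite "\<lambda>_::nat. unit_measure" by (rule product_sigma_finite_unit)
  interpret U: prob_space unit_measure by (rule prob_space_unit)
  have "(\<integral>x. echar d h x \<partial>cube_measure d)
      = (\<Prod>j\<in>{1..d}. \<integral>x. cis (2 * pi * real_of_int (h j) * x) \<partial>unit_measure)"
    unfolding cube_measure_def echar_prod
  proof (rule product_integral_prod)
    fix j
    show "integrable unit_measure (\<lambda>x. cis (2 * pi * real_of_int (h j) * x))"
      by (rule U.integrable_const_bound[of _ 1])
         (auto intro!: measurable_restrict_space1 measurable_compose[OF _ cis_measurable])
  qed simp
  also have "\<dots> = (\<Prod>j\<in>{1..d}. if h j = 0 then 1 else 0)" unfolding integral_cis_unit ..
  also have "\<dots> = (if \<forall>j\<in>{1..d}. h j = 0 then 1 else 0)" by auto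
  finally show ?thesis .
qed

lemma integral_echar_cnj:
  assumes "h \<in> int_vecs d" "k \<in> int_vecs d"
  shows "(\<integral>x. echar d h x * cnj (echar d k x) \<partial>cube_measure d) = (if h = k then 1 else 0)"
proof -
  have "(\<integral>x. echar d h x * cnj (echar d k x) \<partial>cube_measure d)
    = (if \<forall>j\<in>{1..d}. h j + - k j = 0 then 1 else 0)"
    unfolding cnj_echar echar_mult integral_echar by simp
  also have "(\<forall>j\<in>{1..d}. h j + - k j = 0) \<longleftrightarrow> h = k"
    using assms by (auto simp: int_vecs_def intro: PiE_ext)
  finally show ?thesis .
qed

section \<open>Uniform approximation by trigonometric polynomials\<close>

inductive_set trig :: "nat \<Rightarrow> ((nat \<Rightarrow> real) \<Rightarrow> complex) set" for d where
  echar: "h \<in> int_vecs d \<Longrightarrow> echar d h \<in> trig d"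
| scale: "p \<in> trig d \<Longrightarrow> (\<lambda>x. a * p x) \<in> trig d"
| add: "p \<in> trig d \<Longrightarrow> q \<in> trig d \<Longrightarrow> (\<lambda>x. p x + q x) \<in> trig d"

lemma trig_mult_echar:
  assumes "h \<in> int_vecs d" "q \<in> trig d"
  shows "(\<lambda>x. echar d h x * q x) \<in> trig d"
  using assms(2)
proof induction
  case (echar k)
  then show ?case using assms(1) unfolding echar_mult by (intro trig.echar) (auto simp: int_vecs_def)
next
  case (scale p a)
  from trig.scale[OF scale.IH, of a] show ?case by (simp add: mult_ac)
next
  case (add p q)
  from trig.add[OF add.IH] show ?case by (simp add: distrib_left)
qed

text \<open>\<open>trig\<close> is introduced as a linear span only, so that orthogonality passes to
  it by a short induction; the algebra structure required by Stone--Weierstrass is recovered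
  here.\<close>

lemma trig_mult: "p \<in> trig d \<Longrightarrow> q \<in> trig d \<Longrightarrow> (\<lambda>x. p x * q x) \<in> trig d"
proof (induction rule: trig.induct)
  case (echar h)
  then show ?case by (rule trig_mult_echar)
next
  case (scale p a)
  from trig.scale[OF scale.IH[OF scale.prems], of a] show ?case by (simp add: mult_ac)
next
  case (add p p')
  from trig.add[OF add.IH(1)[OF add.prems] add.IH(2)[OF add.prems]] show ?case by (simp add: distrib_right)
qed

lemma trig_const: "(\<lambda>x. c) \<in> trig d"
proof -
  have "echar d (\<lambda>j\<in>{1..d}. 0) \<in> trig d" by (rule trig.echar) (simp add: int_vecs_def)
  from trig.scale[OF this, of c] show ?thesis by (simp add: echar_def dot_def)
qed

lemma trig_coord:
  assumes "j \<in> {1..d}"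
  shows "(\<lambda>x. cis (2 * pi * x j)) \<in> trig d" "(\<lambda>x. cnj (cis (2 * pi * x j))) \<in> trig d"
proof -
  define h :: "nat \<Rightarrow> int" where "h = (\<lambda>i\<in>{1..d}. if i = j then 1 else 0)"
  have "dot d h x = x j" for x
  proof -
    have "dot d h x = (\<Sum>i\<in>{1..d}. if i = j then x i else 0)"
      unfolding dot_def h_def by (intro sum.cong) auto
    then show ?thesis using assms by simp
  qed
  then have e: "echar d h x = cis (2 * pi * x j)" for x by (simp add: echar_def)
  have "echar d h \<in> trig d" by (rule trig.echar) (simp add: int_vecs_def h_def)
  then show "(\<lambda>x. cis (2 * pi * x j)) \<in> trig d" unfolding e[symmetric] .
  have "echar d (\<lambda>i\<in>{1..d}. - h i) \<in> trig d" by (rule trig.echar) (simp add: int_vecs_def)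
  then show "(\<lambda>x. cnj (cis (2 * pi * x j))) \<in> trig d" unfolding e[symmetric] cnj_echar .
qed

text \<open>Glues opposite faces of the cube. Coordinates outside \<open>{1..d}\<close> are mapped
  too, but are constant on \<open>cube d\<close>, where every point takes the value
  \<open>undefined\<close> there.\<close>

definition torus :: "(nat \<Rightarrow> real) \<Rightarrow> nat \<Rightarrow> complex" where
  "torus x = (\<lambda>j. cis (2 * pi * x j))"

text \<open>Outside \<open>{1..d}\<close> a point of the cube can only take the value
  \<open>undefined\<close>, so the cube is a full product of compact sets over all natural numbers
  and Tychonoff's theorem applies.\<close>

lemma compact_cube: "compact (cube d)"
proof -
  have "compactin (product_topology (\<lambda>i::nat. euclidean) UNIV) (PiE UNIV (\<lambda>i. if i \<in> {1..d} then {0..1::real} else {undefined}))"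
    by (subst compactin_PiE) (auto simp: compactin_euclidean_iff)
  moreover have "PiE UNIV (\<lambda>i. if i \<in> {1..d} then {0..1::real} else {undefined}) = cube d"
    by (auto simp: cube_def PiE_iff extensional_def split: if_splits; metis)
  ultimately show ?thesis by (simp add: euclidean_product_topology compactin_euclidean_iff)
qed

lemma continuous_torus: "continuous_on S torus"
proof -
  have "continuous_on S (\<lambda>x. torus x j)" for j
    unfolding torus_def cis_conv_exp
    by (intro continuous_intros continuous_on_product_coordinates continuous_on_subset[OF continuous_on_product_coordinates]) auto
  then show ?thesis by (rule continuous_on_coordinatewise_then_product)
qed

lemma torus_eqD:
  assumes "torus x = torus y"
  shows "x j - y j \<in> \<int>"
proof -
  have "cis (2 * pi * x j) = cis (2 * pi * y j)" using fun_cong[OF assms, of j] by (simp add: torus_def)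
  then have "cis (2 * pi * x j - 2 * pi * y j) = 1" by (simp add: cis_divide [symmetric])
  then obtain n :: int where "2 * pi * x j - 2 * pi * y j = of_int n * (2 * pi)" unfolding cis_eq_1_iff by auto
  then have "(x j - y j) * (2 * pi) = of_int n * (2 * pi)" by (simp add: algebra_simps)
  then have "x j - y j = of_int n" by simp
  then show ?thesis by simp
qed

text \<open>Characters do not separate opposite faces, so Stone--Weierstrass cannot be used on the
  cube itself. Periodicity lets \<open>f\<close> descend to a function \<open>\<phi>\<close> on the
  image \<open>T\<close> of \<open>torus\<close>, where the coordinates separate points.\<close>

lemma trig_approx:
  assumes f: "continuous_on (cube d) f" "one_periodic d f" and e: "0 < e"
  shows "\<exists>p\<in>trig d. \<forall>x\<in>cube d. cmod (complex_of_real (f x) - p x) < e"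
proof -
  define T where "T = torus ` cube d"
  define \<phi> where "\<phi> = (\<lambda>w. f (SOME x. x \<in> cube d \<and> torus x = w))"
  have \<phi>: "\<phi> (torus x) = f x" if "x \<in> cube d" for x
  proof -
    define y where "y = (SOME y. y \<in> cube d \<and> torus y = torus x)"
    have "y \<in> cube d \<and> torus y = torus x"
      unfolding y_def by (rule someI[of _ x]) (use that in simp)
    then have "f y = f x" using f(2) torus_eqD that unfolding one_periodic_def by blast
    then show ?thesis by (simp add: \<phi>_def y_def)
  qed
  \<comment> \<open>A continuous map from a compact space onto a Hausdorff space is a quotient map,
    so continuity of \<open>\<phi>\<close> can be tested after composition with
    \<open>torus\<close>.\<close>
  have q: "quotient_map (top_of_set (cube d)) (top_of_set T) torus"
    by (intro continuous_imp_quotient_map)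
       (auto simp: continuous_map_subtopology_eu continuous_torus compact_cube T_def Hausdorff_space_euclidean Hausdorff_space_subtopology compact_space_subtopology)
  have "continuous_map (top_of_set T) euclidean \<phi>"
  proof (rule continuous_compose_quotient_map[OF q])
    have "continuous_on (cube d) (\<phi> \<circ> torus)"
      using f(1) by (rule continuous_on_eq) (simp add: \<phi>)
    then show "continuous_map (top_of_set (cube d)) euclidean (\<phi> \<circ> torus)" by simp
  qed
  then have cont: "continuous_on T \<phi>" by simp
  \<comment> \<open>A real algebra, as the real form of Stone--Weierstrass demands: functions on
    \<open>T\<close> whose pullback agrees with a trigonometric polynomial on the cube. Real and
    imaginary parts of the coordinates belong to it.\<close>
  define Q where "Q = (\<lambda>q :: (nat \<Rightarrow> complex) \<Rightarrow> real.
     continuous_on T q \<and> (\<exists>p\<in>trig d. \<forall>x\<in>cube d. complex_of_real (q (torus x)) = p x))"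
  have coordQ: "Q (\<lambda>w. Re (w j))" "Q (\<lambda>w. Im (w j))" if j: "j \<in> {1..d}" for j
  proof -
    let ?c = "\<lambda>x::nat\<Rightarrow>real. cis (2 * pi * x j)"
    have c: "continuous_on T (\<lambda>w. w j)"
      by (rule continuous_on_subset[OF continuous_on_product_coordinates]) simp
    have "(\<lambda>x. (1/2) * (?c x + cnj (?c x))) \<in> trig d"
      by (rule trig.scale[OF trig.add[OF trig_coord[OF j]]])
    moreover have "complex_of_real (Re (torus x j)) = (1/2) * (?c x + cnj (?c x))" for x
      by (simp add: torus_def complex_eq_iff)
    ultimately show "Q (\<lambda>w. Re (w j))" unfolding Q_def using continuous_on_Re[OF c]
      by (intro conjI bexI[of _ "\<lambda>x. (1/2) * (?c x + cnj (?c x))"] ballI)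
    have "(\<lambda>x. (- \<i>/2) * (?c x + (-1) * cnj (?c x))) \<in> trig d"
      by (rule trig.scale[OF trig.add[OF trig_coord(1)[OF j] trig.scale[OF trig_coord(2)[OF j]]]])
    moreover have "complex_of_real (Im (torus x j)) = (- \<i>/2) * (?c x + (-1) * cnj (?c x))" for x
      by (simp add: torus_def complex_eq_iff)
    ultimately show "Q (\<lambda>w. Im (w j))" unfolding Q_def using continuous_on_Im[OF c]
      by (intro conjI bexI[of _ "\<lambda>x. (- \<i>/2) * (?c x + (-1) * cnj (?c x))"] ballI)
  qed
  have "\<exists>q. Q q \<and> (\<forall>w\<in>T. \<bar>\<phi> w - q w\<bar> < e)"
  proof (rule Stone_Weierstrass_HOL[where P = Q])
    show "compact T" unfolding T_def by (rule compact_continuous_image[OF continuous_torus compact_cube])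
    show "Q (\<lambda>x. c)" for c unfolding Q_def using trig_const by (auto intro!: bexI)
    show "Q q \<Longrightarrow> continuous_on T q" for q by (simp add: Q_def)
    show "Q (\<lambda>x. q x + r x)" if "Q q \<and> Q r" for q r
    proof -
      have "Q q" "Q r" using that by auto
      obtain p where "p \<in> trig d" "\<forall>x\<in>cube d. complex_of_real (q (torus x)) = p x"
        using \<open>Q q\<close> unfolding Q_def by blast
      moreover obtain p' where "p' \<in> trig d" "\<forall>x\<in>cube d. complex_of_real (r (torus x)) = p' x"
        using \<open>Q r\<close> unfolding Q_def by blast
      moreover have "continuous_on T (\<lambda>x. q x + r x)"
        using that unfolding Q_def by (auto intro: continuous_intros)
      ultimately show ?thesis unfolding Q_def
        by (intro conjI bexI[of _ "\<lambda>x. p x + p' x"] trig.add) auto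
    qed
    show "Q (\<lambda>x. q x * r x)" if "Q q \<and> Q r" for q r
    proof -
      have "Q q" "Q r" using that by auto
      obtain p where "p \<in> trig d" "\<forall>x\<in>cube d. complex_of_real (q (torus x)) = p x"
        using \<open>Q q\<close> unfolding Q_def by blast
      moreover obtain p' where "p' \<in> trig d" "\<forall>x\<in>cube d. complex_of_real (r (torus x)) = p' x"
        using \<open>Q r\<close> unfolding Q_def by blast
      moreover have "continuous_on T (\<lambda>x. q x * r x)"
        using that unfolding Q_def by (auto intro: continuous_intros)
      ultimately show ?thesis unfolding Q_def
        by (intro conjI bexI[of _ "\<lambda>x. p x * p' x"] trig_mult) auto
    qed
    show "\<exists>q. Q q \<and> q v \<noteq> q w" if vw: "v \<in> T \<and> w \<in> T \<and> v \<noteq> w" for v w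
    proof -
      obtain x y where xy: "x \<in> cube d" "y \<in> cube d" "v = torus x" "w = torus y" using vw by (auto simp: T_def)
      \<comment> \<open>Distinct points of \<open>T\<close> must differ in a coordinate from
        \<open>{1..d}\<close>, since all others are constant on the cube.\<close>
      have "\<exists>j\<in>{1..d}. v j \<noteq> w j"
      proof (rule ccontr)
        assume *: "\<not> ?thesis"
        have "v j = w j" for j
        proof (cases "j \<in> {1..d}")
          case False
          then have "x j = y j" using xy by (simp add: cube_def PiE_iff extensional_def)
          then show ?thesis using xy by (simp add: torus_def)
        qed (use * in auto)
        then show False using vw by auto
      qed
      then obtain j where j: "j \<in> {1..d}" "Re (v j) \<noteq> Re (w j) \<or> Im (v j) \<noteq> Im (w j)"
        by (auto simp: complex_eq_iff)
      then show ?thesis using coordQ[OF j(1)] by blast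
    qed
  qed (use cont e in auto)
  then obtain q where q: "Q q" "\<And>w. w \<in> T \<Longrightarrow> \<bar>\<phi> w - q w\<bar> < e" by blast
  then obtain p where p: "p \<in> trig d" "\<And>x. x \<in> cube d \<Longrightarrow> complex_of_real (q (torus x)) = p x"
    unfolding Q_def by blast
  have "cmod (complex_of_real (f x) - p x) < e" if "x \<in> cube d" for x
  proof -
    have "cmod (complex_of_real (f x) - p x) = \<bar>\<phi> (torus x) - q (torus x)\<bar>"
      using p(2)[OF that, symmetric] \<phi>[OF that] by (simp flip: of_real_diff)
    then show ?thesis using q(2)[of "torus x"] that by (simp add: T_def)
  qed
  then show ?thesis using p(1) by blast
qed

section \<open>Mean-square convergence of Fourier series\<close>

lemma fourier_coeff_eq:
  "fourier_coeff d f h = (\<integral>x. complex_of_real (f x) * cnj (echar d h x) \<partial>cube_measure d)"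
  by (simp only: fourier_coeff_def exp_eq_echar)

definition fourier_partial_sum :: "nat \<Rightarrow> ((nat \<Rightarrow> real) \<Rightarrow> real) \<Rightarrow> (nat \<Rightarrow> int) set \<Rightarrow> (nat \<Rightarrow> real) \<Rightarrow> complex" where
  "fourier_partial_sum d f F x = (\<Sum>h\<in>F. fourier_coeff d f h * echar d h x)"

lemma measurable_partial_sum [measurable]:
  "fourier_partial_sum d f F \<in> borel_measurable (cube_measure d)"
  unfolding fourier_partial_sum_def by measurable

lemma norm_echar_sum_le: "cmod (\<Sum>h\<in>F. c h * echar d h x) \<le> (\<Sum>h\<in>F. cmod (c h))"
  by (rule order_trans[OF norm_sum]) (simp add: norm_mult)

lemma trig_measurable_bounded:
  assumes "p \<in> trig d"
  shows "p \<in> borel_measurable (cube_measure d) \<and> (\<exists>B. \<forall>x. cmod (p x) \<le> B)"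
  using assms
proof induction
  case (echar h)
  have "cmod (echar d h x) \<le> 1" for x by simp
  then show ?case by (blast intro: echar_measurable)
next
  case (scale p a)
  then obtain B where "\<And>x. cmod (p x) \<le> B" by blast
  then have "cmod (a * p x) \<le> cmod a * B" for x by (simp add: norm_mult mult_left_mono)
  then show ?case using scale.IH by (intro conjI) (auto intro!: borel_measurable_times)
next
  case (add p q)
  then obtain B C where "\<And>x. cmod (p x) \<le> B" "\<And>x. cmod (q x) \<le> C" by blast
  then have "cmod (p x + q x) \<le> B + C" for x by (meson add_mono norm_triangle_le)
  then show ?case using add.IH by (intro conjI) (auto intro!: borel_measurable_add)
qed

locale bounded_on_cube =
  fixes d :: nat and f :: "(nat \<Rightarrow> real) \<Rightarrow> real" and B :: real
  assumes f_meas [measurable]: "f \<in> borel_measurable (cube_measure d)"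
    and f_bound: "x \<in> cube d \<Longrightarrow> \<bar>f x\<bar> \<le> B"
begin

abbreviation "res F x \<equiv> complex_of_real (f x) - fourier_partial_sum d f F x"

lemma res_bound: "x \<in> cube d \<Longrightarrow> cmod (res F x) \<le> B + (\<Sum>h\<in>F. cmod (fourier_coeff d f h))"
proof -
  assume "x \<in> cube d"
  then have "cmod (complex_of_real (f x)) \<le> B" by (simp add: f_bound)
  with norm_echar_sum_le[of "fourier_coeff d f" d x F] show ?thesis
    unfolding fourier_partial_sum_def by (meson add_mono norm_triangle_le_diff)
qed

lemma integrable_res_mult:
  assumes "p \<in> borel_measurable (cube_measure d)" "\<And>x. x \<in> cube d \<Longrightarrow> cmod (p x) \<le> C"
  shows "integrable (cube_measure d) (\<lambda>x. res F x * cnj (p x))"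
proof (rule integrable_cubeI)
  show "(\<lambda>x. res F x * cnj (p x)) \<in> borel_measurable (cube_measure d)" using assms(1) by measurable
  fix x assume x: "x \<in> cube d"
  show "cmod (res F x * cnj (p x)) \<le> (B + (\<Sum>h\<in>F. cmod (fourier_coeff d f h))) * C"
    unfolding norm_mult complex_mod_cnj using res_bound[OF x, of F] assms(2)[OF x]
    by (intro mult_mono) (auto intro: order_trans[OF norm_ge_zero])
qed

lemma res_orth_echar:
  assumes F: "finite F" "F \<subseteq> int_vecs d" and k: "k \<in> F"
  shows "(\<integral>x. res F x * cnj (echar d k x) \<partial>cube_measure d) = 0"
proof -
  have i: "integrable (cube_measure d) (\<lambda>x. echar d h x * cnj (echar d k x))" for h
    by (rule integrable_cubeI[of _ _ 1]) (auto simp: norm_mult)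
  have "(\<integral>x. res F x * cnj (echar d k x) \<partial>cube_measure d)
     = (\<integral>x. complex_of_real (f x) * cnj (echar d k x)
          - (\<Sum>h\<in>F. fourier_coeff d f h * (echar d h x * cnj (echar d k x))) \<partial>cube_measure d)"
    unfolding fourier_partial_sum_def by (simp add: left_diff_distrib sum_distrib_right mult.assoc)
  also have "\<dots> = (\<integral>x. complex_of_real (f x) * cnj (echar d k x) \<partial>cube_measure d)
          - (\<integral>x. (\<Sum>h\<in>F. fourier_coeff d f h * (echar d h x * cnj (echar d k x))) \<partial>cube_measure d)"
    by (intro Bochner_Integration.integral_diff Bochner_Integration.integrable_sum integrable_mult_right i
          integrable_cubeI[of _ _ B]) (auto simp: norm_mult f_bound)
  also have "(\<integral>x. (\<Sum>h\<in>F. fourier_coeff d f h * (echar d h x * cnj (echar d k x))) \<partial>cube_measure d)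
     = (\<Sum>h\<in>F. fourier_coeff d f h * (\<integral>x. echar d h x * cnj (echar d k x) \<partial>cube_measure d))"
    using i by (subst Bochner_Integration.integral_sum) auto
  also have "\<dots> = (\<Sum>h\<in>F. if h = k then fourier_coeff d f h else 0)"
    using F k by (intro sum.cong refl) (auto simp: integral_echar_cnj subset_eq)
  also have "\<dots> = fourier_coeff d f k" using F k by simp
  finally show ?thesis by (simp add: fourier_coeff_eq)
qed

text \<open>\<open>F0\<close> plays the role of the spectrum of \<open>p\<close>; the existential
  form avoids carrying an explicit expansion of \<open>p\<close>.\<close>

lemma res_orth_trig:
  assumes "p \<in> trig d"
  shows "\<exists>F0. finite F0 \<and> F0 \<subseteq> int_vecs d \<and> (\<forall>F. finite F \<longrightarrow> F0 \<subseteq> F \<longrightarrow> F \<subseteq> int_vecs d \<longrightarrow>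
     (\<integral>x. res F x * cnj (p x) \<partial>cube_measure d) = 0)"
  using assms
proof induction
  case (echar h)
  then show ?case using res_orth_echar by (intro exI[of _ "{h}"]) auto
next
  case (scale p a)
  then obtain F0 where F0: "finite F0" "F0 \<subseteq> int_vecs d"
    "\<And>F. finite F \<Longrightarrow> F0 \<subseteq> F \<Longrightarrow> F \<subseteq> int_vecs d \<Longrightarrow> (\<integral>x. res F x * cnj (p x) \<partial>cube_measure d) = 0"
    by blast
  have "(\<integral>x. res F x * cnj (a * p x) \<partial>cube_measure d) = cnj a * (\<integral>x. res F x * cnj (p x) \<partial>cube_measure d)" for F
    by (subst integral_mult_right_zero [symmetric]) (simp add: mult_ac)
  with F0 show ?case by (intro exI[of _ F0]) auto
next
  case (add p q)
  obtain F0 where F0: "finite F0" "F0 \<subseteq> int_vecs d"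
    "\<And>F. finite F \<Longrightarrow> F0 \<subseteq> F \<Longrightarrow> F \<subseteq> int_vecs d \<Longrightarrow> (\<integral>x. res F x * cnj (p x) \<partial>cube_measure d) = 0"
    using add.IH by blast
  obtain F1 where F1: "finite F1" "F1 \<subseteq> int_vecs d"
    "\<And>F. finite F \<Longrightarrow> F1 \<subseteq> F \<Longrightarrow> F \<subseteq> int_vecs d \<Longrightarrow> (\<integral>x. res F x * cnj (q x) \<partial>cube_measure d) = 0"
    using add.IH by blast
  have "(\<integral>x. res F x * cnj (p x + q x) \<partial>cube_measure d)
      = (\<integral>x. res F x * cnj (p x) \<partial>cube_measure d) + (\<integral>x. res F x * cnj (q x) \<partial>cube_measure d)" for F
  proof -
    obtain Bp Bq where b: "\<And>x. cmod (p x) \<le> Bp" "\<And>x. cmod (q x) \<le> Bq"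
      using trig_measurable_bounded[OF add.hyps(1)] trig_measurable_bounded[OF add.hyps(2)] by blast
    have m: "p \<in> borel_measurable (cube_measure d)" "q \<in> borel_measurable (cube_measure d)"
      using trig_measurable_bounded[OF add.hyps(1)] trig_measurable_bounded[OF add.hyps(2)] by auto
    have "(\<integral>x. res F x * cnj (p x) + res F x * cnj (q x) \<partial>cube_measure d)
      = (\<integral>x. res F x * cnj (p x) \<partial>cube_measure d) + (\<integral>x. res F x * cnj (q x) \<partial>cube_measure d)"
      using b by (intro Bochner_Integration.integral_add integrable_res_mult m) blast+
    then show ?thesis by (simp add: distrib_left)
  qed
  with F0 F1 show ?case by (intro exI[of _ "F0 \<union> F1"]) auto
qed

text \<open>With a trigonometric polynomial \<open>p\<close> uniformly within \<open>e\<close> of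
  \<open>f\<close>, the residual is \<open>(f - p) + p - P\<close>, where \<open>P\<close> is the
  partial sum. It is orthogonal to \<open>P\<close>, and to \<open>p\<close> once \<open>F\<close>
  contains \<open>F0\<close>, so its square integral equals its pairing with \<open>f - p\<close>.
  Absolute summability of the coefficients bounds the residual uniformly in
  \<open>F\<close>.\<close>

lemma integral_res_square_le:
  assumes cont: "continuous_on (cube d) f" and per: "one_periodic d f"
    and sm: "(\<lambda>h. cmod (fourier_coeff d f h)) summable_on int_vecs d" and e: "0 < e"
  shows "\<exists>F0. finite F0 \<and> F0 \<subseteq> int_vecs d \<and> (\<forall>F. finite F \<longrightarrow> F0 \<subseteq> F \<longrightarrow> F \<subseteq> int_vecs d \<longrightarrow>
     (\<integral>x. (cmod (res F x))\<^sup>2 \<partial>cube_measure d)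
        \<le> (B + (\<Sum>\<^sub>\<infinity>h\<in>int_vecs d. cmod (fourier_coeff d f h))) * e)"
proof -
  interpret C: prob_space "cube_measure d" by (rule prob_space_cube)
  let ?S = "\<Sum>\<^sub>\<infinity>h\<in>int_vecs d. cmod (fourier_coeff d f h)"
  obtain p where p: "p \<in> trig d" "\<And>x. x \<in> cube d \<Longrightarrow> cmod (complex_of_real (f x) - p x) < e"
    using trig_approx[OF cont per e] by blast
  obtain Bp where Bp: "\<And>x. cmod (p x) \<le> Bp" using trig_measurable_bounded[OF p(1)] by blast
  have pm [measurable]: "p \<in> borel_measurable (cube_measure d)" using trig_measurable_bounded[OF p(1)] by blast
  obtain F0 where F0: "finite F0" "F0 \<subseteq> int_vecs d"
    "\<And>F. finite F \<Longrightarrow> F0 \<subseteq> F \<Longrightarrow> F \<subseteq> int_vecs d \<Longrightarrow> (\<integral>x. res F x * cnj (p x) \<partial>cube_measure d) = 0"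
    using res_orth_trig[OF p(1)] by blast
  have "(\<integral>x. (cmod (res F x))\<^sup>2 \<partial>cube_measure d) \<le> (B + ?S) * e"
    if F: "finite F" "F0 \<subseteq> F" "F \<subseteq> int_vecs d" for F
  proof -
    let ?P = "fourier_partial_sum d f F"
    have S: "(\<Sum>h\<in>F. cmod (fourier_coeff d f h)) \<le> ?S"
      using F sm by (intro finite_sum_le_infsum) auto
    have P0: "(\<integral>x. res F x * cnj (?P x) \<partial>cube_measure d) = 0"
    proof -
      have "(\<integral>x. res F x * cnj (?P x) \<partial>cube_measure d)
         = (\<integral>x. (\<Sum>k\<in>F. cnj (fourier_coeff d f k) * (res F x * cnj (echar d k x))) \<partial>cube_measure d)"
        unfolding fourier_partial_sum_def[of d f F] cnj_sum sum_distrib_left by (simp add: mult_ac)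
      also have "\<dots> = (\<Sum>k\<in>F. cnj (fourier_coeff d f k) * (\<integral>x. res F x * cnj (echar d k x) \<partial>cube_measure d))"
        by (subst Bochner_Integration.integral_sum)
           (auto intro!: integrable_mult_right integrable_res_mult[of _ 1])
      also have "\<dots> = 0" using res_orth_echar[OF F(1) F(3)] by simp
      finally show ?thesis .
    qed
    have i1: "integrable (cube_measure d) (\<lambda>x. res F x * cnj (complex_of_real (f x) - p x))"
      using p(2) by (intro integrable_res_mult[of _ e]) (auto intro: less_imp_le)
    have i2: "integrable (cube_measure d) (\<lambda>x. res F x * cnj (p x))"
      using Bp by (intro integrable_res_mult) auto
    have i3: "integrable (cube_measure d) (\<lambda>x. res F x * cnj (?P x))"
      using norm_echar_sum_le[of "fourier_coeff d f" d _ F]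
      by (intro integrable_res_mult) (auto simp: fourier_partial_sum_def)
    have "complex_of_real (\<integral>x. (cmod (res F x))\<^sup>2 \<partial>cube_measure d)
       = (\<integral>x. res F x * cnj (complex_of_real (f x) - p x) + res F x * cnj (p x) - res F x * cnj (?P x) \<partial>cube_measure d)"
      unfolding integral_complex_of_real[symmetric] complex_norm_square
      by (rule Bochner_Integration.integral_cong) (auto simp: algebra_simps)
    also have "\<dots> = (\<integral>x. res F x * cnj (complex_of_real (f x) - p x) \<partial>cube_measure d)"
      using i1 i2 i3 P0 F0(3)[OF F] by (simp only: Bochner_Integration.integral_add Bochner_Integration.integral_diff Bochner_Integration.integrable_add) simp
    finally have "cmod (complex_of_real (\<integral>x. (cmod (res F x))\<^sup>2 \<partial>cube_measure d))
       \<le> (\<integral>x. cmod (res F x * cnj (complex_of_real (f x) - p x)) \<partial>cube_measure d)"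
      by (simp only: integral_norm_bound)
    also have "\<dots> \<le> (\<integral>x. (B + ?S) * e \<partial>cube_measure d)"
    proof (rule integral_mono)
      fix x assume "x \<in> space (cube_measure d)"
      then have x: "x \<in> cube d" by (simp add: space_cube)
      show "cmod (res F x * cnj (complex_of_real (f x) - p x)) \<le> (B + ?S) * e"
        unfolding norm_mult complex_mod_cnj using res_bound[OF x, of F] S p(2)[OF x] norm_ge_zero[of "res F x"]
        by (intro mult_mono) (linarith | simp)+
    qed (use i1 in \<open>auto intro: integrable_norm\<close>)
    also have "\<dots> = (B + ?S) * e" using C.prob_space by simp
    finally show ?thesis by (simp only: norm_of_real)
  qed
  with F0 show ?thesis by blast
qed

end

section \<open>From mean-square to pointwise convergence\<close>

lemma emeasure_unit_open_pos:
  assumes "open V" "t \<in> V" "t \<in> {0..1}"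
  shows "V \<inter> {0..1} \<in> sets unit_measure" "0 < emeasure unit_measure (V \<inter> {0..1})"
proof -
  show s: "V \<inter> {0..1} \<in> sets unit_measure"
    using assms(1) by (auto simp: sets_restrict_space_iff)
  obtain e where e: "e > 0" "\<And>y. \<bar>y - t\<bar> < e \<Longrightarrow> y \<in> V"
    using assms(1,2) by (metis open_dist dist_real_def)
  \<comment> \<open>Clipping at 0 and 1 leaves a one-sided interval of positive length when
    \<open>t\<close> is an endpoint.\<close>
  define a b where "a = max 0 (t - e/2)" and "b = min 1 (t + e/2)"
  have ab: "a < b" using e assms(3) by (auto simp: a_def b_def)
  have "{a..b} \<subseteq> V \<inter> {0..1}"
  proof
    fix y assume "y \<in> {a..b}"
    then have "\<bar>y - t\<bar> < e" "y \<in> {0..1}" using e(1) assms(3) by (auto simp: a_def b_def abs_less_iff)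
    then show "y \<in> V \<inter> {0..1}" using e(2) by simp
  qed
  then have "emeasure lborel {a..b} \<le> emeasure lborel (V \<inter> {0..1})"
    using assms(1) by (intro emeasure_mono) auto
  moreover have "emeasure lborel {a..b} = ennreal (b - a)" using ab by simp
  moreover have "emeasure unit_measure (V \<inter> {0..1}) = emeasure lborel (V \<inter> {0..1})"
    by (rule emeasure_restrict_space) auto
  ultimately show "0 < emeasure unit_measure (V \<inter> {0..1})"
    using ab by (metis diff_gt_0_iff_gt ennreal_less_zero_iff order_less_le_trans)
qed

text \<open>A basic open box around \<open>x\<close> inside \<open>U\<close> is measurable by
  construction, and its measure is a finite product of positive lengths.\<close>

lemma open_cube_box:
  assumes U: "open U" "x \<in> U" "x \<in> cube d"
  shows "\<exists>E. E \<in> sets (cube_measure d) \<and> E \<subseteq> U \<inter> cube d \<and> 0 < measure (cube_measure d) E"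
proof -
  interpret product_sigma_finite "\<lambda>_::nat. unit_measure" by (rule product_sigma_finite_unit)
  interpret C: prob_space "cube_measure d" by (rule prob_space_cube)
  obtain X where X: "x \<in> PiE UNIV X" "\<And>i. open (X i)" "PiE UNIV X \<subseteq> U"
    using product_topology_open_contains_basis[of "\<lambda>_. euclidean" UNIV U x] U
    by (auto simp: open_fun_def)
  define E where "E = PiE {1..d} (\<lambda>j. X j \<inter> {0..1})"
  have xj: "x j \<in> {0..1}" if "j \<in> {1..d}" for j using U(3) that by (auto simp: cube_def PiE_iff)
  have s: "X j \<inter> {0..1} \<in> sets unit_measure" "0 < emeasure unit_measure (X j \<inter> {0..1})" if "j \<in> {1..d}" for j
    using emeasure_unit_open_pos[of "X j" "x j"] X xj[OF that] by (auto simp: PiE_iff)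
  have "emeasure (cube_measure d) E = (\<Prod>j\<in>{1..d}. emeasure unit_measure (X j \<inter> {0..1}))"
    unfolding E_def cube_measure_def using s by (intro emeasure_PiM) auto
  also have "\<dots> \<noteq> 0" using s(2) by (simp add: prod_zero_iff) (metis less_irrefl atLeastAtMost_iff One_nat_def)
  finally have "emeasure (cube_measure d) E \<noteq> 0" .
  then have "0 < measure (cube_measure d) E"
    by (simp add: C.emeasure_eq_measure zero_less_measure_iff)
  moreover have "E \<in> sets (cube_measure d)" unfolding E_def cube_measure_def using s by (intro sets_PiM_I_finite) auto
  moreover have "E \<subseteq> U \<inter> cube d"
  proof
    fix y assume y: "y \<in> E"
    then have "y \<in> cube d" by (auto simp: E_def cube_def PiE_iff)
    moreover have "y i \<in> X i" for i
    proof (cases "i \<in> {1..d}")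
      case True then show ?thesis using y by (auto simp: E_def PiE_iff)
    next
      case False
      then have "y i = x i" using y U(3) by (simp add: E_def cube_def PiE_iff extensional_def)
      then show ?thesis using X(1) by (auto simp: PiE_iff)
    qed
    then have "y \<in> U" using X(3) by (auto simp: PiE_iff)
    ultimately show "y \<in> U \<inter> cube d" by simp
  qed
  ultimately show ?thesis by blast
qed

lemma continuous_on_partial_sum: "continuous_on S (fourier_partial_sum d f F)"
  unfolding fourier_partial_sum_def echar_def cis_conv_exp dot_def
  by (intro continuous_intros continuous_on_subset[OF continuous_on_product_coordinates]) auto

text \<open>Characters have modulus 1, so the tail of the sum of the \<open>cmod (c h)\<close>
  controls the remainder for every \<open>x\<close> with the same \<open>F0\<close>.\<close>

lemma infsum_echar_tail:
  assumes sm: "(\<lambda>h. cmod (c h)) summable_on I" and e: "0 < e"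
  shows "\<exists>F0. finite F0 \<and> F0 \<subseteq> I \<and> (\<forall>F x. finite F \<longrightarrow> F0 \<subseteq> F \<longrightarrow> F \<subseteq> I \<longrightarrow>
    cmod ((\<Sum>\<^sub>\<infinity>h\<in>I. c h * echar d h x) - (\<Sum>h\<in>F. c h * echar d h x)) \<le> e)"
proof -
  obtain F0 where F0: "finite F0" "F0 \<subseteq> I" "dist (\<Sum>h\<in>F0. cmod (c h)) (\<Sum>\<^sub>\<infinity>h\<in>I. cmod (c h)) \<le> e"
    using infsum_finite_approximation[OF sm e] by blast
  have "cmod ((\<Sum>\<^sub>\<infinity>h\<in>I. c h * echar d h x) - (\<Sum>h\<in>F. c h * echar d h x)) \<le> e"
    if F: "finite F" "F0 \<subseteq> F" "F \<subseteq> I" for F x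
  proof -
    have sm': "(\<lambda>h. cmod (c h * echar d h x)) summable_on I" using sm by (simp add: norm_mult)
    have sc: "(\<lambda>h. c h * echar d h x) summable_on (I - F)"
      by (rule abs_summable_summable, rule summable_on_subset[OF _ Diff_subset]) (use sm' in simp)
    have I: "I = F \<union> (I - F)" using F by auto
    have "(\<Sum>\<^sub>\<infinity>h\<in>I. c h * echar d h x) = (\<Sum>\<^sub>\<infinity>h\<in>F. c h * echar d h x) + (\<Sum>\<^sub>\<infinity>h\<in>I - F. c h * echar d h x)"
      by (subst I, subst infsum_Un_disjoint) (use F sc in auto)
    then have "cmod ((\<Sum>\<^sub>\<infinity>h\<in>I. c h * echar d h x) - (\<Sum>h\<in>F. c h * echar d h x)) = cmod (\<Sum>\<^sub>\<infinity>h\<in>I - F. c h * echar d h x)"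
      using F by simp
    also have "\<dots> \<le> (\<Sum>\<^sub>\<infinity>h\<in>I - F. cmod (c h * echar d h x))"
      by (rule norm_infsum_bound) (rule summable_on_subset[OF sm' Diff_subset])
    also have "\<dots> = (\<Sum>\<^sub>\<infinity>h\<in>I - F. cmod (c h))" by (simp add: norm_mult)
    also have "\<dots> = (\<Sum>\<^sub>\<infinity>h\<in>I. cmod (c h)) - (\<Sum>h\<in>F. cmod (c h))"
    proof -
      have "(\<Sum>\<^sub>\<infinity>h\<in>I. cmod (c h)) = (\<Sum>\<^sub>\<infinity>h\<in>F. cmod (c h)) + (\<Sum>\<^sub>\<infinity>h\<in>I - F. cmod (c h))"
        by (subst I, subst infsum_Un_disjoint) (use F sm in \<open>auto intro: summable_on_subset[OF _ Diff_subset]\<close>)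
      then show ?thesis using F by simp
    qed
    also have "\<dots> \<le> (\<Sum>\<^sub>\<infinity>h\<in>I. cmod (c h)) - (\<Sum>h\<in>F0. cmod (c h))"
      using F by (intro diff_left_mono sum_mono2) auto
    also have "\<dots> \<le> e" using F0(3) by (simp add: dist_real_def)
    finally show ?thesis .
  qed
  with F0 show ?thesis by blast
qed

text \<open>Suppose the two sides differ by \<open>4 * \<delta>\<close> at \<open>x0\<close>. A late
  partial sum then misses \<open>f\<close> by more than \<open>3 * \<delta>\<close> at
  \<open>x0\<close>, and by continuity on a set of positive measure. Uniform convergence keeps all
  later residuals at least \<open>\<delta>\<close> there, against mean-square convergence to 0.
  Continuity is applied to finite sums only.\<close>

theorem fourier_series_pointwise:
  assumes f_meas: "f \<in> borel_measurable (cube_measure d)"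
    and cont: "continuous_on (cube d) f" and per: "one_periodic d f"
    and sm: "(\<lambda>h. cmod (fourier_coeff d f h)) summable_on int_vecs d" and x0: "x0 \<in> cube d"
  shows "(\<Sum>\<^sub>\<infinity>h\<in>int_vecs d. fourier_coeff d f h * echar d h x0) = complex_of_real (f x0)"
proof (rule ccontr)
  interpret C: prob_space "cube_measure d" by (rule prob_space_cube)
  let ?c = "fourier_coeff d f"
  let ?g = "\<lambda>x. \<Sum>\<^sub>\<infinity>h\<in>int_vecs d. ?c h * echar d h x"
  let ?S = "\<Sum>\<^sub>\<infinity>h\<in>int_vecs d. cmod (?c h)"
  assume neq: "?g x0 \<noteq> complex_of_real (f x0)"
  obtain B where B: "\<And>x. x \<in> cube d \<Longrightarrow> \<bar>f x\<bar> \<le> B"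
    using compact_imp_bounded[OF compact_continuous_image[OF cont compact_cube]]
    by (auto simp: bounded_iff)
  interpret bounded_on_cube d f B by unfold_locales (use f_meas B in auto)
  define \<delta> where "\<delta> = cmod (complex_of_real (f x0) - ?g x0) / 4"
  have \<delta>: "\<delta> > 0" using neq by (simp add: \<delta>_def)
  obtain F1 where F1: "finite F1" "F1 \<subseteq> int_vecs d"
    "\<And>F x. finite F \<Longrightarrow> F1 \<subseteq> F \<Longrightarrow> F \<subseteq> int_vecs d \<Longrightarrow> cmod (?g x - fourier_partial_sum d f F x) \<le> \<delta> / 2"
    using infsum_echar_tail[OF sm, of "\<delta>/2" d] \<delta> unfolding fourier_partial_sum_def by auto
  have big: "3 * \<delta> < cmod (res F1 x0)"
  proof -
    have "4 * \<delta> = cmod (res F1 x0 + (fourier_partial_sum d f F1 x0 - ?g x0))" by (simp add: \<delta>_def)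
    also have "\<dots> \<le> cmod (res F1 x0) + cmod (fourier_partial_sum d f F1 x0 - ?g x0)" by (rule norm_triangle_ineq)
    also have "cmod (fourier_partial_sum d f F1 x0 - ?g x0) \<le> \<delta> / 2"
      using F1(3)[OF F1(1) order_refl F1(2), of x0] by (simp add: norm_minus_commute)
    finally show ?thesis using \<delta> by linarith
  qed
  have "continuous_on (cube d) (\<lambda>x. cmod (res F1 x))"
    by (intro continuous_intros cont continuous_on_partial_sum)
  then obtain U where U: "open U" "U \<inter> cube d = (\<lambda>x. cmod (res F1 x)) -` {3 * \<delta><..} \<inter> cube d"
    using continuous_on_open_invariant[of "cube d" "\<lambda>x. cmod (res F1 x)"] open_greaterThan by metis
  have "x0 \<in> U" using U(2) big x0 by auto
  from open_cube_box[OF U(1) this x0] obtain E where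
    E: "E \<in> sets (cube_measure d)" "E \<subseteq> U \<inter> cube d" "0 < measure (cube_measure d) E" by blast
  define m where "m = measure (cube_measure d) E"
  have "B \<ge> 0" using f_bound[OF x0] by linarith
  have "?S \<ge> 0" by (intro infsum_nonneg) auto
  \<comment> \<open>Chosen so that \<open>(B + ?S + 1) * e\<close> is half of
    \<open>\<delta>\<^sup>2 * m\<close>, the lower bound for the square integral.\<close>
  define e where "e = \<delta>\<^sup>2 * m / (2 * (B + ?S + 1))"
  have e: "e > 0" using \<delta> E(3) \<open>B \<ge> 0\<close> \<open>?S \<ge> 0\<close> by (simp add: e_def m_def)
  obtain F2 where F2: "finite F2" "F2 \<subseteq> int_vecs d"
    "\<And>F. finite F \<Longrightarrow> F2 \<subseteq> F \<Longrightarrow> F \<subseteq> int_vecs d \<Longrightarrow> (\<integral>x. (cmod (res F x))\<^sup>2 \<partial>cube_measure d) \<le> (B + ?S) * e"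
    using integral_res_square_le[OF cont per sm e] by blast
  define F where "F = F1 \<union> F2"
  have F: "finite F" "F1 \<subseteq> F" "F2 \<subseteq> F" "F \<subseteq> int_vecs d" using F1 F2 by (auto simp: F_def)
  \<comment> \<open>Passing from \<open>F1\<close> to \<open>F\<close> changes the residual by at
    most twice \<open>\<delta> / 2\<close>, out of more than \<open>3 * \<delta>\<close>.\<close>
  have low: "\<delta> \<le> cmod (res F x)" if "x \<in> E" for x
  proof -
    have "3 * \<delta> < cmod (res F1 x)" using U(2) E(2) that by auto
    also have "res F1 x = res F x + ((?g x - fourier_partial_sum d f F1 x) - (?g x - fourier_partial_sum d f F x))" by simp
    also have "cmod \<dots> \<le> cmod (res F x) + (cmod (?g x - fourier_partial_sum d f F1 x) + cmod (?g x - fourier_partial_sum d f F x))"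
      by (meson add_left_mono norm_triangle_ineq norm_triangle_ineq4 order_trans)
    finally show ?thesis using F1(3)[OF F1(1) order_refl F1(2), of x] F1(3)[OF F(1,2,4), of x] \<delta> by linarith
  qed
  have int: "integrable (cube_measure d) (\<lambda>x. (cmod (res F x))\<^sup>2)"
  proof (rule integrable_cubeI)
    fix x assume "x \<in> cube d"
    show "norm ((cmod (res F x))\<^sup>2) \<le> (B + (\<Sum>h\<in>F. cmod (?c h)))\<^sup>2"
      using res_bound[OF \<open>x \<in> cube d\<close>, of F] by (simp add: power_mono)
  qed simp
  have "\<delta>\<^sup>2 * m = (\<integral>x. \<delta>\<^sup>2 * indicator E x \<partial>cube_measure d)"
    using E(1) by (simp add: m_def)
  also have "\<dots> \<le> (\<integral>x. (cmod (res F x))\<^sup>2 \<partial>cube_measure d)"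
  proof (rule integral_mono)
    show "integrable (cube_measure d) (\<lambda>x. \<delta>\<^sup>2 * indicator E x :: real)"
      using E(1) by (intro integrable_mult_right integrable_real_indicator) (auto simp: C.emeasure_eq_measure)
    fix x
    show "\<delta>\<^sup>2 * indicator E x \<le> (cmod (res F x))\<^sup>2"
      using low[of x] \<delta> by (cases "x \<in> E") (auto simp: power_mono)
  qed (rule int)
  also have "\<dots> \<le> (B + ?S) * e" by (rule F2(3)[OF F(1,3,4)])
  also have "\<dots> \<le> (B + ?S + 1) * e" using e by simp
  also have "\<dots> = \<delta>\<^sup>2 * m / 2" using \<open>B \<ge> 0\<close> \<open>?S \<ge> 0\<close> by (simp add: e_def divide_simps)
  finally have "\<delta>\<^sup>2 * m \<le> 0" by linarith
  moreover have "0 < \<delta>\<^sup>2 * m" using \<delta> E(3) by (simp add: m_def)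
  ultimately show False by linarith
qed

text \<open>Orthonormality gives equality for finite partial sums, and uniform convergence carries
  the bound \<open>Q\<close> over to \<open>u\<close>. The coefficients are those of a given series,
  so complex-valued error functions are covered.\<close>

theorem parseval_le:
  assumes u: "u \<in> borel_measurable (cube_measure d)"
    and ser: "\<And>x. x \<in> cube d \<Longrightarrow> u x = (\<Sum>\<^sub>\<infinity>h\<in>int_vecs d. c h * echar d h x)"
    and sm: "(\<lambda>h. cmod (c h)) summable_on int_vecs d"
    and Q: "\<And>F. finite F \<Longrightarrow> F \<subseteq> int_vecs d \<Longrightarrow> (\<Sum>h\<in>F. (cmod (c h))\<^sup>2) \<le> Q"
  shows "(\<integral>\<^sup>+x. ennreal ((cmod (u x))\<^sup>2) \<partial>cube_measure d) \<le> ennreal Q"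
proof -
  interpret C: prob_space "cube_measure d" by (rule prob_space_cube)
  let ?S = "\<Sum>\<^sub>\<infinity>h\<in>int_vecs d. cmod (c h)"
  have S0: "0 \<le> ?S" by (intro infsum_nonneg) auto
  have ub: "cmod (u x) \<le> ?S" if "x \<in> cube d" for x
    unfolding ser[OF that] using sm norm_infsum_bound[of "\<lambda>h. c h * echar d h x" "int_vecs d"]
    by (simp add: norm_mult)
  have iu: "integrable (cube_measure d) (\<lambda>x. (cmod (u x))\<^sup>2)"
    by (rule integrable_cubeI[of _ _ "?S\<^sup>2"]) (use u ub in \<open>auto simp: power_mono\<close>)
  have "(\<integral>x. (cmod (u x))\<^sup>2 \<partial>cube_measure d) \<le> Q"
  proof (rule field_le_epsilon)
    fix e' :: real assume e': "0 < e'"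
    \<comment> \<open>For \<open>0 \<le> t \<le> ?S\<close> this makes
      \<open>(t + e)\<^sup>2 - t\<^sup>2 = e * (2 * t + e)\<close> at most
      \<open>e * (2 * ?S + 1) \<le> e'\<close>.\<close>
    define e where "e = min 1 (e' / (2 * ?S + 1))"
    have e: "0 < e" "e \<le> 1" "e * (2 * ?S + 1) \<le> e'" using e' S0 by (simp_all add: e_def min_def divide_simps)
    obtain F where F: "finite F" "F \<subseteq> int_vecs d"
      "\<And>x. cmod ((\<Sum>\<^sub>\<infinity>h\<in>int_vecs d. c h * echar d h x) - (\<Sum>h\<in>F. c h * echar d h x)) \<le> e"
      using infsum_echar_tail[OF sm e(1), of d] by blast
    let ?P = "\<lambda>x. \<Sum>h\<in>F. c h * echar d h x"
    have PS: "cmod (?P x) \<le> ?S" for x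
      by (rule order_trans[OF norm_echar_sum_le]) (use F sm in \<open>auto intro!: finite_sum_le_infsum\<close>)
    have i: "integrable (cube_measure d) (\<lambda>x. c h * cnj (c k) * (echar d h x * cnj (echar d k x)))" for h k
      by (intro integrable_mult_right integrable_cubeI[of _ _ 1]) (auto simp: norm_mult)
    have "complex_of_real (\<integral>x. (cmod (?P x))\<^sup>2 \<partial>cube_measure d)
      = (\<integral>x. (\<Sum>h\<in>F. \<Sum>k\<in>F. c h * cnj (c k) * (echar d h x * cnj (echar d k x))) \<partial>cube_measure d)"
      unfolding integral_complex_of_real[symmetric] complex_norm_square cnj_sum sum_product
      by (simp add: mult_ac)
    also have "\<dots> = (\<Sum>h\<in>F. \<Sum>k\<in>F. c h * cnj (c k) * (\<integral>x. echar d h x * cnj (echar d k x) \<partial>cube_measure d))"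
      using i by (simp add: Bochner_Integration.integral_sum Bochner_Integration.integrable_sum)
    also have "\<dots> = (\<Sum>h\<in>F. \<Sum>k\<in>F. if h = k then c h * cnj (c k) else 0)"
      using F by (intro sum.cong refl) (auto simp: integral_echar_cnj subset_eq)
    also have "\<dots> = complex_of_real (\<Sum>h\<in>F. (cmod (c h))\<^sup>2)"
      using F by (simp flip: complex_norm_square)
    finally have P2: "(\<integral>x. (cmod (?P x))\<^sup>2 \<partial>cube_measure d) = (\<Sum>h\<in>F. (cmod (c h))\<^sup>2)"
      by (simp only: of_real_eq_iff)
    have iP: "integrable (cube_measure d) (\<lambda>x. (cmod (?P x))\<^sup>2)"
      by (rule integrable_cubeI[of _ _ "?S\<^sup>2"]) (use PS in \<open>auto simp: power_mono\<close>)
    have "(\<integral>x. (cmod (u x))\<^sup>2 \<partial>cube_measure d) \<le> (\<integral>x. (cmod (?P x))\<^sup>2 + e' \<partial>cube_measure d)"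
    proof (rule integral_mono)
      fix x assume "x \<in> space (cube_measure d)"
      then have x: "x \<in> cube d" by (simp add: space_cube)
      have "cmod (u x) \<le> cmod (?P x) + e"
        using F(3)[of x] norm_triangle_ineq[of "?P x" "u x - ?P x"] by (simp add: ser[OF x])
      then have "(cmod (u x))\<^sup>2 \<le> (cmod (?P x) + e)\<^sup>2" by (intro power_mono) auto
      also have "\<dots> = (cmod (?P x))\<^sup>2 + e * (2 * cmod (?P x) + e)" by (simp add: power2_eq_square algebra_simps)
      also have "\<dots> \<le> (cmod (?P x))\<^sup>2 + e * (2 * ?S + 1)" using e PS[of x] by (intro add_left_mono mult_left_mono) auto
      finally show "(cmod (u x))\<^sup>2 \<le> (cmod (?P x))\<^sup>2 + e'" using e(3) by linarith
    qed (use iu iP in auto)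
    also have "\<dots> = (\<Sum>h\<in>F. (cmod (c h))\<^sup>2) + e'" using iP P2 C.prob_space by simp
    finally show "(\<integral>x. (cmod (u x))\<^sup>2 \<partial>cube_measure d) \<le> Q + e'" using Q[OF F(1,2)] by linarith
  qed
  moreover have "(\<integral>\<^sup>+x. ennreal ((cmod (u x))\<^sup>2) \<partial>cube_measure d) = ennreal (\<integral>x. (cmod (u x))\<^sup>2 \<partial>cube_measure d)"
    by (rule nn_integral_eq_integral[OF iu]) simp
  ultimately show ?thesis by (simp add: ennreal_leI)
qed

section \<open>Medians\<close>

lemma length_filter_sort_map:
  "length (filter P (sort (map Z [1..<Suc R]))) = card {r \<in> {1..R}. P (Z r)}"
proof -
  have "length (filter P (sort (map Z [1..<Suc R]))) = length (filter (P \<circ> Z) [1..<Suc R])"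
    by (simp only: filter_sort length_sort filter_map length_map)
  also have "\<dots> = card ({r. (P \<circ> Z) r} \<inter> set [1..<Suc R])"
    by (rule distinct_length_filter) simp
  also have "{r. (P \<circ> Z) r} \<inter> set [1..<Suc R] = {r \<in> {1..R}. P (Z r)}" by auto
  finally show ?thesis .
qed

text \<open>With \<open>R = 2 * n + 1\<close>, at least \<open>n + 1\<close> values are at most the
  median and at least \<open>n + 1\<close> are at least the median. A set \<open>G\<close> of more
  than \<open>n\<close> indices meets both groups, so on either side of \<open>c\<close> some index
  of \<open>G\<close> deviates at least as much as the median.\<close>

lemma real_median_witness:
  assumes R: "odd R" and G: "G \<subseteq> {1..R}" "R div 2 < card G"
  shows "\<exists>r\<in>G. \<bar>real_median R Z - c\<bar> \<le> \<bar>Z r - c\<bar>"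
proof -
  define n where "n = R div 2"
  have Gn: "n < card G" using G(2) by (simp add: n_def)
  have Rn: "R = 2 * n + 1" using R by (auto simp: n_def elim!: oddE)
  define s where "s = sort (map Z [1..<Suc R])"
  have len: "length s = R" by (simp add: s_def)
  have srt: "sorted s" by (simp add: s_def)
  define m where "m = real_median R Z"
  have m: "m = s ! n" by (simp add: m_def real_median_def s_def n_def)
  have lo: "n + 1 \<le> card {r \<in> {1..R}. Z r \<le> m}"
  proof -
    have "\<forall>x\<in>set (take (n + 1) s). x \<le> m"
      using srt len Rn by (auto simp: in_set_conv_nth m sorted_iff_nth_mono)
    then have "filter (\<lambda>x. x \<le> m) (take (n + 1) s) = take (n + 1) s" by (simp add: filter_id_conv)
    then have "n + 1 = length (filter (\<lambda>x. x \<le> m) (take (n + 1) s))" using len Rn by simp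
    also have "\<dots> \<le> length (filter (\<lambda>x. x \<le> m) (take (n + 1) s @ drop (n + 1) s))" by (simp del: append_take_drop_id)
    finally show ?thesis by (simp only: append_take_drop_id s_def length_filter_sort_map)
  qed
  have hi: "n + 1 \<le> card {r \<in> {1..R}. m \<le> Z r}"
  proof -
    have "\<forall>x\<in>set (drop n s). m \<le> x"
      using srt len Rn by (auto simp: in_set_conv_nth m sorted_iff_nth_mono)
    then have "filter (\<lambda>x. m \<le> x) (drop n s) = drop n s" by (simp add: filter_id_conv)
    then have "n + 1 = length (filter (\<lambda>x. m \<le> x) (drop n s))" using len Rn by simp
    also have "\<dots> \<le> length (filter (\<lambda>x. m \<le> x) (take n s @ drop n s))" by (simp del: append_take_drop_id)
    finally show ?thesis by (simp only: append_take_drop_id s_def length_filter_sort_map)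
  qed
  \<comment> \<open>Pigeonhole: two disjoint sets of at least \<open>n + 1\<close> indices do not
    fit into \<open>{1..R}\<close>.\<close>
  have meet: "\<exists>r\<in>G. r \<in> S" if S: "S \<subseteq> {1..R}" "n + 1 \<le> card S" for S
  proof (rule ccontr)
    assume "\<not> ?thesis"
    then have "G \<inter> S = {}" by auto
    then have "card G + card S = card (G \<union> S)"
      using G S by (intro card_Un_disjoint [symmetric]) (auto intro: finite_subset)
    also have "\<dots> \<le> card {1..R}" using G S by (intro card_mono) auto
    finally show False using Gn S(2) Rn by simp
  qed
  show ?thesis
  proof (cases "c \<le> m")
    case True
    obtain r where "r \<in> G" "m \<le> Z r" using meet[OF _ hi] by fastforce
    then show ?thesis using True by (intro bexI[of _ r]) (auto simp: m_def)
  next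
    case False
    obtain r where "r \<in> G" "Z r \<le> m" using meet[OF _ lo] by fastforce
    then show ?thesis using False by (intro bexI[of _ r]) (auto simp: m_def)
  qed
qed

text \<open>Real and imaginary parts may have different witnesses in \<open>G\<close>, so the sum
  over all of \<open>G\<close> serves as a common bound; in the final estimate this costs only a
  factor \<open>R\<close>.\<close>

lemma complex_median_error:
  assumes R: "odd R" and G: "G \<subseteq> {1..R}" "R div 2 < card G"
  shows "(cmod (complex_median R Z - c))\<^sup>2 \<le> (\<Sum>r\<in>G. (cmod (Z r - c))\<^sup>2)"
proof -
  have fin: "finite G" using G(1) by (rule finite_subset) simp
  obtain r where r: "r \<in> G" "\<bar>real_median R (\<lambda>r. Re (Z r)) - Re c\<bar> \<le> \<bar>Re (Z r) - Re c\<bar>"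
    using real_median_witness[OF R G, of "\<lambda>r. Re (Z r)" "Re c"] by blast
  obtain s where s: "s \<in> G" "\<bar>real_median R (\<lambda>r. Im (Z r)) - Im c\<bar> \<le> \<bar>Im (Z s) - Im c\<bar>"
    using real_median_witness[OF R G, of "\<lambda>r. Im (Z r)" "Im c"] by blast
  have "(cmod (complex_median R Z - c))\<^sup>2
      = (real_median R (\<lambda>r. Re (Z r)) - Re c)\<^sup>2 + (real_median R (\<lambda>r. Im (Z r)) - Im c)\<^sup>2"
    by (simp add: cmod_power2 complex_median_def)
  also have "\<dots> \<le> (Re (Z r) - Re c)\<^sup>2 + (Im (Z s) - Im c)\<^sup>2"
    using r(2) s(2) by (intro add_mono) (auto simp: abs_le_square_iff)
  also have "\<dots> \<le> (\<Sum>r\<in>G. (Re (Z r) - Re c)\<^sup>2) + (\<Sum>r\<in>G. (Im (Z r) - Im c)\<^sup>2)"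
    using r(1) s(1) fin by (intro add_mono member_le_sum) auto
  also have "\<dots> = (\<Sum>r\<in>G. (cmod (Z r - c))\<^sup>2)"
    by (simp add: cmod_power2 sum.distrib)
  finally show ?thesis .
qed

text \<open>Union bound over the index sets of size \<open>m\<close>: by independence each is
  entirely bad with probability at most \<open>q ^ m\<close>, and there are at most
  \<open>2 ^ R\<close> of them.\<close>

lemma prob_many_bad:
  fixes M :: "'a pmf"
  assumes "measure_pmf.prob M B \<le> q"
  shows "measure_pmf.prob (Pi_pmf {1..R} undefined (\<lambda>_. M)) {z. m \<le> card {r \<in> {1..R}. z r \<in> B}}
     \<le> 2 ^ R * q ^ m"
proof -
  let ?P = "Pi_pmf {1..R} undefined (\<lambda>_. M)"
  define I where "I = {S. S \<subseteq> {1..R} \<and> card S = m}"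
  have finI: "finite I" by (rule finite_subset[of _ "Pow {1..R}"]) (auto simp: I_def)
  have sub: "{z. m \<le> card {r \<in> {1..R}. z r \<in> B}} \<subseteq> (\<Union>S\<in>I. Pi {1..R} (\<lambda>r. if r \<in> S then B else UNIV))"
  proof
    fix z assume "z \<in> {z. m \<le> card {r \<in> {1..R}. z r \<in> B}}"
    then obtain S where "S \<subseteq> {r \<in> {1..R}. z r \<in> B}" "card S = m"
      by (auto elim: obtain_subset_with_card_n)
    then have "S \<in> I" "z \<in> Pi {1..R} (\<lambda>r. if r \<in> S then B else UNIV)" by (auto simp: I_def)
    then show "z \<in> (\<Union>S\<in>I. Pi {1..R} (\<lambda>r. if r \<in> S then B else UNIV))" by blast
  qed
  have q0: "0 \<le> q" using assms measure_nonneg order_trans by blast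
  have one: "measure_pmf.prob ?P (Pi {1..R} (\<lambda>r. if r \<in> S then B else UNIV)) \<le> q ^ m" if S: "S \<in> I" for S
  proof -
    have "measure_pmf.prob ?P (Pi {1..R} (\<lambda>r. if r \<in> S then B else UNIV))
        = (\<Prod>r\<in>{1..R}. measure_pmf.prob M (if r \<in> S then B else UNIV))"
      by (rule measure_Pi_pmf_Pi) simp
    also have "\<dots> = (\<Prod>r\<in>S. measure_pmf.prob M B)"
      using S by (intro prod.mono_neutral_cong_right) (auto simp: I_def)
    also have "\<dots> = measure_pmf.prob M B ^ m" using S by (simp add: I_def)
    also have "\<dots> \<le> q ^ m" using assms by (intro power_mono) auto
    finally show ?thesis .
  qed
  have "measure_pmf.prob ?P {z. m \<le> card {r \<in> {1..R}. z r \<in> B}}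
     \<le> measure_pmf.prob ?P (\<Union>S\<in>I. Pi {1..R} (\<lambda>r. if r \<in> S then B else UNIV))"
    using sub by (intro measure_pmf.finite_measure_mono) auto
  also have "\<dots> \<le> (\<Sum>S\<in>I. measure_pmf.prob ?P (Pi {1..R} (\<lambda>r. if r \<in> S then B else UNIV)))"
    using finI by (intro measure_UNION_le) auto
  also have "\<dots> \<le> (\<Sum>S\<in>I. q ^ m)" by (rule sum_mono) (rule one)
  also have "\<dots> = real (card I) * q ^ m" by simp
  also have "\<dots> \<le> 2 ^ R * q ^ m"
  proof (rule mult_right_mono)
    have "card I \<le> card (Pow {1..R})" by (rule card_mono) (auto simp: I_def)
    then have "real (card I) \<le> real (2 ^ R)" unfolding card_Pow[OF finite_atLeastAtMost] of_nat_le_iff by simp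
    then show "real (card I) \<le> 2 ^ R" by simp
  qed (use q0 in simp)
  finally show ?thesis .
qed

section \<open>Random rank-one lattices\<close>

definition idot :: "nat \<Rightarrow> (nat \<Rightarrow> int) \<Rightarrow> (nat \<Rightarrow> nat) \<Rightarrow> int" where
  "idot d h z = (\<Sum>j=1..d. h j * int (z j))"

text \<open>For \<open>N > 0\<close>, the frequencies whose characters coincide with that of
  \<open>h\<close> at all nodes of the lattice generated by \<open>z\<close>.\<close>

definition dual_coset :: "nat \<Rightarrow> nat \<Rightarrow> (nat \<Rightarrow> nat) \<Rightarrow> (nat \<Rightarrow> int) \<Rightarrow> (nat \<Rightarrow> int) set" where
  "dual_coset d N z h = {k \<in> int_vecs d. int N dvd idot d k z - idot d h z}"

lemma sum_root_of_unity:
  assumes N: "N > 0"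
  shows "(\<Sum>i<N. cis (2 * pi * (real i * real_of_int n / real N))) = (if int N dvd n then of_nat N else 0)"
proof -
  define w where "w = cis (2 * pi * (real_of_int n / real N))"
  have pw: "cis (2 * pi * (real i * real_of_int n / real N)) = w ^ i" for i
    unfolding w_def Complex.DeMoivre by (simp add: mult_ac)
  have wN: "w ^ N = 1" unfolding pw[symmetric] using N by simp
  have w1: "w = 1 \<longleftrightarrow> int N dvd n"
  proof
    assume "w = 1"
    then obtain m :: int where "2 * pi * (real_of_int n / real N) = of_int m * (2 * pi)"
      unfolding w_def cis_eq_1_iff by auto
    then have "(2 * pi) * (real_of_int n / real N) = (2 * pi) * of_int m" by simp
    then have "real_of_int n / real N = of_int m" by (subst (asm) mult_cancel_left) simp
    then have "real_of_int n = real_of_int (int N * m)" using N by (simp add: field_simps)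
    then show "int N dvd n" by (metis dvd_triv_left of_int_eq_iff)
  next
    assume "int N dvd n"
    then obtain m where "n = int N * m" by (auto elim: dvdE)
    then have "real_of_int n / real N = of_int m" using N by simp
    then show "w = 1" unfolding w_def by (simp only:) (rule cis_multiple_2pi, simp)
  qed
  show ?thesis
  proof (cases "w = 1")
    case True
    then show ?thesis using w1 unfolding pw by simp
  next
    case False
    then have "(\<Sum>i<N. w ^ i) = 0" using wN by (simp add: geometric_sum)
    then show ?thesis using w1 False unfolding pw by simp
  qed
qed

lemma lattice_point_in_cube: "lattice_point d N z k \<in> cube d"
  by (auto simp: lattice_point_def cube_def less_imp_le frac_lt_1)

lemma dot_node: "dot d h (\<lambda>j. real i * real (z j) / real N) = real i * real_of_int (idot d h z) / real N"
  by (simp add: dot_def idot_def sum_distrib_left sum_divide_distrib mult_ac)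

lemma echar_lattice_point:
  "echar d h (lattice_point d N z i) = cis (2 * pi * (real i * real_of_int (idot d h z) / real N))"
proof -
  let ?y = "\<lambda>j. real i * real (z j) / real N"
  have "dot d h (lattice_point d N z i) = (\<Sum>j=1..d. real_of_int (h j) * ?y j - real_of_int (h j * \<lfloor>?y j\<rfloor>))"
    unfolding dot_def lattice_point_def by (intro sum.cong) (auto simp: frac_def algebra_simps)
  also have "\<dots> = dot d h ?y - real_of_int (\<Sum>j=1..d. h j * \<lfloor>?y j\<rfloor>)"
    by (simp add: sum_subtractf dot_def)
  finally have "dot d h (lattice_point d N z i)
      = real i * real_of_int (idot d h z) / real N - real_of_int (\<Sum>j=1..d. h j * \<lfloor>?y j\<rfloor>)"
    unfolding dot_node .
  then show ?thesis
    unfolding echar_def by (simp only: right_diff_distrib cis_divide[symmetric] cis_multiple_2pi Ints_of_int div_by_1)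
qed

text \<open>The aliasing formula: inserting the series and averaging over the nodes leaves a
  geometric sum of roots of unity for each frequency, which is 1 on the coset and 0 elsewhere after
  normalisation.\<close>

lemma lattice_coeff_alias:
  assumes N: "N > 0" and sm: "(\<lambda>h. cmod (c h)) summable_on int_vecs d"
    and ser: "\<And>x. x \<in> cube d \<Longrightarrow> complex_of_real (f x) = (\<Sum>\<^sub>\<infinity>h\<in>int_vecs d. c h * echar d h x)"
  shows "lattice_coeff d N z f h = (\<Sum>\<^sub>\<infinity>k\<in>dual_coset d N z h. c k)"
proof -
  let ?I = "int_vecs d"
  let ?t = "\<lambda>n i. cis (2 * pi * (real i * real_of_int n / real N))"
  have sc: "(\<lambda>k. c k * cis (t k)) summable_on ?I" for t
    by (rule abs_summable_summable) (use sm in \<open>simp add: norm_mult\<close>)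
  have e: "exp (- 2 * of_real pi * \<i> * of_real (dot d h (\<lambda>j. real i * real (z j) / real N)))
      = cnj (?t (idot d h z) i)" for i
    unfolding exp_eq_echar unfolding echar_def dot_node ..
  have summand: "complex_of_real (f (lattice_point d N z i)) *
          exp (- 2 * of_real pi * \<i> * of_real (dot d h (\<lambda>j. real i * real (z j) / real N)))
        = (\<Sum>\<^sub>\<infinity>k\<in>?I. c k * ?t (idot d k z - idot d h z) i)" for i
  proof -
    have "?t n i * cnj (?t m i) = ?t (n - m) i" for n m
      unfolding cis_cnj cis_mult
      by (rule arg_cong[of _ _ cis]) (simp add: right_diff_distrib diff_divide_distrib)
    then have t: "c k * ?t (idot d k z) i * cnj (?t (idot d h z) i) = c k * ?t (idot d k z - idot d h z) i" for k
      by (simp only: mult.assoc)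
    have "complex_of_real (f (lattice_point d N z i)) * cnj (?t (idot d h z) i)
        = (\<Sum>\<^sub>\<infinity>k\<in>?I. c k * ?t (idot d k z) i * cnj (?t (idot d h z) i))"
      unfolding ser[OF lattice_point_in_cube] echar_lattice_point
      by (rule infsum_cmult_left[symmetric]) (rule sc)
    then show ?thesis unfolding e t .
  qed
  have "lattice_coeff d N z f h = 1 / of_nat N * (\<Sum>i<N. \<Sum>\<^sub>\<infinity>k\<in>?I. c k * ?t (idot d k z - idot d h z) i)"
    unfolding lattice_coeff_def summand ..
  also have "(\<Sum>i<N. \<Sum>\<^sub>\<infinity>k\<in>?I. c k * ?t (idot d k z - idot d h z) i)
      = (\<Sum>\<^sub>\<infinity>k\<in>?I. \<Sum>i<N. c k * ?t (idot d k z - idot d h z) i)"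
  proof -
    have "((\<lambda>k. \<Sum>i<M. c k * ?t (idot d k z - idot d h z) i) has_sum
        (\<Sum>i<M. \<Sum>\<^sub>\<infinity>k\<in>?I. c k * ?t (idot d k z - idot d h z) i)) ?I" for M
      by (induction M) (auto intro!: has_sum_add has_sum_infsum sc)
    from this[of N] show ?thesis by (rule infsumI [symmetric])
  qed
  also have "\<dots> = (\<Sum>\<^sub>\<infinity>k\<in>?I. of_nat N * (if int N dvd idot d k z - idot d h z then c k else 0))"
    unfolding sum_distrib_left[symmetric] sum_root_of_unity[OF N] by (intro infsum_cong) auto
  also have "\<dots> = of_nat N * (\<Sum>\<^sub>\<infinity>k\<in>?I. if int N dvd idot d k z - idot d h z then c k else 0)"
    by (rule infsum_cmult_right')
  also have "(\<Sum>\<^sub>\<infinity>k\<in>?I. if int N dvd idot d k z - idot d h z then c k else 0) = (\<Sum>\<^sub>\<infinity>k\<in>dual_coset d N z h. c k)"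
    by (rule infsum_cong_neutral) (auto simp: dual_coset_def)
  finally show ?thesis using N by simp
qed

section \<open>Counting generating vectors and the probability of being bad\<close>

abbreviation gen_set :: "nat \<Rightarrow> nat \<Rightarrow> (nat \<Rightarrow> nat) set" where
  "gen_set d N \<equiv> {1..d} \<rightarrow>\<^sub>E {1..N - 1}"

lemma finite_gen_set: "finite (gen_set d N)"
  by (rule finite_PiE) auto

text \<open>As \<open>N\<close> is prime, \<open>k j - h j\<close> is invertible modulo
  \<open>N\<close>, so the other coordinates of a solution determine \<open>z j\<close>. Overwriting
  coordinate \<open>j\<close> freely is therefore injective on pairs of a solution and a value in
  \<open>{1..N - 1}\<close>.\<close>

lemma card_dual_solutions:
  assumes N: "prime N" and j: "j \<in> {1..d}" "\<not> int N dvd k j - h j"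
  shows "(N - 1) * card {z \<in> gen_set d N. int N dvd idot d k z - idot d h z} \<le> card (gen_set d N)"
proof -
  define S where "S = {z \<in> gen_set d N. int N dvd idot d k z - idot d h z}"
  define \<phi> where "\<phi> = (\<lambda>(z::nat \<Rightarrow> nat, t::nat). z(j := t))"
  have inj: "inj_on \<phi> (S \<times> {1..N - 1})"
  proof (rule inj_onI, clarify)
    fix z t z' t' assume zt: "z \<in> S" "z' \<in> S" "\<phi> (z, t) = \<phi> (z', t')"
    have off: "z i = z' i" if "i \<noteq> j" for i using fun_cong[OF zt(3), of i] that by (simp add: \<phi>_def)
    have t: "t = t'" using fun_cong[OF zt(3), of j] by (simp add: \<phi>_def)
    have id: "idot d k y - idot d h y = (k j - h j) * int (y j) + (\<Sum>i\<in>{1..d} - {j}. (k i - h i) * int (y i))" for y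
    proof -
      have "idot d k y - idot d h y = (\<Sum>i\<in>{1..d}. (k i - h i) * int (y i))"
        by (simp add: idot_def left_diff_distrib sum_subtractf)
      then show ?thesis using j by (simp add: sum.remove)
    qed
    have "int N dvd (idot d k z - idot d h z) - (idot d k z' - idot d h z')"
      by (rule dvd_diff) (use zt in \<open>auto simp: S_def\<close>)
    also have "(idot d k z - idot d h z) - (idot d k z' - idot d h z') = (k j - h j) * (int (z j) - int (z' j))"
      unfolding id using off by (simp add: algebra_simps)
    finally have "int N dvd int (z j) - int (z' j)"
      using j N by (simp add: prime_dvd_mult_iff)
    moreover have "z j \<in> {1..N-1}" "z' j \<in> {1..N-1}" using zt j by (auto simp: S_def PiE_iff)
    ultimately have "z j = z' j"
      using dvd_imp_le_int[of "int (z j) - int (z' j)" "int N"] by fastforce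
    then have "z = z'" using off by (metis ext)
    with t show "z = z' \<and> t = t'" by simp
  qed
  have "\<phi> ` (S \<times> {1..N - 1}) \<subseteq> gen_set d N"
    using j by (auto simp: \<phi>_def S_def PiE_iff extensional_def)
  then have "card (S \<times> {1..N - 1}) \<le> card (gen_set d N)"
    using inj finite_gen_set by (intro card_inj_on_le[of \<phi>]) auto
  then show ?thesis unfolding card_cartesian_product S_def by (simp add: mult.commute)
qed

lemma decay_powr_summable:
  assumes "\<And>j. 1 \<le> j \<Longrightarrow> 0 < g j \<and> g j \<le> 1" and "e > 0"
  shows "(\<lambda>h. decay d g h powr (1 + e)) summable_on int_vecs d"
  by (rule nonneg_bdd_above_summable_on) (auto intro!: bdd_aboveI2 sum_decay_powr_le assms)

text \<open>The assumption \<open>Lg\<close> puts the frequency set into the box of coordinates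
  below \<open>N / 2\<close> in modulus, so that distinct members are incongruent modulo
  \<open>N\<close> in some coordinate.\<close>

locale lattice_params =
  fixes d N :: nat and g :: "nat \<Rightarrow> real" and L e :: real
  assumes N: "prime N" "odd N"
    and g: "\<And>j. 1 \<le> j \<Longrightarrow> 0 < g j \<and> g j \<le> 1"
    and L: "1 < L" and Lg: "\<And>j. j \<in> {1..d} \<Longrightarrow> 2 * (L * g j) \<le> real N"
    and e: "0 < e"
begin

definition A :: "(nat \<Rightarrow> int) set" where "A = {h \<in> int_vecs d. 1 < L * decay d g h}"

abbreviation "\<Pi>\<^sub>e \<equiv> Pi_fac d g (1 + 1 / e)"

definition wt :: "(nat \<Rightarrow> int) \<Rightarrow> real" where "wt k = decay d g k powr (1 + e)"

definition tail :: "(nat \<Rightarrow> nat) \<Rightarrow> (nat \<Rightarrow> int) \<Rightarrow> real" where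
  "tail z h = (\<Sum>\<^sub>\<infinity>k\<in>dual_coset d N z h - {h}. wt k)"

definition bad :: "real \<Rightarrow> (nat \<Rightarrow> int) \<Rightarrow> (nat \<Rightarrow> nat) \<Rightarrow> bool" where
  "bad \<theta> h z \<longleftrightarrow> (\<exists>k\<in>A - {h}. k \<in> dual_coset d N z h) \<or> \<theta> < tail z h"

lemma N3: "3 \<le> N"
  using N prime_ge_2_nat[OF N(1)] by (cases "N = 2") auto

lemma decay_bounds: "0 < decay d g h" "decay d g h \<le> 1"
  using g by (auto intro: decay_pos decay_le1)

lemma wt_nonneg: "0 \<le> wt k"
  by (simp add: wt_def)

lemma wt_summable: "S \<subseteq> int_vecs d \<Longrightarrow> wt summable_on S"
  unfolding wt_def[abs_def] by (rule summable_on_subset[OF decay_powr_summable]) (use g e in auto)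

lemma dual_coset_subset: "dual_coset d N z h \<subseteq> int_vecs d"
  by (auto simp: dual_coset_def)

lemma finite_A: "finite A"
  using card_decay_set_le[of g e L d] g e L by (auto simp: A_def)

lemma Pi_ge1: "1 \<le> \<Pi>\<^sub>e"
  using g e by (intro Pi_fac_ge1) auto

lemma A_coord_less:
  assumes "h \<in> A" "j \<in> {1..d}"
  shows "2 * \<bar>h j\<bar> < int N"
proof (cases "h j = 0")
  case False
  have "1 < L * decay d g h" using assms by (simp add: A_def)
  also have "\<dots> \<le> L * decay1 (g j) (h j)"
    using L g assms(2) by (intro mult_left_mono decay_le_decay1) auto
  finally have "\<bar>real_of_int (h j)\<bar> < L * g j" using False by (simp add: decay1_def field_simps)
  then have "2 * \<bar>real_of_int (h j)\<bar> < real N" using Lg[OF assms(2)] by linarith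
  then show ?thesis by linarith
qed (use N3 in simp)

lemma A_not_congruent:
  assumes "h \<in> A" "k \<in> A" "h \<noteq> k"
  shows "\<exists>j\<in>{1..d}. \<not> int N dvd k j - h j"
proof -
  have "\<exists>j\<in>{1..d}. h j \<noteq> k j"
    using assms unfolding A_def int_vecs_def by (metis (no_types, lifting) PiE_ext mem_Collect_eq)
  then obtain j where j: "j \<in> {1..d}" "h j \<noteq> k j" by blast
  have "\<bar>k j - h j\<bar> < int N" using A_coord_less[OF assms(1) j(1)] A_coord_less[OF assms(2) j(1)] by linarith
  then show ?thesis using j dvd_imp_le_int[of "k j - h j" "int N"] by fastforce
qed

abbreviation "V \<equiv> gen_set d N"

lemma card_V: "0 < real (card V)"
  using N3 by (simp add: card_PiE)

lemma card_solutions: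
  assumes "j \<in> {1..d}" "\<not> int N dvd k j - h j" "k \<in> int_vecs d"
  shows "real (card {z \<in> V. k \<in> dual_coset d N z h}) \<le> real (card V) / (real N - 1)"
proof -
  have "(N - 1) * card {z \<in> V. k \<in> dual_coset d N z h} \<le> card V"
    using card_dual_solutions[where h=h and k=k, OF N(1) assms(1,2)] assms(3) by (simp add: dual_coset_def)
  then have "real (N - 1) * real (card {z \<in> V. k \<in> dual_coset d N z h}) \<le> real (card V)"
    by (simp only: of_nat_mult [symmetric] of_nat_le_iff)
  then show ?thesis using N3 by (simp add: field_simps of_nat_diff)
qed

lemma card_collision:
  assumes h: "h \<in> A"
  shows "real (card {z \<in> V. \<exists>k\<in>A - {h}. k \<in> dual_coset d N z h})
     \<le> (real (card A) - 1) * (real (card V) / (real N - 1))"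
proof -
  have "{z \<in> V. \<exists>k\<in>A - {h}. k \<in> dual_coset d N z h} = (\<Union>k\<in>A - {h}. {z \<in> V. k \<in> dual_coset d N z h})" by auto
  then have "card {z \<in> V. \<exists>k\<in>A - {h}. k \<in> dual_coset d N z h} \<le> (\<Sum>k\<in>A - {h}. card {z \<in> V. k \<in> dual_coset d N z h})"
    using finite_A by (simp add: card_UN_le)
  then have "real (card {z \<in> V. \<exists>k\<in>A - {h}. k \<in> dual_coset d N z h})
     \<le> (\<Sum>k\<in>A - {h}. real (card {z \<in> V. k \<in> dual_coset d N z h}))" by (simp flip: of_nat_sum)
  also have "\<dots> \<le> (\<Sum>k\<in>A - {h}. real (card V) / (real N - 1))"
  proof (rule sum_mono)
    fix k assume k: "k \<in> A - {h}"
    then obtain j where "j \<in> {1..d}" "\<not> int N dvd k j - h j" using A_not_congruent[OF h] by blast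
    then show "real (card {z \<in> V. k \<in> dual_coset d N z h}) \<le> real (card V) / (real N - 1)"
      using k by (intro card_solutions) (auto simp: A_def)
  qed
  also have "\<dots> = real (card (A - {h})) * (real (card V) / (real N - 1))" by simp
  also have "real (card (A - {h})) = real (card A) - 1"
    using card.remove[OF finite_A h] by simp
  finally show ?thesis .
qed

text \<open>Write \<open>k = h + N * l\<close> with \<open>l\<close> nonzero. Where
  \<open>l j \<noteq> 0\<close>, the bound on \<open>h j\<close> yields
  \<open>2 * \<bar>k j\<bar> \<ge> N * \<bar>l j\<bar>\<close>. One such coordinate supplies the
  factor \<open>2 / N\<close>; in the others the decay at \<open>k j\<close> is simply at most that
  at \<open>l j\<close>. Summing over \<open>l\<close> gives the product.\<close>

lemma sum_wt_congruent_le: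
  assumes h: "h \<in> A" and F: "finite F" "F \<subseteq> {k \<in> int_vecs d. k \<noteq> h \<and> (\<forall>j\<in>{1..d}. int N dvd k j - h j)}"
  shows "(\<Sum>k\<in>F. wt k) \<le> 2 / real N * \<Pi>\<^sub>e"
proof -
  define l where "l = (\<lambda>k. \<lambda>j\<in>{1..d}. (k j - h j) div int N)"
  have kl: "k j = h j + int N * l k j" if "k \<in> F" "j \<in> {1..d}" for k j
    using F(2) that by (auto simp: l_def)
  have li: "l k \<in> int_vecs d" for k by (simp add: l_def int_vecs_def)
  have inj: "inj_on l F"
  proof (rule inj_onI)
    fix k k' assume k: "k \<in> F" "k' \<in> F" "l k = l k'"
    show "k = k'"
    proof (rule PiE_ext)
      show "k \<in> PiE {1..d} (\<lambda>_. UNIV)" "k' \<in> PiE {1..d} (\<lambda>_. UNIV)" using k F(2) by (auto simp: int_vecs_def)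
      show "k j = k' j" if "j \<in> {1..d}" for j using kl[OF k(1) that] kl[OF k(2) that] k(3) by simp
    qed
  qed
  have "wt k \<le> 2 / real N * wt (l k)" if k: "k \<in> F" for k
  proof -
    have kh: "k \<noteq> h" "k \<in> int_vecs d" using k F(2) by auto
    have "\<exists>j\<in>{1..d}. k j \<noteq> h j"
      using h kh unfolding A_def int_vecs_def by (metis (no_types, lifting) PiE_ext mem_Collect_eq)
    then obtain i where i: "i \<in> {1..d}" "k i \<noteq> h i" by blast
    then have li0: "l k i \<noteq> 0" using kl[OF k i(1)] by auto
    have coord: "2 * \<bar>real_of_int (k j)\<bar> \<ge> real N * \<bar>real_of_int (l k j)\<bar>" if "j \<in> {1..d}" "l k j \<noteq> 0" for j
    proof -
      have "int N * \<bar>l k j\<bar> = \<bar>int N * l k j\<bar>" by (simp add: abs_mult)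
      also have "\<dots> \<le> \<bar>k j\<bar> + \<bar>h j\<bar>" using kl[OF k that(1)] by linarith
      finally have *: "int N * \<bar>l k j\<bar> \<le> \<bar>k j\<bar> + \<bar>h j\<bar>" .
      have "int N \<le> int N * \<bar>l k j\<bar>" using that(2) mult_left_mono[of 1 "\<bar>l k j\<bar>" "int N"] by simp
      then have "int N * \<bar>l k j\<bar> \<le> 2 * \<bar>k j\<bar>" using * A_coord_less[OF h that(1)] by linarith
      then have "real_of_int (int N * \<bar>l k j\<bar>) \<le> real_of_int (2 * \<bar>k j\<bar>)" by (simp only: of_int_le_iff)
      then show ?thesis by simp
    qed
    have le2: "decay1 (g j) (k j) \<le> (2 / real N) * decay1 (g j) (l k j)" if "j \<in> {1..d}" "l k j \<noteq> 0" for j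
    proof -
      have pos: "0 < real N * \<bar>real_of_int (l k j)\<bar>" using N3 that by simp
      then have k0: "0 < \<bar>real_of_int (k j)\<bar>" using coord[OF that] by linarith
      have "g j / \<bar>real_of_int (k j)\<bar> \<le> g j / (real N * \<bar>real_of_int (l k j)\<bar> / 2)"
        using coord[OF that] pos g[of j] that by (intro divide_left_mono) auto
      also have "\<dots> = (2 / real N) * (g j / \<bar>real_of_int (l k j)\<bar>)" by simp
      finally show ?thesis using that k0 by (simp add: decay1_def)
    qed
    have p: "0 < decay1 (g j) n" "decay1 (g j) n \<le> 1" if "j \<in> {1..d}" for j n using g[of j] that by (auto intro: decay1_pos decay1_le1)
    have le1: "decay1 (g j) (k j) \<le> decay1 (g j) (l k j)" if "j \<in> {1..d}" for j
    proof (cases "l k j = 0")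
      case True
      then show ?thesis using p[OF that, of "k j"] by (simp add: decay1_def)
    next
      case False
      have "(2 / real N) * decay1 (g j) (l k j) \<le> 1 * decay1 (g j) (l k j)"
        using N3 p[OF that, of "l k j"] by (intro mult_right_mono) auto
      then show ?thesis using le2[OF that False] by linarith
    qed
    have "decay d g k = decay1 (g i) (k i) * (\<Prod>j\<in>{1..d} - {i}. decay1 (g j) (k j))"
      unfolding decay_def using i by (simp add: prod.remove)
    also have "\<dots> \<le> ((2 / real N) * decay1 (g i) (l k i)) * (\<Prod>j\<in>{1..d} - {i}. decay1 (g j) (l k j))"
      using le2[OF i(1) li0] le1 p i by (intro mult_mono prod_mono prod_nonneg) (auto simp: less_imp_le)
    also have "\<dots> = (2 / real N) * decay d g (l k)"
      unfolding decay_def using i by (simp add: prod.remove)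
    finally have "wt k \<le> ((2 / real N) * decay d g (l k)) powr (1 + e)"
      unfolding wt_def using decay_bounds(1)[of k] e by (intro powr_mono2) auto
    also have "\<dots> = (2 / real N) powr (1 + e) * wt (l k)"
      unfolding wt_def using decay_bounds(1)[of "l k"] N3 by (subst powr_mult) auto
    also have "\<dots> \<le> (2 / real N) powr 1 * wt (l k)"
      using N3 e by (intro mult_right_mono wt_nonneg powr_mono') auto
    finally show ?thesis using N3 by simp
  qed
  then have "(\<Sum>k\<in>F. wt k) \<le> (\<Sum>k\<in>F. 2 / real N * wt (l k))" by (rule sum_mono)
  also have "\<dots> = 2 / real N * (\<Sum>k\<in>l ` F. wt k)"
    using inj by (simp add: sum.reindex sum_distrib_left)
  also have "\<dots> \<le> 2 / real N * \<Pi>\<^sub>e"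
    unfolding wt_def by (intro mult_left_mono sum_decay_powr_le) (use g e F li in auto)
  finally show ?thesis .
qed

text \<open>The constant 3 splits as 1 + 2: a frequency incongruent to \<open>h\<close> in some
  coordinate lies in the coset for at most a fraction \<open>1 / (N - 1)\<close> of the vectors,
  while the congruent ones, present for all vectors, have total weight at most \<open>2 / N\<close>
  times the product.\<close>

lemma sum_tail_le:
  assumes h: "h \<in> A"
  shows "(\<Sum>z\<in>V. tail z h) \<le> real (card V) * (3 * \<Pi>\<^sub>e / (real N - 1))"
proof -
  let ?I = "int_vecs d"
  let ?w = "\<lambda>z k. if k \<in> dual_coset d N z h - {h} then wt k else 0"
  have t: "tail z h = (\<Sum>\<^sub>\<infinity>k\<in>?I. ?w z k)" for z
    unfolding tail_def by (rule infsum_cong_neutral) (auto simp: dual_coset_def)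
  have sm: "(\<lambda>k. ?w z k) summable_on ?I" for z
    by (rule summable_on_comparison_test[OF wt_summable[OF order_refl]]) (auto simp: wt_nonneg)
  have hs: "((\<lambda>k. \<Sum>z\<in>W. ?w z k) has_sum (\<Sum>z\<in>W. tail z h)) ?I" if "finite W" for W
    using that
  proof (induction W)
    case (insert z W)
    have "(?w z has_sum tail z h) ?I" unfolding t by (rule has_sum_infsum[OF sm])
    from has_sum_add[OF this insert.IH] show ?case using insert.hyps by simp
  qed simp
  show ?thesis
  \<comment> \<open>The mean of the tails is itself an infinite sum over frequencies, so a bound on
    its finite partial sums suffices.\<close>
  proof (rule has_sum_le_finite_sums[OF hs[OF finite_gen_set]])
    fix F assume F: "finite F" "F \<subseteq> ?I"
    define F' where "F' = {k \<in> F. k \<noteq> h}"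
    define F1 where "F1 = {k \<in> F'. \<exists>j\<in>{1..d}. \<not> int N dvd k j - h j}"
    define F2 where "F2 = {k \<in> F'. \<forall>j\<in>{1..d}. int N dvd k j - h j}"
    have fin: "finite F'" "finite F1" "finite F2" using F by (auto simp: F'_def F1_def F2_def)
    have cnt: "(\<Sum>z\<in>V. ?w z k) = (if k \<noteq> h then wt k * real (card {z \<in> V. k \<in> dual_coset d N z h}) else 0)" for k
    proof -
      have "(\<Sum>z\<in>V. ?w z k) = (\<Sum>z\<in>V. if k \<in> dual_coset d N z h \<and> k \<noteq> h then wt k else 0)"
        by (intro sum.cong) auto
      also have "\<dots> = (if k \<noteq> h then wt k * real (card {z \<in> V. k \<in> dual_coset d N z h}) else 0)"
        using finite_gen_set[of d N] by (simp add: sum.If_cases Int_def)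
      finally show ?thesis .
    qed
    have "(\<Sum>k\<in>F. \<Sum>z\<in>V. ?w z k) = (\<Sum>k\<in>F'. wt k * real (card {z \<in> V. k \<in> dual_coset d N z h}))"
      unfolding cnt F'_def using F by (intro sum.inter_filter [symmetric])
    also have "F' = F1 \<union> F2" by (auto simp: F1_def F2_def)
    also have "(\<Sum>k\<in>F1 \<union> F2. wt k * real (card {z \<in> V. k \<in> dual_coset d N z h}))
       = (\<Sum>k\<in>F1. wt k * real (card {z \<in> V. k \<in> dual_coset d N z h}))
         + (\<Sum>k\<in>F2. wt k * real (card {z \<in> V. k \<in> dual_coset d N z h}))"
      using fin by (intro sum.union_disjoint) (auto simp: F1_def F2_def)
    also have "\<dots> \<le> (\<Sum>k\<in>F1. wt k * (real (card V) / (real N - 1))) + (\<Sum>k\<in>F2. wt k * real (card V))"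
    proof (intro add_mono sum_mono mult_left_mono wt_nonneg)
      fix k assume "k \<in> F1"
      then obtain j where "j \<in> {1..d}" "\<not> int N dvd k j - h j" "k \<in> ?I"
        using F by (auto simp: F1_def F'_def)
      then show "real (card {z \<in> V. k \<in> dual_coset d N z h}) \<le> real (card V) / (real N - 1)"
        by (rule card_solutions)
    next
      fix k
      show "real (card {z \<in> V. k \<in> dual_coset d N z h}) \<le> real (card V)"
        using finite_gen_set by (intro of_nat_mono card_mono) auto
    qed
    also have "\<dots> = real (card V) * ((\<Sum>k\<in>F1. wt k) / (real N - 1) + (\<Sum>k\<in>F2. wt k))"
      unfolding sum_distrib_right[symmetric] by (simp add: algebra_simps)
    also have "\<dots> \<le> real (card V) * (\<Pi>\<^sub>e / (real N - 1) + 2 / real N * \<Pi>\<^sub>e)"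
    proof (intro mult_left_mono add_mono divide_right_mono)
      show "(\<Sum>k\<in>F1. wt k) \<le> \<Pi>\<^sub>e"
        unfolding wt_def by (rule sum_decay_powr_le) (use g e F fin in \<open>auto simp: F1_def F'_def\<close>)
      show "(\<Sum>k\<in>F2. wt k) \<le> 2 / real N * \<Pi>\<^sub>e"
        by (rule sum_wt_congruent_le[OF h fin(3)]) (use F in \<open>auto simp: F2_def F'_def\<close>)
    qed (use N3 in auto)
    also have "\<dots> \<le> real (card V) * (\<Pi>\<^sub>e / (real N - 1) + 2 / (real N - 1) * \<Pi>\<^sub>e)"
      using N3 Pi_ge1 by (intro mult_left_mono add_mono mult_right_mono divide_left_mono) auto
    also have "\<dots> = real (card V) * (3 * \<Pi>\<^sub>e / (real N - 1))" by (simp add: add_divide_distrib[symmetric])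
    finally show "(\<Sum>k\<in>F. \<Sum>z\<in>V. ?w z k) \<le> real (card V) * (3 * \<Pi>\<^sub>e / (real N - 1))" .
  qed
qed

lemma tail_nonneg: "0 \<le> tail z h"
  unfolding tail_def by (intro infsum_nonneg wt_nonneg)

text \<open>A collision with one of the other frequencies of \<open>A\<close> has probability at
  most \<open>1 / x\<close> by the union bound. A tail above \<open>x\<close> times its mean bound
  has probability at most \<open>1 / x\<close> by Markov's inequality, here in counting
  form.\<close>

lemma prob_bad_le:
  assumes h: "h \<in> A" and x: "0 < x"
    and A: "real (card A) - 1 \<le> (real N - 1) / x"
  shows "measure_pmf.prob (pmf_of_set V) {z. bad (3 * \<Pi>\<^sub>e / (real N - 1) * x) h z} \<le> 2 / x"
proof -
  define \<mu> where "\<mu> = 3 * \<Pi>\<^sub>e / (real N - 1)"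
  have \<mu>: "0 < \<mu>" using N3 Pi_ge1 by (simp add: \<mu>_def)
  let ?B1 = "{z \<in> V. \<exists>k\<in>A - {h}. k \<in> dual_coset d N z h}"
  let ?B2 = "{z \<in> V. \<mu> * x < tail z h}"
  have "1 \<le> N - 1" using N3 by linarith
  then have ne: "V \<noteq> {}" by (simp add: PiE_eq_empty_iff)
  have b1: "real (card ?B1) \<le> real (card V) / x"
  proof -
    have "real (card ?B1) \<le> (real (card A) - 1) * (real (card V) / (real N - 1))" by (rule card_collision[OF h])
    also have "\<dots> \<le> (real N - 1) / x * (real (card V) / (real N - 1))"
      using A N3 by (intro mult_right_mono) auto
    finally show ?thesis using N3 by simp
  qed
  have b2: "real (card ?B2) \<le> real (card V) / x"
  proof -
    have "real (card ?B2) * (\<mu> * x) = (\<Sum>z\<in>?B2. \<mu> * x)" by simp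
    also have "\<dots> \<le> (\<Sum>z\<in>?B2. tail z h)" by (intro sum_mono) auto
    also have "\<dots> \<le> (\<Sum>z\<in>V. tail z h)" by (intro sum_mono2 finite_gen_set) (auto simp: tail_nonneg)
    also have "\<dots> \<le> real (card V) * \<mu>" unfolding \<mu>_def by (rule sum_tail_le[OF h])
    finally show ?thesis using \<mu> x by (simp add: field_simps)
  qed
  have "measure_pmf.prob (pmf_of_set V) {z. bad (\<mu> * x) h z} = real (card (V \<inter> {z. bad (\<mu> * x) h z})) / real (card V)"
    by (rule measure_pmf_of_set[OF ne finite_gen_set])
  also have "V \<inter> {z. bad (\<mu> * x) h z} = ?B1 \<union> ?B2" by (auto simp: bad_def)
  also have "real (card (?B1 \<union> ?B2)) / real (card V) \<le> (real (card ?B1) + real (card ?B2)) / real (card V)"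
    using card_Un_le[of ?B1 ?B2] card_V by (intro divide_right_mono) (simp_all flip: of_nat_add)
  also have "\<dots> \<le> (real (card V) / x + real (card V) / x) / real (card V)"
    using b1 b2 by (intro divide_right_mono add_mono) auto
  also have "\<dots> = 2 / x" using card_V by (simp add: field_simps)
  finally show ?thesis by (simp add: \<mu>_def)
qed

end

section \<open>The error for good generating vectors\<close>

text \<open>Summability and bound come together from finite sums, so the lemma serves both for
  absolute convergence of Fourier series and for the aliasing estimates.\<close>

lemma Cauchy_Schwarz_infsum:
  fixes a b :: "'a \<Rightarrow> real" and c :: "'a \<Rightarrow> 'b::real_normed_vector"
  assumes a: "a summable_on D" "\<And>k. k \<in> D \<Longrightarrow> 0 \<le> a k"
    and b: "b summable_on D" "\<And>k. k \<in> D \<Longrightarrow> 0 \<le> b k"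
    and c: "\<And>k. k \<in> D \<Longrightarrow> (norm (c k))\<^sup>2 \<le> a k * b k"
  shows "(\<lambda>k. norm (c k)) summable_on D"
    and "(\<Sum>\<^sub>\<infinity>k\<in>D. norm (c k)) \<le> sqrt (infsum a D * infsum b D)"
proof -
  have fin: "(\<Sum>k\<in>F. norm (c k)) \<le> sqrt (infsum a D * infsum b D)" if F: "finite F" "F \<subseteq> D" for F
  proof -
    have "(\<Sum>k\<in>F. norm (c k)) \<le> (\<Sum>k\<in>F. \<bar>sqrt (a k)\<bar> * \<bar>sqrt (b k)\<bar>)"
    proof (rule sum_mono)
      fix k assume "k \<in> F"
      then have k: "k \<in> D" using F by auto
      then have "norm (c k) \<le> sqrt (a k * b k)" using c by (intro real_le_rsqrt)
      then show "norm (c k) \<le> \<bar>sqrt (a k)\<bar> * \<bar>sqrt (b k)\<bar>"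
        using a(2)[OF k] b(2)[OF k] by (simp add: real_sqrt_mult)
    qed
    also have "\<dots> \<le> L2_set (\<lambda>k. sqrt (a k)) F * L2_set (\<lambda>k. sqrt (b k)) F"
      by (rule L2_set_mult_ineq)
    also have "\<dots> = sqrt ((\<Sum>k\<in>F. a k) * (\<Sum>k\<in>F. b k))"
      using F a(2) b(2) by (simp add: L2_set_def real_sqrt_mult subset_eq)
    also have "\<dots> \<le> sqrt (infsum a D * infsum b D)"
      using F a b by (intro real_sqrt_le_mono mult_mono finite_sum_le_infsum infsum_nonneg sum_nonneg) auto
    finally show ?thesis .
  qed
  then show "(\<lambda>k. norm (c k)) summable_on D"
    by (intro nonneg_bdd_above_summable_on) (auto intro!: bdd_aboveI2)
  then show "(\<Sum>\<^sub>\<infinity>k\<in>D. norm (c k)) \<le> sqrt (infsum a D * infsum b D)"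
    by (rule infsum_le_finite_sums) (rule fin)
qed

text \<open>The function enters only through its expansion with coefficients \<open>c\<close> of
  weighted norm at most 1. By \<open>good\<close> and oddness of \<open>R\<close>, a strict majority
  of the vectors is good for each frequency of \<open>A\<close>.\<close>

locale median_params = lattice_params +
  fixes \<alpha> \<theta> :: real and R :: nat and z :: "nat \<Rightarrow> nat \<Rightarrow> nat"
    and c :: "(nat \<Rightarrow> int) \<Rightarrow> complex" and f :: "(nat \<Rightarrow> real) \<Rightarrow> real"
  assumes alpha: "1 + e \<le> 2 * \<alpha>" and theta: "0 < \<theta>" and R: "odd R"
    and good: "\<And>h. h \<in> A \<Longrightarrow> card {r \<in> {1..R}. bad \<theta> h (z r)} \<le> R div 2"
    and norm_le1: "\<And>F. finite F \<Longrightarrow> F \<subseteq> int_vecs d \<Longrightarrow> (\<Sum>k\<in>F. (cmod (c k))\<^sup>2 * decay d g k powr - (2 * \<alpha>)) \<le> 1"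
    and ser: "\<And>x. x \<in> cube d \<Longrightarrow> complex_of_real (f x) = (\<Sum>\<^sub>\<infinity>h\<in>int_vecs d. c h * echar d h x)"
begin

text \<open>\<open>a\<close> and \<open>b\<close> split the squared coefficients for
  Cauchy--Schwarz: \<open>a\<close> carries the Korobov norm, \<open>b\<close> the inverse frequency
  function. \<open>T\<close> will bound the sum of \<open>b\<close> over a good coset without its
  base point.\<close>

definition a :: "(nat \<Rightarrow> int) \<Rightarrow> real" where "a k = (cmod (c k))\<^sup>2 * decay d g k powr - (2 * \<alpha>)"
definition b :: "(nat \<Rightarrow> int) \<Rightarrow> real" where "b k = decay d g k powr (2 * \<alpha>)"
definition T :: real where "T = \<theta> powr (2 * \<alpha> / (1 + e))"

lemma ab_nonneg: "0 \<le> a k" "0 \<le> b k"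
  by (auto simp: a_def b_def)

lemma c_eq_ab: "(cmod (c k))\<^sup>2 = a k * b k"
  using decay_bounds[of k] by (simp add: a_def b_def powr_minus)

lemma a_summable: "S \<subseteq> int_vecs d \<Longrightarrow> a summable_on S"
  by (rule nonneg_bdd_above_summable_on) (auto simp: ab_nonneg a_def intro!: bdd_aboveI2[where M = 1] norm_le1)

lemma infsum_a_le1: "S \<subseteq> int_vecs d \<Longrightarrow> infsum a S \<le> 1"
  by (rule infsum_le_finite_sums[OF a_summable]) (auto simp: a_def intro!: norm_le1)

lemma b_eq_wt: "b k = wt k * wt k powr (2 * \<alpha> / (1 + e) - 1)"
proof -
  have "1 + e \<noteq> 0" using e by simp
  then have "(1 + e) * (2 * \<alpha> / (1 + e)) = 2 * \<alpha>"
    by (metis nonzero_mult_div_cancel_left times_divide_eq_right)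
  then have "(1 + e) + (1 + e) * (2 * \<alpha> / (1 + e) - 1) = 2 * \<alpha>"
    by (simp add: right_diff_distrib)
  then show ?thesis
    unfolding b_def wt_def powr_powr powr_add[symmetric] by simp
qed

lemma exponent_nonneg: "0 \<le> 2 * \<alpha> / (1 + e) - 1"
  using alpha e by simp

lemma b_le_wt: "b k \<le> wt k"
  unfolding b_def wt_def using decay_bounds[of k] alpha by (intro powr_mono') auto

lemma b_summable: "S \<subseteq> int_vecs d \<Longrightarrow> b summable_on S"
  by (rule summable_on_comparison_test[OF wt_summable]) (auto simp: b_le_wt ab_nonneg)

lemma c_summable: "S \<subseteq> int_vecs d \<Longrightarrow> (\<lambda>k. cmod (c k)) summable_on S"
  by (rule Cauchy_Schwarz_infsum(1)[OF a_summable _ b_summable]) (auto simp: ab_nonneg c_eq_ab)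

lemma infsum_c_le:
  assumes "S \<subseteq> int_vecs d"
  shows "(\<Sum>\<^sub>\<infinity>k\<in>S. cmod (c k)) \<le> sqrt (infsum a S * infsum b S)"
  using assms by (intro Cauchy_Schwarz_infsum(2) a_summable b_summable) (auto simp: ab_nonneg c_eq_ab)

text \<open>Nonnegative terms with sum at most \<theta> are each at most \<theta>, so their powers
  with exponent \<open>s = 2 * \<alpha> / (1 + e) \<ge> 1\<close> sum to at most
  \<open>\<theta> powr s\<close>. This is why Markov's inequality is applied to the small exponent
  \<open>1 + e\<close>: the factor \<open>x\<close> lost there is negligible, and raising to
  \<open>s\<close> recovers nearly the full rate.\<close>

lemma infsum_b_good:
  assumes "\<not> bad \<theta> h y"
  shows "infsum b (dual_coset d N y h - {h}) \<le> T"
proof -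
  let ?D = "dual_coset d N y h - {h}"
  let ?p = "2 * \<alpha> / (1 + e) - 1"
  have sub: "?D \<subseteq> int_vecs d" using dual_coset_subset by auto
  have tl: "infsum wt ?D \<le> \<theta>" using assms by (simp add: bad_def tail_def)
  have "infsum b ?D \<le> (\<Sum>\<^sub>\<infinity>k\<in>?D. wt k * \<theta> powr ?p)"
  proof (rule infsum_mono)
    show "b summable_on ?D" "(\<lambda>k. wt k * \<theta> powr ?p) summable_on ?D"
      using sub by (auto intro!: b_summable summable_on_cmult_left wt_summable)
    fix k assume "k \<in> ?D"
    then have "wt k \<le> infsum wt ?D"
      using finite_sum_le_infsum[OF wt_summable[OF sub], of "{k}"] by (auto simp: wt_nonneg)
    then have "wt k \<le> \<theta>" using tl by linarith
    then show "b k \<le> wt k * \<theta> powr ?p"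
      unfolding b_eq_wt using exponent_nonneg by (intro mult_left_mono powr_mono2 wt_nonneg) auto
  qed
  also have "\<dots> = infsum wt ?D * \<theta> powr ?p"
    using sub by (intro infsum_cmult_left wt_summable)
  also have "\<dots> \<le> \<theta> * \<theta> powr ?p" using tl by (intro mult_right_mono) auto
  also have "\<dots> = T" using theta by (simp add: T_def powr_mult_base)
  finally show ?thesis .
qed

lemma lattice_coeff_error:
  assumes h: "h \<in> int_vecs d" and y: "\<not> bad \<theta> h y"
  shows "(cmod (lattice_coeff d N y f h - c h))\<^sup>2 \<le> T * infsum a (dual_coset d N y h - {h})"
proof -
  let ?D = "dual_coset d N y h - {h}"
  have sub: "?D \<subseteq> int_vecs d" using dual_coset_subset by auto
  have sc: "c summable_on ?D" by (rule abs_summable_summable) (use sub in \<open>auto intro: c_summable\<close>)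
  have "h \<in> dual_coset d N y h" using h by (simp add: dual_coset_def)
  then have "dual_coset d N y h = insert h ?D" by auto
  then have "lattice_coeff d N y f h = infsum c (insert h ?D)"
    using lattice_coeff_alias[OF _ c_summable[OF order_refl] ser, of N y h] N3 by simp
  also have "\<dots> = c h + infsum c ?D" by (rule infsum_insert) (use sc in auto)
  finally have "cmod (lattice_coeff d N y f h - c h) = cmod (infsum c ?D)" by simp
  also have "\<dots> \<le> (\<Sum>\<^sub>\<infinity>k\<in>?D. cmod (c k))" by (rule norm_infsum_bound) (rule c_summable[OF sub])
  also have "\<dots> \<le> sqrt (infsum a ?D * infsum b ?D)" by (rule infsum_c_le[OF sub])
  finally have "(cmod (lattice_coeff d N y f h - c h))\<^sup>2 \<le> (sqrt (infsum a ?D * infsum b ?D))\<^sup>2"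
    by (intro power_mono) auto
  also have "\<dots> = infsum a ?D * infsum b ?D"
    by (simp add: infsum_nonneg ab_nonneg)
  also have "\<dots> \<le> infsum a ?D * T"
    by (intro mult_left_mono infsum_b_good[OF y]) (simp add: infsum_nonneg ab_nonneg)
  finally show ?thesis by (simp add: mult.commute)
qed

abbreviation "med h \<equiv> median_coeff d N R z f h"

lemma T_nonneg: "0 \<le> T"
  by (simp add: T_def)

text \<open>Two frequencies of \<open>A\<close> that are both good for the same generating vector lie in different
  cosets of its dual lattice, so every Fourier coefficient is charged at most once per vector.\<close>

lemma median_error_le: "(\<Sum>h\<in>A. (cmod (med h - c h))\<^sup>2) \<le> real R * T"
proof -
  let ?D = "\<lambda>r h. dual_coset d N (z r) h - {h}"
  let ?G = "\<lambda>h. {r \<in> {1..R}. \<not> bad \<theta> h (z r)}"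
  let ?H = "\<lambda>r. {h \<in> A. \<not> bad \<theta> h (z r)}"
  have AI: "A \<subseteq> int_vecs d" by (auto simp: A_def)
  have one: "(cmod (med h - c h))\<^sup>2 \<le> (\<Sum>r\<in>?G h. T * infsum a (?D r h))" if h: "h \<in> A" for h
  proof -
    have "{1..R} = ?G h \<union> {r \<in> {1..R}. bad \<theta> h (z r)}" by auto
    then have "card {1..R} = card (?G h \<union> {r \<in> {1..R}. bad \<theta> h (z r)})" by (rule arg_cong)
    also have "\<dots> = card (?G h) + card {r \<in> {1..R}. bad \<theta> h (z r)}"
      by (rule card_Un_disjoint) auto
    finally have "R = card (?G h) + card {r \<in> {1..R}. bad \<theta> h (z r)}" by simp
    then have "R div 2 < card (?G h)" using good[OF h] R by (auto elim!: oddE)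
    then have "(cmod (med h - c h))\<^sup>2 \<le> (\<Sum>r\<in>?G h. (cmod (lattice_coeff d N (z r) f h - c h))\<^sup>2)"
      unfolding median_coeff_def by (intro complex_median_error R) auto
    also have "\<dots> \<le> (\<Sum>r\<in>?G h. T * infsum a (?D r h))"
      using h AI by (intro sum_mono lattice_coeff_error) auto
    finally show ?thesis .
  qed
  have "(\<Sum>h\<in>A. (cmod (med h - c h))\<^sup>2) \<le> (\<Sum>h\<in>A. \<Sum>r\<in>?G h. T * infsum a (?D r h))"
    by (rule sum_mono) (rule one)
  also have "\<dots> = (\<Sum>r\<in>{1..R}. \<Sum>h\<in>?H r. T * infsum a (?D r h))"
    by (rule sum.swap_restrict) (auto simp: finite_A)
  also have "\<dots> \<le> (\<Sum>r\<in>{1..R}. T * 1)"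
  proof (rule sum_mono)
    fix r
    have disj: "?D r h \<inter> ?D r h' = {}" if hh: "h \<in> ?H r" "h' \<in> ?H r" "h \<noteq> h'" for h h'
    proof (rule ccontr)
      assume "?D r h \<inter> ?D r h' \<noteq> {}"
      then obtain k where k: "k \<in> dual_coset d N (z r) h" "k \<in> dual_coset d N (z r) h'" by auto
      have "int N dvd (idot d k (z r) - idot d h (z r)) - (idot d k (z r) - idot d h' (z r))"
        by (rule dvd_diff) (use k in \<open>auto simp: dual_coset_def\<close>)
      then have "h' \<in> dual_coset d N (z r) h" using hh AI by (auto simp: dual_coset_def)
      then show False using hh by (auto simp: bad_def)
    qed
    have "(\<Sum>h\<in>?H r. T * infsum a (?D r h)) = T * (\<Sum>h\<in>?H r. infsum a (?D r h))"
      by (simp add: sum_distrib_left)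
    also have "(\<Sum>h\<in>?H r. infsum a (?D r h)) = infsum a (\<Union>h\<in>?H r. ?D r h)"
    proof (rule sum_infsum)
      show "finite (?H r)" using finite_A by simp
      show "a summable_on ?D r h" for h using dual_coset_subset by (intro a_summable) blast
    qed (rule disj)
    also have "T * \<dots> \<le> T * 1"
      using dual_coset_subset by (intro mult_left_mono infsum_a_le1 T_nonneg) blast
    finally show "(\<Sum>h\<in>?H r. T * infsum a (?D r h)) \<le> T * 1" .
  qed
  also have "\<dots> = real R * T" by simp
  finally show ?thesis .
qed

text \<open>The coefficients of the error \<open>f\<close> minus its reconstruction: aliasing error
  on \<open>A\<close>, truncation error elsewhere.\<close>

definition c' :: "(nat \<Rightarrow> int) \<Rightarrow> complex" where
  "c' k = c k - (if k \<in> A then med k else 0)"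

lemma inverse_L_powr: "(1 / L) powr x = L powr - x"
  using L by (simp add: powr_divide powr_minus inverse_eq_divide)

lemma decay_outside: "k \<in> int_vecs d \<Longrightarrow> k \<notin> A \<Longrightarrow> decay d g k \<le> 1 / L"
  using L by (auto simp: A_def not_less field_simps)

text \<open>The two terms are aliasing and truncation; off \<open>A\<close> the decay is at most
  \<open>1 / L\<close>, which gives \<open>b k \<le> L powr - (2 * \<alpha>)\<close>.\<close>

lemma sum_c'_square_le:
  assumes F: "finite F" "F \<subseteq> int_vecs d"
  shows "(\<Sum>k\<in>F. (cmod (c' k))\<^sup>2) \<le> real R * T + L powr - (2 * \<alpha>)"
proof -
  have "(\<Sum>k\<in>F. (cmod (c' k))\<^sup>2) = (\<Sum>k\<in>F \<inter> A. (cmod (c' k))\<^sup>2) + (\<Sum>k\<in>F - A. (cmod (c' k))\<^sup>2)"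
    using F by (simp add: sum.Int_Diff)
  also have "(\<Sum>k\<in>F \<inter> A. (cmod (c' k))\<^sup>2) = (\<Sum>k\<in>F \<inter> A. (cmod (med k - c k))\<^sup>2)"
    by (intro sum.cong) (auto simp: c'_def norm_minus_commute)
  also have "\<dots> \<le> (\<Sum>k\<in>A. (cmod (med k - c k))\<^sup>2)"
    by (intro sum_mono2 finite_A) auto
  also have "\<dots> \<le> real R * T" by (rule median_error_le)
  also have "(\<Sum>k\<in>F - A. (cmod (c' k))\<^sup>2) \<le> (\<Sum>k\<in>F - A. L powr - (2 * \<alpha>) * a k)"
  proof (rule sum_mono)
    fix k assume k: "k \<in> F - A"
    have "b k \<le> (1 / L) powr (2 * \<alpha>)"
      unfolding b_def using k F decay_outside[of k] decay_bounds[of k] alpha e by (intro powr_mono2) auto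
    also have "\<dots> = L powr - (2 * \<alpha>)" by (rule inverse_L_powr)
    finally have "a k * b k \<le> a k * L powr - (2 * \<alpha>)" by (intro mult_left_mono ab_nonneg)
    then show "(cmod (c' k))\<^sup>2 \<le> L powr - (2 * \<alpha>) * a k"
      using k by (simp add: c'_def c_eq_ab mult.commute)
  qed
  also have "\<dots> = L powr - (2 * \<alpha>) * (\<Sum>k\<in>F - A. a k)" by (simp add: sum_distrib_left)
  also have "\<dots> \<le> L powr - (2 * \<alpha>) * 1"
    unfolding a_def using F by (intro mult_left_mono norm_le1) auto
  finally show ?thesis by simp
qed

text \<open>On \<open>A\<close> the passage from the square sum to the absolute sum costs
  \<open>sqrt (card A)\<close>. Off \<open>A\<close>, only the surplus exponent
  \<open>2 * \<alpha> - 1 - e\<close> of \<open>b\<close> is turned into a power of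
  \<open>1 / L\<close>; the remaining \<open>wt\<close> keeps the sum convergent.\<close>

lemma infsum_c'_le:
  shows "(\<lambda>k. cmod (c' k)) summable_on int_vecs d" (is ?S)
    and "(\<Sum>\<^sub>\<infinity>k\<in>int_vecs d. cmod (c' k))
      \<le> sqrt (real (card A) * (real R * T)) + sqrt (L powr - (2 * \<alpha> - 1 - e) * \<Pi>\<^sub>e)" (is ?B)
proof -
  let ?I = "int_vecs d"
  have AI: "A \<subseteq> ?I" by (auto simp: A_def)
  have I: "?I = A \<union> (?I - A)" using AI by auto
  have out: "(\<lambda>k. cmod (c' k)) summable_on (?I - A)"
    by (rule summable_on_cong[THEN iffD2, OF _ c_summable]) (auto simp: c'_def)
  show ?S by (subst I, rule summable_on_Un_disjoint) (use out finite_A in auto)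
  have "(\<Sum>\<^sub>\<infinity>k\<in>?I. cmod (c' k)) = (\<Sum>k\<in>A. cmod (c' k)) + (\<Sum>\<^sub>\<infinity>k\<in>?I - A. cmod (c' k))"
    by (subst I, subst infsum_Un_disjoint) (use out finite_A in auto)
  also have "(\<Sum>\<^sub>\<infinity>k\<in>?I - A. cmod (c' k)) = (\<Sum>\<^sub>\<infinity>k\<in>?I - A. cmod (c k))"
    by (rule infsum_cong) (auto simp: c'_def)
  also have "\<dots> \<le> sqrt (infsum a (?I - A) * infsum b (?I - A))" by (rule infsum_c_le) auto
  also have "\<dots> \<le> sqrt (1 * (L powr - (2 * \<alpha> - 1 - e) * \<Pi>\<^sub>e))"
  proof (intro real_sqrt_le_mono mult_mono)
    show "infsum a (?I - A) \<le> 1" by (rule infsum_a_le1) auto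
    show "infsum b (?I - A) \<le> L powr - (2 * \<alpha> - 1 - e) * \<Pi>\<^sub>e"
    proof (rule infsum_le_finite_sums[OF b_summable])
      fix F assume F: "finite F" "F \<subseteq> ?I - A"
      have "(\<Sum>k\<in>F. b k) \<le> (\<Sum>k\<in>F. L powr - (2 * \<alpha> - 1 - e) * wt k)"
      proof (rule sum_mono)
        fix k assume k: "k \<in> F"
        have "b k = decay d g k powr (2 * \<alpha> - 1 - e) * wt k"
          unfolding b_def wt_def powr_add[symmetric] by simp
        also have "\<dots> \<le> (1 / L) powr (2 * \<alpha> - 1 - e) * wt k"
          using k F decay_outside[of k] decay_bounds[of k] alpha
          by (intro mult_right_mono wt_nonneg powr_mono2) auto
        also have "(1 / L) powr (2 * \<alpha> - 1 - e) = L powr - (2 * \<alpha> - 1 - e)"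
          by (rule inverse_L_powr)
        finally show "b k \<le> L powr - (2 * \<alpha> - 1 - e) * wt k" .
      qed
      also have "\<dots> = L powr - (2 * \<alpha> - 1 - e) * (\<Sum>k\<in>F. wt k)" by (simp add: sum_distrib_left)
      also have "\<dots> \<le> L powr - (2 * \<alpha> - 1 - e) * \<Pi>\<^sub>e"
        unfolding wt_def using F g e by (intro mult_left_mono sum_decay_powr_le) auto
      finally show "(\<Sum>k\<in>F. b k) \<le> L powr - (2 * \<alpha> - 1 - e) * \<Pi>\<^sub>e" .
    qed auto
  qed (auto simp: ab_nonneg infsum_nonneg)
  also have "(\<Sum>k\<in>A. cmod (c' k)) \<le> sqrt (real (card A) * (real R * T))"
  proof -
    have "(\<Sum>k\<in>A. \<bar>1\<bar> * \<bar>cmod (c' k)\<bar>) \<le> L2_set (\<lambda>_. 1) A * L2_set (\<lambda>k. cmod (c' k)) A"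
      by (rule L2_set_mult_ineq)
    also have "\<dots> = sqrt (real (card A) * (\<Sum>k\<in>A. (cmod (c' k))\<^sup>2))"
      by (simp add: L2_set_def real_sqrt_mult)
    also have "(\<Sum>k\<in>A. (cmod (c' k))\<^sup>2) = (\<Sum>k\<in>A. (cmod (med k - c k))\<^sup>2)"
      by (intro sum.cong) (auto simp: c'_def norm_minus_commute)
    also have "sqrt (real (card A) * \<dots>) \<le> sqrt (real (card A) * (real R * T))"
      by (intro real_sqrt_le_mono mult_left_mono median_error_le) auto
    finally show ?thesis by simp
  qed
  finally show ?B by simp
qed

lemma error_series:
  assumes x: "x \<in> cube d"
  shows "complex_of_real (f x) - median_lattice d N R z A f x = (\<Sum>\<^sub>\<infinity>k\<in>int_vecs d. c' k * echar d k x)"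
proof -
  let ?I = "int_vecs d"
  have AI: "A \<subseteq> ?I" by (auto simp: A_def)
  have "((\<lambda>k. (if k \<in> A then med k else 0) * echar d k x) has_sum (\<Sum>k\<in>A. med k * echar d k x)) ?I"
    by (rule has_sum_cong_neutral[THEN iffD1, OF _ _ _ has_sum_finite[OF finite_A]]) (use AI in auto)
  moreover have "(\<Sum>k\<in>A. med k * echar d k x) = median_lattice d N R z A f x"
    unfolding median_lattice_def exp_eq_echar ..
  moreover have "((\<lambda>k. c k * echar d k x) has_sum complex_of_real (f x)) ?I"
    unfolding ser[OF x]
    by (rule has_sum_infsum, rule abs_summable_summable)
      (use c_summable[OF order_refl] in \<open>simp add: norm_mult\<close>)
  ultimately have "((\<lambda>k. c k * echar d k x + - ((if k \<in> A then med k else 0) * echar d k x)) has_sum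
      (complex_of_real (f x) + - median_lattice d N R z A f x)) ?I"
    by (intro has_sum_add has_sum_uminus[THEN iffD2]) simp_all
  then have "((\<lambda>k. c' k * echar d k x) has_sum (complex_of_real (f x) - median_lattice d N R z A f x)) ?I"
    by (simp add: c'_def left_diff_distrib)
  then show ?thesis by (rule infsumI[symmetric])
qed

end

section \<open>Norms and constants\<close>

text \<open>Below exponent 2 the square integral suffices on a probability space. Above it,
  \<open>q - 2\<close> powers are estimated by the uniform bound:
  \<open>(a * n powr (1 / 2)) powr (q - 2) * a\<^sup>2\<close> is the \<open>q\<close>-th power of
  \<open>a * n powr (1 / 2 - 1 / q)\<close>.\<close>

lemma Lp_norm_le:
  fixes u :: "(nat \<Rightarrow> real) \<Rightarrow> complex" and p :: ennreal
  assumes u: "u \<in> borel_measurable (cube_measure d)" and a: "0 < a" and n: "1 \<le> n" and p: "1 \<le> p"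
    and L2: "(\<integral>\<^sup>+x. ennreal ((cmod (u x))\<^sup>2) \<partial>cube_measure d) \<le> ennreal (a\<^sup>2)"
    and sup: "\<And>x. x \<in> cube d \<Longrightarrow> cmod (u x) \<le> a * n powr (1 / 2)"
  shows "Lp_norm d p u \<le> ennreal (a * n powr max (1 / 2 - enn2real (1 / p)) 0)"
proof (cases "p = \<infinity>")
  case True
  have "esssup (cube_measure d) (\<lambda>x. ennreal (cmod (u x))) \<le> ennreal (a * n powr (1 / 2))"
    using u sup by (intro esssup_I AE_I2) (auto simp: space_cube ennreal_leI)
  then show ?thesis using True by (simp add: Lp_norm_def)
next
  case False
  interpret C: prob_space "cube_measure d" by (rule prob_space_cube)
  define q where "q = enn2real p"
  have pq: "p = ennreal q" using False by (simp add: q_def top.not_eq_extremum)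
  have q1: "1 \<le> q" using p unfolding pq by (metis ennreal_1 ennreal_le_iff2 le_numeral_extra(3) not_one_le_zero zero_less_one order_trans less_le_not_le)
  have ip: "enn2real (1 / p) = 1 / q"
    unfolding pq using q1 by (simp add: divide_ennreal flip: ennreal_1)
  define s where "s = max (1 / 2 - 1 / q) 0"
  let ?b = "a * n powr s"
  let ?I = "\<integral>\<^sup>+x. ennreal (cmod (u x) powr q) \<partial>cube_measure d"
  have b: "0 < ?b" using a n by simp
  have I: "?I \<le> ennreal (?b powr q)"
  proof (cases "q \<le> 2")
    case True
    \<comment> \<open>A replacement for Jensen's inequality: the concave function
      \<open>s powr (q / 2)\<close> lies below its tangent at \<open>s = a\<^sup>2\<close>, whose
      integral is at most \<open>a powr q\<close>.\<close>
    have pw: "t powr q \<le> a powr q * (1 - q / 2) + a powr q * (q / 2) / a\<^sup>2 * t\<^sup>2" if "0 \<le> t" for t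
    proof (cases "t = 0")
      case True
      then show ?thesis using a \<open>q \<le> 2\<close> q1 by simp
    next
      case False
      then have t: "0 < t" using that by simp
      have "(t\<^sup>2 / a\<^sup>2) powr (q / 2) \<le> 1 + (q / 2) * (t\<^sup>2 / a\<^sup>2 - 1)"
      proof -
        have "(1::real) powr (1 - q / 2) * (t\<^sup>2 / a\<^sup>2) powr (q / 2) \<le> (1 - q / 2) * 1 + (q / 2) * (t\<^sup>2 / a\<^sup>2)"
          using True q1 t a by (intro Youngs_inequality_0) auto
        then show ?thesis by (simp add: algebra_simps)
      qed
      moreover have "(t\<^sup>2 / a\<^sup>2) powr (q / 2) = t powr q / a powr q"
        using t a by (simp add: powr_divide powr_powr flip: powr_numeral)
      ultimately have "t powr q \<le> a powr q * (1 + (q / 2) * (t\<^sup>2 / a\<^sup>2 - 1))"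
        using a by (simp add: pos_divide_le_eq mult.commute)
      then show ?thesis by (simp add: algebra_simps)
    qed
    have k: "0 \<le> a powr q * (1 - q / 2)" "0 \<le> a powr q * (q / 2) / a\<^sup>2" using True q1 by auto
    have "?I \<le> (\<integral>\<^sup>+x. ennreal (a powr q * (1 - q / 2)) + ennreal (a powr q * (q / 2) / a\<^sup>2) * ennreal ((cmod (u x))\<^sup>2) \<partial>cube_measure d)"
    proof (rule nn_integral_mono)
      fix x
      have "0 \<le> a powr q * (q / 2) / a\<^sup>2 * (cmod (u x))\<^sup>2" using k(2) by (intro mult_nonneg_nonneg) auto
      then have "ennreal (a powr q * (1 - q / 2)) + ennreal (a powr q * (q / 2) / a\<^sup>2) * ennreal ((cmod (u x))\<^sup>2)
          = ennreal (a powr q * (1 - q / 2) + a powr q * (q / 2) / a\<^sup>2 * (cmod (u x))\<^sup>2)"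
        using k by (simp only: ennreal_plus ennreal_mult zero_le_power2)
      then show "ennreal (cmod (u x) powr q) \<le> ennreal (a powr q * (1 - q / 2)) + ennreal (a powr q * (q / 2) / a\<^sup>2) * ennreal ((cmod (u x))\<^sup>2)"
        using pw[OF norm_ge_zero, of "u x"] by (simp only: ennreal_leI)
    qed
    also have "\<dots> = ennreal (a powr q * (1 - q / 2)) + ennreal (a powr q * (q / 2) / a\<^sup>2) * (\<integral>\<^sup>+x. ennreal ((cmod (u x))\<^sup>2) \<partial>cube_measure d)"
      using u by (subst nn_integral_add) (auto simp: nn_integral_cmult C.emeasure_space_1)
    also have "\<dots> \<le> ennreal (a powr q * (1 - q / 2)) + ennreal (a powr q * (q / 2) / a\<^sup>2) * ennreal (a\<^sup>2)"
      by (intro add_left_mono mult_left_mono L2) simp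
    also have "\<dots> = ennreal (a powr q * (1 - q / 2) + a powr q * (q / 2) / a\<^sup>2 * a\<^sup>2)"
      using k by (simp only: ennreal_plus ennreal_mult zero_le_power2 mult_nonneg_nonneg)
    also have "a powr q * (1 - q / 2) + a powr q * (q / 2) / a\<^sup>2 * a\<^sup>2 = a powr q"
      using a by (simp add: algebra_simps)
    also have "ennreal (a powr q) \<le> ennreal (?b powr q)"
      using a n q1 by (intro ennreal_leI powr_mono2) (auto simp: s_def ge_one_powr_ge_zero)
    finally show ?thesis .
  next
    case False
    define m where "m = (a * n powr (1 / 2)) powr (q - 2)"
    have "?I \<le> (\<integral>\<^sup>+x. ennreal m * ennreal ((cmod (u x))\<^sup>2) \<partial>cube_measure d)"
    proof (rule nn_integral_mono)
      fix x assume "x \<in> space (cube_measure d)"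
      then have x: "x \<in> cube d" by (simp add: space_cube)
      have "cmod (u x) powr q = cmod (u x) powr (q - 2) * (cmod (u x))\<^sup>2"
      proof (cases "u x = 0")
        case False
        then have "(cmod (u x))\<^sup>2 = cmod (u x) powr 2" by simp
        then show ?thesis unfolding \<open>(cmod (u x))\<^sup>2 = cmod (u x) powr 2\<close> powr_add[symmetric] by simp
      qed (use q1 in simp)
      also have "\<dots> \<le> m * (cmod (u x))\<^sup>2"
        unfolding m_def using False sup[OF x] by (intro mult_right_mono powr_mono2) auto
      finally show "ennreal (cmod (u x) powr q) \<le> ennreal m * ennreal ((cmod (u x))\<^sup>2)"
        by (simp add: ennreal_mult[symmetric] m_def ennreal_leI)
    qed
    also have "\<dots> = ennreal m * (\<integral>\<^sup>+x. ennreal ((cmod (u x))\<^sup>2) \<partial>cube_measure d)"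
      using u by (intro nn_integral_cmult) auto
    also have "\<dots> \<le> ennreal m * ennreal (a\<^sup>2)" by (intro mult_left_mono L2) simp
    also have "\<dots> = ennreal (m * a\<^sup>2)" by (simp add: ennreal_mult m_def)
    also have "m * a\<^sup>2 = ?b powr q"
    proof -
      have "1 / q \<le> 1 / 2" using False q1 by (intro divide_left_mono) auto
      then have s: "s * q = (q - 2) / 2" using q1 False by (simp add: s_def left_diff_distrib diff_divide_distrib)
      have "m * a\<^sup>2 = a powr (q - 2) * a powr 2 * n powr ((q - 2) / 2)"
        using a n by (simp add: m_def powr_mult powr_powr)
      also have "\<dots> = a powr q * n powr (s * q)" unfolding s powr_add[symmetric] by simp
      also have "\<dots> = ?b powr q" using a n by (simp add: powr_mult powr_powr)
      finally show ?thesis .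
    qed
    finally show ?thesis .
  qed
  then have fin: "?I \<noteq> \<infinity>" using ennreal_less_top leD by fastforce
  have "enn2real ?I \<le> ?b powr q" using I by (rule enn2real_leI[OF powr_ge_zero])
  then have "enn2real ?I powr (1 / q) \<le> (?b powr q) powr (1 / q)"
    using q1 by (intro powr_mono2) auto
  also have "\<dots> = ?b" using b q1 by (simp add: powr_powr)
  finally have "ennreal (enn2real ?I powr (1 / q)) \<le> ennreal ?b" by (rule ennreal_leI)
  then show ?thesis using False fin unfolding Lp_norm_def ip s_def q_def[symmetric] by (simp add: Let_def)
qed

text \<open>The growth bounds use exponent \<open>\<beta> / (2 * \<alpha>)\<close> because they are
  raised to powers up to \<open>2 * \<alpha>\<close>. \<open>c\<^sub>2\<close> covers aliasing.
  \<open>c\<^sub>3\<close> covers both truncation bounds; its factor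
  \<open>exp (2 * \<alpha> - 1) * K\<close> comes from the uniform one.\<close>

lemma error_constants:
  fixes \<alpha> \<tau> K n \<beta> :: real
  assumes \<alpha>: "1 / 2 < \<alpha>" and \<tau>: "0 < \<tau>" and K: "1 \<le> K" and n: "3 \<le> n" and \<beta>: "0 < \<beta>"
    and P: "1 \<le> P" "P \<le> K * n powr (\<beta> / (2 * \<alpha>))"
    and Q: "1 \<le> Q" "Q \<le> K * n powr (\<beta> / (2 * \<alpha>))"
    and x: "1 \<le> x" "x \<le> K * n powr (\<beta> / (2 * \<alpha>))"
  defines "e \<equiv> (2 * \<alpha> - 1) / ln n"
    and "L \<equiv> (n - 1) / (exp (1 / \<tau>) * P)"
    and "\<theta> \<equiv> 3 * Q / (n - 1) * x"
    and "c\<^sub>2 \<equiv> (6 * K\<^sup>2) powr (2 * \<alpha>) * exp (2 * \<alpha> * (2 * \<alpha> - 1))"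
    and "c\<^sub>3 \<equiv> (2 * exp (1 / \<tau>) * K) powr (2 * \<alpha>) * exp (2 * \<alpha> - 1) * K"
  shows "\<theta> powr (2 * \<alpha> / (1 + e)) \<le> c\<^sub>2 * n powr (- 2 * \<alpha> + 2 * \<beta>)"
    and "L powr - (2 * \<alpha>) \<le> c\<^sub>3 * n powr (- 2 * \<alpha> + 2 * \<beta>)"
    and "L powr - (2 * \<alpha> - 1 - e) * Q \<le> c\<^sub>3 * n powr (1 - 2 * \<alpha> + 2 * \<beta>)"
proof -
  define \<beta>0 where "\<beta>0 = \<beta> / (2 * \<alpha>)"
  have b0: "0 < \<beta>0" "\<beta>0 \<le> \<beta>" "2 * \<alpha> * \<beta>0 = \<beta>" using \<alpha> \<beta> by (auto simp: \<beta>0_def field_simps)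
  have "1 \<le> ln (3::real)" using exp_le by (simp add: ln_ge_iff)
  then have lnn: "1 \<le> ln n" using n by (smt (verit) ln_le_cancel_iff)
  have e: "0 < e" "1 + e \<le> 2 * \<alpha>"
    using \<alpha> lnn mult_right_mono[OF lnn, of "2 * \<alpha> - 1"] by (auto simp: e_def field_simps)
  \<comment> \<open>The point of the choice of \<open>e\<close>: losses in the exponent proportional
    to \<open>e\<close> become constants.\<close>
  have ne: "n powr (t * e) = exp (t * (2 * \<alpha> - 1))" for t
    using n lnn by (simp add: powr_def e_def)
  have n1: "1 / (n - 1) \<le> 2 / n" using n by (simp add: field_simps)
  show "\<theta> powr (2 * \<alpha> / (1 + e)) \<le> c\<^sub>2 * n powr (- 2 * \<alpha> + 2 * \<beta>)"
  proof -
    \<comment> \<open>The 6 is the 3 in \<theta> times the 2 from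
      \<open>1 / (n - 1) \<le> 2 / n\<close>; \<open>Q\<close> and \<open>x\<close> each contribute
      \<open>K * n powr \<beta>0\<close>.\<close>
    define W where "W = 6 * K\<^sup>2 * n powr (2 * \<beta>0)"
    have W1: "1 \<le> W"
      using K n b0 mult_mono[of 1 "6 * K\<^sup>2" 1 "n powr (2 * \<beta>0)"] one_le_power[OF K, of 2]
      by (simp add: W_def ge_one_powr_ge_zero)
    have "\<theta> = 3 * (Q * x) * (1 / (n - 1))" by (simp add: \<theta>_def)
    also have "\<dots> \<le> 3 * ((K * n powr \<beta>0) * (K * n powr \<beta>0)) * (2 / n)"
      using P Q x K n n1 unfolding \<beta>0_def by (intro mult_mono) auto
    also have "\<dots> = W / n" by (simp add: W_def power2_eq_square powr_add[symmetric] mult_ac)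
    finally have "\<theta> \<le> W / n" .
    moreover have "0 < \<theta>" using Q x n by (simp add: \<theta>_def)
    ultimately have "\<theta> powr (2 * \<alpha> / (1 + e)) \<le> (W / n) powr (2 * \<alpha> / (1 + e))"
      using e \<alpha> by (intro powr_mono2) auto
    also have "\<dots> = W powr (2 * \<alpha> / (1 + e)) * n powr - (2 * \<alpha> / (1 + e))"
      using W1 n powr_divide[of W n "2 * \<alpha> / (1 + e)"] powr_minus[of n "2 * \<alpha> / (1 + e)"] by (simp add: inverse_eq_divide)
    \<comment> \<open>Uses \<open>1 \<le> W\<close> for the first factor and
      \<open>1 - e \<le> 1 / (1 + e)\<close> for the second.\<close>
    also have "\<dots> \<le> W powr (2 * \<alpha>) * n powr (- 2 * \<alpha> + 2 * \<alpha> * e)"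
    proof (intro mult_mono powr_mono)
      show "2 * \<alpha> / (1 + e) \<le> 2 * \<alpha>" using e \<alpha> by (simp add: field_simps)
      have "2 * \<alpha> * (1 - e) * (1 + e) \<le> 2 * \<alpha>" using e \<alpha> by (simp add: algebra_simps)
      then have "2 * \<alpha> * (1 - e) \<le> 2 * \<alpha> / (1 + e)" using e by (simp add: pos_le_divide_eq)
      then show "- (2 * \<alpha> / (1 + e)) \<le> - 2 * \<alpha> + 2 * \<alpha> * e" by (simp add: algebra_simps)
    qed (use W1 n in auto)
    also have "n powr (- 2 * \<alpha> + 2 * \<alpha> * e) = n powr (- 2 * \<alpha>) * exp (2 * \<alpha> * (2 * \<alpha> - 1))"
      unfolding powr_add ne ..
    also have "W powr (2 * \<alpha>) = (6 * K\<^sup>2) powr (2 * \<alpha>) * n powr (2 * \<beta>)"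
    proof -
      have "W powr (2 * \<alpha>) = (6 * K\<^sup>2) powr (2 * \<alpha>) * n powr (2 * (2 * \<alpha> * \<beta>0))"
        unfolding W_def using K n by (subst powr_mult) (auto simp: powr_powr mult_ac)
      then show ?thesis unfolding b0(3) .
    qed
    also have "(6 * K\<^sup>2) powr (2 * \<alpha>) * n powr (2 * \<beta>) * (n powr (- 2 * \<alpha>) * exp (2 * \<alpha> * (2 * \<alpha> - 1)))
        = c\<^sub>2 * (n powr (- 2 * \<alpha>) * n powr (2 * \<beta>))" unfolding c\<^sub>2_def by (simp only: mult_ac)
    finally show ?thesis unfolding powr_add .
  qed
  define c where "c = 2 * exp (1 / \<tau>) * K"
  have "1 \<le> exp (1 / \<tau>)" using \<tau> by simp
  then have "1 \<le> 2 * exp (1 / \<tau>)" by linarith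
  then have c1: "1 \<le> c" using K mult_mono[of 1 "2 * exp (1 / \<tau>)" 1 K] by (simp add: c_def)
  have Llow: "n powr (1 - \<beta>0) / c \<le> L"
  proof -
    have "n powr (1 - \<beta>0) / c = (n / 2) / (exp (1 / \<tau>) * (K * n powr \<beta>0))"
      using n by (simp add: c_def powr_diff)
    also have "\<dots> \<le> (n - 1) / (exp (1 / \<tau>) * P)"
      using n K P unfolding \<beta>0_def by (intro frac_le mult_left_mono) auto
    finally show ?thesis by (simp add: L_def)
  qed
  \<comment> \<open>Stated for all \<open>s\<close> up to \<open>2 * \<alpha>\<close>, since both
    \<open>s = 2 * \<alpha>\<close> and \<open>s = 2 * \<alpha> - 1 - e\<close> are required with
    the same constant.\<close>
  have Ls: "L powr - s \<le> c powr (2 * \<alpha>) * n powr (- s + \<beta>)" if s: "0 \<le> s" "s \<le> 2 * \<alpha>" for s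
  proof -
    have "L powr - s \<le> (n powr (1 - \<beta>0) / c) powr - s"
      using Llow c1 n s by (intro powr_mono2') auto
    also have "\<dots> = c powr s * n powr (- s + \<beta>0 * s)"
    proof -
      have "(n powr (1 - \<beta>0) / c) powr - s = n powr ((1 - \<beta>0) * - s) / c powr - s"
        using n c1 by (simp add: powr_divide powr_powr)
      also have "(1 - \<beta>0) * - s = - s + \<beta>0 * s" by (simp add: algebra_simps)
      finally show ?thesis using c1 by (simp add: powr_minus divide_inverse mult.commute)
    qed
    also have "\<dots> \<le> c powr (2 * \<alpha>) * n powr (- s + \<beta>)"
    proof (intro mult_mono powr_mono)
      have "\<beta>0 * s \<le> \<beta>0 * (2 * \<alpha>)" using b0 s by (intro mult_left_mono) auto
      then show "- s + \<beta>0 * s \<le> - s + \<beta>" using b0(3) by (simp add: mult_ac)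
    qed (use s c1 n in auto)
    finally show ?thesis .
  qed
  have ex: "1 \<le> exp (2 * \<alpha> - 1) * K"
    using K \<alpha> mult_mono[of 1 "exp (2 * \<alpha> - 1)" 1 K] by simp
  have c3: "c powr (2 * \<alpha>) \<le> c\<^sub>3"
    using mult_left_mono[OF ex, of "c powr (2 * \<alpha>)"] by (simp add: c\<^sub>3_def c_def mult.assoc)
  show "L powr - (2 * \<alpha>) \<le> c\<^sub>3 * n powr (- 2 * \<alpha> + 2 * \<beta>)"
  proof -
    have "L powr - (2 * \<alpha>) \<le> c powr (2 * \<alpha>) * n powr (- (2 * \<alpha>) + \<beta>)" using \<alpha> by (intro Ls) auto
    also have "\<dots> \<le> c\<^sub>3 * n powr (- 2 * \<alpha> + 2 * \<beta>)"
      using c3 n \<beta> order_trans[OF powr_ge_zero c3] by (intro mult_mono powr_mono) auto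
    finally show ?thesis .
  qed
  show "L powr - (2 * \<alpha> - 1 - e) * Q \<le> c\<^sub>3 * n powr (1 - 2 * \<alpha> + 2 * \<beta>)"
  proof -
    have "L powr - (2 * \<alpha> - 1 - e) * Q \<le> (c powr (2 * \<alpha>) * n powr (- (2 * \<alpha> - 1 - e) + \<beta>)) * (K * n powr \<beta>)"
    proof (rule mult_mono)
      show "L powr - (2 * \<alpha> - 1 - e) \<le> c powr (2 * \<alpha>) * n powr (- (2 * \<alpha> - 1 - e) + \<beta>)"
        using e by (intro Ls) auto
      have "K * n powr \<beta>0 \<le> K * n powr \<beta>" using K n b0 by (intro mult_left_mono powr_mono) auto
      then show "Q \<le> K * n powr \<beta>" using Q unfolding \<beta>0_def by linarith
    qed (use Q in auto)
    also have "n powr (- (2 * \<alpha> - 1 - e) + \<beta>) = n powr (1 - 2 * \<alpha> + \<beta>) * n powr (1 * e)"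
      unfolding powr_add[symmetric] by (simp add: algebra_simps)
    also have "\<dots> = n powr (1 - 2 * \<alpha> + \<beta>) * exp (2 * \<alpha> - 1)" unfolding ne by simp
    finally have "L powr - (2 * \<alpha> - 1 - e) * Q \<le> c\<^sub>3 * (n powr (1 - 2 * \<alpha> + \<beta>) * n powr \<beta>)"
      by (simp add: c\<^sub>3_def c_def mult_ac)
    also have "n powr (1 - 2 * \<alpha> + \<beta>) * n powr \<beta> = n powr (1 - 2 * \<alpha> + 2 * \<beta>)"
      unfolding powr_add[symmetric] by (simp add: algebra_simps)
    finally show ?thesis .
  qed
qed

section \<open>The main theorem\<close>

lemma ln_3_ge_1: "1 \<le> ln (3::real)"
  using exp_le by (simp add: ln_ge_iff)

lemma P_fac_eq_Pi_fac:
  "P_fac N d \<tau> \<alpha> \<gamma> = Pi_fac d (\<lambda>j. \<gamma> j powr (1 / (2 * \<alpha>))) (1 + \<tau> * ln (real N))"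
  by (simp add: P_fac_def Pi_fac_def)

text \<open>A single choice function provides the constants for every dimension. If the weights are
  not summable, only dependence on \<open>d\<close> is possible, and the uniform bound is applied to
  the sequence cut off after \<open>d\<close>.\<close>

lemma growth_constants:
  fixes g :: "nat \<Rightarrow> real"
  assumes g: "\<And>j. 1 \<le> j \<Longrightarrow> 0 < g j \<and> g j \<le> 1" and \<tau>: "0 < \<tau>" "0 < \<tau>'"
  shows "\<exists>K :: nat \<Rightarrow> real \<Rightarrow> real.
     (\<forall>d b. 0 < b \<longrightarrow> 1 \<le> K d b \<and> (\<forall>x\<ge>1.
        Pi_fac d g (1 + \<tau> * ln x) \<le> K d b * x powr b \<and>
        Pi_fac d g (1 + \<tau>' * ln x) \<le> K d b * x powr b \<and>
        1 + \<tau> * ln x \<le> K d b * x powr b)) \<and>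
     (summable (\<lambda>j. g (Suc j)) \<longrightarrow> (\<forall>d d' b. K d b = K d' b))"
proof -
  define ok where "ok = (\<lambda>d b K. 1 \<le> K \<and> (\<forall>x\<ge>1.
        Pi_fac d g (1 + \<tau> * ln x) \<le> K * x powr b \<and>
        Pi_fac d g (1 + \<tau>' * ln x) \<le> K * x powr b \<and> 1 + \<tau> * ln x \<le> K * x powr b))"
  have uniform: "\<exists>K. \<forall>d. Pi_fac d g = Pi_fac d g' \<longrightarrow> ok d b K"
    if g': "\<And>j. 1 \<le> j \<Longrightarrow> 0 \<le> g' j \<and> g' j \<le> 1" "summable (\<lambda>j. g' (Suc j))" and b: "0 < b" for g' b
  proof -
    obtain K1 where K1: "1 \<le> K1" "\<And>x d. 1 \<le> x \<Longrightarrow> Pi_fac d g' (1 + \<tau> * ln x) \<le> K1 * x powr b"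
      using Pi_fac_log_le[OF g' \<tau>(1) b] by blast
    obtain K2 where K2: "1 \<le> K2" "\<And>x d. 1 \<le> x \<Longrightarrow> Pi_fac d g' (1 + \<tau>' * ln x) \<le> K2 * x powr b"
      using Pi_fac_log_le[OF g' \<tau>(2) b] by blast
    define K where "K = K1 + K2 + \<tau> / b"
    have K0: "0 < \<tau> / b" using \<tau> b by simp
    have "ok d b K" if d: "Pi_fac d g = Pi_fac d g'" for d
      unfolding ok_def
    proof (intro conjI allI impI)
      show "1 \<le> K" using K1 K2 K0 by (simp add: K_def)
      fix x :: real assume x: "1 \<le> x"
      have xb: "1 \<le> x powr b" using x b by (simp add: ge_one_powr_ge_zero)
      have "K1 * x powr b \<le> K * x powr b" "K2 * x powr b \<le> K * x powr b"
        using K1 K2 K0 by (auto simp: K_def intro!: mult_right_mono)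
      then show "Pi_fac d g (1 + \<tau> * ln x) \<le> K * x powr b" "Pi_fac d g (1 + \<tau>' * ln x) \<le> K * x powr b"
        unfolding d using K1(2)[OF x, of d] K2(2)[OF x, of d] by linarith+
      have "\<tau> * ln x \<le> \<tau> * (x powr b / b)" using \<tau> ln_powr_bound[OF x b] by (intro mult_left_mono) auto
      then have "1 + \<tau> * ln x \<le> (1 + \<tau> / b) * x powr b" using xb by (simp add: algebra_simps)
      also have "\<dots> \<le> K * x powr b" using K1 K2 by (intro mult_right_mono) (auto simp: K_def)
      finally show "1 + \<tau> * ln x \<le> K * x powr b" .
    qed
    then show ?thesis by blast
  qed
  show ?thesis
  proof (cases "summable (\<lambda>j. g (Suc j))")
    case True
    have "\<exists>K. \<forall>d. ok d b K" if "0 < b" for b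
      using uniform[of g b] g True that by (auto simp: less_imp_le)
    \<comment> \<open>The chosen constant does not mention the dimension, which yields the equality
      claimed in the summable case.\<close>
    then have "\<forall>d. ok d b (SOME K. \<forall>d. ok d b K)" if "0 < b" for b
      using that by (intro someI_ex[of "\<lambda>K. \<forall>d. ok d b K"])
    then show ?thesis unfolding ok_def by (intro exI[of _ "\<lambda>d b. SOME K. \<forall>d. ok d b K"]) (auto simp: ok_def)
  next
    case False
    have "\<exists>K. ok d b K" if b: "0 < b" for d b
    proof -
      \<comment> \<open>Cutting off after \<open>d\<close> leaves the product in dimension
        \<open>d\<close> unchanged and makes the sequence summable.\<close>
      define g' where "g' = (\<lambda>j. if j \<le> d then g j else 0)"
      have "Pi_fac d g x = Pi_fac d g' x" for x
        unfolding Pi_fac_def g'_def by (intro prod.cong) auto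
      moreover have "summable (\<lambda>j. g' (Suc j))"
        by (rule summable_finite[of "{..<d}"]) (auto simp: g'_def)
      ultimately show ?thesis using uniform[of g' b] g b by (force simp: g'_def less_imp_le)
    qed
    then have "ok d b (SOME K. ok d b K)" if "0 < b" for d b using that by (intro someI_ex[of "ok d b"])
    then show ?thesis using False by (intro exI[of _ "\<lambda>d b. SOME K. ok d b K"]) (auto simp: ok_def)
  qed
qed

section \<open>The algorithm with its actual parameters\<close>

locale algorithm_params =
  fixes \<alpha> \<tau> :: real and R d N :: nat and \<gamma> :: "nat \<Rightarrow> real"
  assumes \<alpha>: "1 / 2 < \<alpha>" and \<tau>: "0 < \<tau>" and R: "odd R"
    and \<gamma>: "\<And>j. 1 \<le> j \<Longrightarrow> 0 < \<gamma> j \<and> \<gamma> j \<le> 1"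
    and N: "prime N" "odd N" and N2: "1 < N2 N d \<tau> \<alpha> \<gamma>"
begin

definition g :: "nat \<Rightarrow> real" where "g j = \<gamma> j powr (1 / (2 * \<alpha>))"
definition L :: real where "L = N2 N d \<tau> \<alpha> \<gamma>"
definition e :: real where "e = (2 * \<alpha> - 1) / ln (real N)"
definition x :: real where "x = 1 + \<tau> * ln L"

lemma g01: "1 \<le> j \<Longrightarrow> 0 < g j \<and> g j \<le> 1"
  using \<gamma>[of j] \<alpha> by (auto simp: g_def powr_le1)

lemma N3': "3 \<le> real N"
  using N prime_ge_2_nat[OF N(1)] by (cases "N = 2") auto

lemma ln_N: "1 \<le> ln (real N)"
  using ln_3_ge_1 N3' by (smt (verit) ln_le_cancel_iff)

lemma P_eq: "P_fac N d \<tau> \<alpha> \<gamma> = Pi_fac d g (1 + \<tau> * ln (real N))"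
  unfolding P_fac_eq_Pi_fac g_def[abs_def] ..

lemma P_ge1: "1 \<le> P_fac N d \<tau> \<alpha> \<gamma>"
  unfolding P_eq using g01 ln_N \<tau> by (intro Pi_fac_ge1) auto

lemma L_eq: "L = (real N - 1) / (exp (1 / \<tau>) * P_fac N d \<tau> \<alpha> \<gamma>)"
  by (simp add: L_def N2_def)

lemma L1: "1 < L"
  using N2 by (simp add: L_def)

lemma exp_ge1: "1 \<le> exp (1 / \<tau>)"
  using \<tau> by simp

lemma L_le_N: "L \<le> real N"
proof -
  have "1 * 1 \<le> exp (1 / \<tau>) * P_fac N d \<tau> \<alpha> \<gamma>" using exp_ge1 P_ge1 by (intro mult_mono) auto
  then have "L \<le> (real N - 1) / 1" unfolding L_eq using N3' by (intro divide_left_mono) auto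
  then show ?thesis by simp
qed

lemma e_bounds: "0 < e" "1 + e \<le> 2 * \<alpha>"
proof -
  show "0 < e" using \<alpha> ln_N by (simp add: e_def)
  have "e \<le> 2 * \<alpha> - 1"
    unfolding e_def using \<alpha> ln_N mult_left_mono[OF ln_N, of "2 * \<alpha> - 1"] by (simp add: pos_divide_le_eq)
  then show "1 + e \<le> 2 * \<alpha>" by simp
qed

lemma x1: "1 < x" "x \<le> 1 + \<tau> * ln (real N)"
  using L1 L_le_N \<tau> by (auto simp: x_def)

text \<open>The box condition holds because \<open>P_fac\<close> contains the factor belonging to
  \<open>j\<close>, which is at least \<open>2 * g j\<close>, and \<open>L * exp (1 / \<tau>) *
  P_fac N d \<tau> \<alpha> \<gamma> = N - 1\<close>.\<close>

sublocale lattice_params d N g L e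
proof
  show "2 * (L * g j) \<le> real N" if j: "j \<in> {1..d}" for j
  proof -
    let ?F = "\<lambda>i. 1 + 2 * g i * (1 + \<tau> * ln (real N))"
    have F1: "1 \<le> ?F i" if "1 \<le> i" for i using g01[OF that] \<tau> ln_N by simp
    have "2 * g j * 1 \<le> 2 * g j * (1 + \<tau> * ln (real N))"
      using g01[of j] j \<tau> ln_N by (intro mult_left_mono) auto
    then have "2 * g j \<le> ?F j * 1" by simp
    also have "\<dots> \<le> ?F j * (\<Prod>i\<in>{1..d} - {j}. ?F i)"
      using F1 j by (intro mult_left_mono prod_ge_1) (auto intro: order_trans[OF zero_le_one])
    also have "\<dots> = P_fac N d \<tau> \<alpha> \<gamma>" unfolding P_eq Pi_fac_def using j by (simp add: prod.remove)
    also have "\<dots> \<le> exp (1 / \<tau>) * P_fac N d \<tau> \<alpha> \<gamma>" using exp_ge1 P_ge1 mult_right_mono[of 1 "exp (1 / \<tau>)" "P_fac N d \<tau> \<alpha> \<gamma>"] by simp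
    finally have "L * (2 * g j) \<le> L * (exp (1 / \<tau>) * P_fac N d \<tau> \<alpha> \<gamma>)" using L1 by (intro mult_left_mono) auto
    also have "\<dots> = real N - 1" unfolding L_eq using P_ge1 by simp
    finally show ?thesis by (simp add: mult_ac)
  qed
qed (use N g01 L1 e_bounds in auto)

lemma A_eq: "A = freq_set d \<alpha> \<gamma> L"
proof -
  have "freq_set d \<alpha> \<gamma> L = {h \<in> int_vecs d. 1 < L * decay d g h}"
    unfolding g_def[abs_def] using \<alpha> \<gamma> L1 by (intro freq_set_eq_decay) auto
  then show ?thesis by (simp only: A_def)
qed

text \<open>The left side counts the possible collision partners of a frequency of \<open>A\<close>.
  With \<open>\<delta> = 1 / (\<tau> * ln L)\<close> the refined count has denominator
  \<open>1 + 1 / \<delta> = x\<close>, and its numerator is at most \<open>L * exp (1 / \<tau>) *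
  P_fac N d \<tau> \<alpha> \<gamma> = N - 1\<close>; \<open>L \<le> N\<close> allows the product at
  \<open>x\<close> to be compared with \<open>P_fac\<close>.\<close>

lemma card_A_le: "real (card A) - 1 \<le> (real N - 1) / x"
proof -
  define \<delta> where "\<delta> = 1 / (\<tau> * ln L)"
  have lnL: "0 < ln L" using L1 by simp
  have \<delta>: "0 < \<delta>" "1 + 1 / \<delta> = x" using lnL \<tau> by (auto simp: \<delta>_def x_def)
  have "L powr (1 + \<delta>) = L powr 1 * L powr \<delta>" by (rule powr_add)
  also have "L powr \<delta> = exp (1 / \<tau>)" using L1 lnL by (simp add: powr_def \<delta>_def)
  finally have Lp: "L powr (1 + \<delta>) = L * exp (1 / \<tau>)" using L1 by simp
  have "card A - 1 \<le> card (A - {\<lambda>j\<in>{1..d}. 0})" using diff_card_le_card_Diff[of "{\<lambda>j\<in>{1..d}. 0}" A] by simp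
  then have "real (card A) - 1 \<le> real (card (A - {\<lambda>j\<in>{1..d}. 0}))" by linarith
  also have "\<dots> \<le> L powr (1 + \<delta>) * (Pi_fac d g (1 + 1 / \<delta>) - 1) / (1 + 1 / \<delta>)"
    using card_decay_set_le[of g \<delta> L d] g01 \<delta> L1 by (simp add: A_def)
  also have "\<dots> = L * exp (1 / \<tau>) * (Pi_fac d g x - 1) / x" unfolding \<delta> Lp ..
  also have "\<dots> \<le> L * exp (1 / \<tau>) * P_fac N d \<tau> \<alpha> \<gamma> / x"
  proof (intro divide_right_mono mult_left_mono)
    have "Pi_fac d g x \<le> P_fac N d \<tau> \<alpha> \<gamma>" unfolding P_eq using g01 x1 by (intro Pi_fac_mono) auto
    then show "Pi_fac d g x - 1 \<le> P_fac N d \<tau> \<alpha> \<gamma>" by simp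
  qed (use x1 L1 in auto)
  also have "L * exp (1 / \<tau>) * P_fac N d \<tau> \<alpha> \<gamma> = real N - 1" unfolding L_eq using P_ge1 by simp
  finally show ?thesis .
qed

lemma card_A_le_N: "real (card A) \<le> real N"
proof -
  have "(real N - 1) / x \<le> (real N - 1) / 1" using x1 N3' by (intro divide_left_mono) auto
  then show ?thesis using card_A_le by simp
qed

definition \<theta> :: real where "\<theta> = 3 * \<Pi>\<^sub>e / (real N - 1) * x"

definition good_vectors :: "(nat \<Rightarrow> nat \<Rightarrow> nat) set" where
  "good_vectors = {z. \<forall>h\<in>A. card {r \<in> {1..R}. bad \<theta> h (z r)} \<le> R div 2}"

text \<open>For \<open>R = 2 * m - 1\<close>, failure at one frequency needs \<open>m\<close> bad
  vectors. Its bound \<open>2 ^ R * (2 / x) ^ m\<close> equals \<open>(8 / x) ^ m / 2\<close>, so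
  the union bound over \<open>A\<close> produces \<open>eps2\<close> exactly.\<close>

lemma prob_good_vectors:
  "1 - eps2 N d R \<tau> \<alpha> \<gamma> \<le> measure_pmf.prob (generating_vectors d N R) good_vectors"
proof -
  let ?M = "generating_vectors d N R"
  define m where "m = R div 2 + 1"
  have Rm: "R = 2 * m - 1" "1 \<le> m" using R by (auto simp: m_def elim!: oddE)
  have ceil: "nat \<lceil>real R / 2\<rceil> = m"
  proof -
    have "\<lceil>real R / 2\<rceil> = int m" using Rm by (intro ceiling_unique) (auto simp: of_nat_diff)
    then show ?thesis by simp
  qed
  let ?E = "\<lambda>h. {z. m \<le> card {r \<in> {1..R}. z r \<in> {y. bad \<theta> h y}}}"
  have one: "measure_pmf.prob ?M (?E h) \<le> 2 ^ R * (2 / x) ^ m" if "h \<in> A" for h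
    unfolding generating_vectors_def \<theta>_def
    by (rule prob_many_bad, rule prob_bad_le[OF that]) (use x1 card_A_le in auto)
  have "- good_vectors = (\<Union>h\<in>A. ?E h)" by (auto simp: good_vectors_def m_def not_le Suc_le_eq)
  then have "measure_pmf.prob ?M (- good_vectors) \<le> (\<Sum>h\<in>A. measure_pmf.prob ?M (?E h))"
    using finite_A by (simp only:) (rule measure_UNION_le, auto)
  also have "\<dots> \<le> (\<Sum>h\<in>A. 2 ^ R * (2 / x) ^ m)" by (rule sum_mono) (rule one)
  also have "\<dots> = real (card A) / 2 * (2 ^ Suc R * (2 / x) ^ m)" by simp
  also have "(2::real) ^ Suc R = 4 ^ m"
  proof -
    have "Suc R = 2 * m" using Rm by simp
    then show ?thesis by (simp only: power_mult) simp
  qed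
  also have "4 ^ m * (2 / x) ^ m = (8 / x) ^ m" by (simp flip: power_mult_distrib)
  also have "real (card A) / 2 * (8 / x) ^ m = eps2 N d R \<tau> \<alpha> \<gamma>"
    unfolding eps2_def ceil x_def A_eq unfolding L_def ..
  finally have "measure_pmf.prob ?M (- good_vectors) \<le> eps2 N d R \<tau> \<alpha> \<gamma>" .
  moreover have "measure_pmf.prob ?M (- good_vectors) = 1 - measure_pmf.prob ?M good_vectors"
    using measure_pmf.prob_compl[of good_vectors ?M] by (simp add: Compl_eq_Diff_UNIV)
  ultimately show ?thesis by linarith
qed

text \<open>The set \<open>good_vectors\<close> mentions neither \<open>f\<close> nor \<beta>: one
  draw of vectors handles the whole unit ball and all rates, and \<beta> enters only when the
  logarithmic products are bounded by powers of \<open>N\<close>.\<close>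

lemma worst_case_error_good:
  fixes K \<beta> :: real
  assumes z: "z \<in> good_vectors" and \<beta>: "0 < \<beta>" and p: "1 \<le> p" and K: "1 \<le> K"
    and KP: "P_fac N d \<tau> \<alpha> \<gamma> \<le> K * real N powr (\<beta> / (2 * \<alpha>))"
    and KQ: "\<Pi>\<^sub>e \<le> K * real N powr (\<beta> / (2 * \<alpha>))"
    and Kx: "1 + \<tau> * ln (real N) \<le> K * real N powr (\<beta> / (2 * \<alpha>))"
  defines "c\<^sub>2 \<equiv> (6 * K\<^sup>2) powr (2 * \<alpha>) * exp (2 * \<alpha> * (2 * \<alpha> - 1))"
    and "c\<^sub>3 \<equiv> (2 * exp (1 / \<tau>) * K) powr (2 * \<alpha>) * exp (2 * \<alpha> - 1) * K"
  shows "worst_case_error d \<alpha> \<gamma> p (median_lattice d N R z A)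
     \<le> ennreal ((sqrt (real R * c\<^sub>2) + sqrt c\<^sub>3) *
          real N powr (- \<alpha> + max (1 / 2 - enn2real (1 / p)) 0 + \<beta>))"
  unfolding worst_case_error_def
proof (rule SUP_least)
  fix f assume "f \<in> {f \<in> korobov_space d \<alpha> \<gamma>. korobov_norm d \<alpha> \<gamma> f \<le> 1}"
  then have f: "f \<in> borel_measurable (cube_measure d)" "continuous_on (cube d) f" "one_periodic d f"
    and sm: "(\<lambda>h. (cmod (fourier_coeff d f h))\<^sup>2 * freq_fun d \<alpha> \<gamma> h) summable_on int_vecs d"
    and nrm: "korobov_norm d \<alpha> \<gamma> f \<le> 1"
    by (auto simp: korobov_space_def)
  let ?n = "real N"
  define c where "c = fourier_coeff d f"
  have fk: "freq_fun d \<alpha> \<gamma> h = decay d g h powr - (2 * \<alpha>)" for h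
    unfolding g_def[abs_def] using \<alpha> \<gamma> by (intro freq_fun_eq_decay) auto
  have sm': "(\<lambda>h. (cmod (c h))\<^sup>2 * decay d g h powr - (2 * \<alpha>)) summable_on int_vecs d"
    using sm unfolding c_def fk .
  have le1: "(\<Sum>k\<in>F. (cmod (c k))\<^sup>2 * decay d g k powr - (2 * \<alpha>)) \<le> 1" if F: "finite F" "F \<subseteq> int_vecs d" for F
  proof -
    have "(\<Sum>k\<in>F. (cmod (c k))\<^sup>2 * decay d g k powr - (2 * \<alpha>))
        \<le> (\<Sum>\<^sub>\<infinity>h\<in>int_vecs d. (cmod (c h))\<^sup>2 * decay d g h powr - (2 * \<alpha>))"
      using F by (intro finite_sum_le_infsum sm') auto
    also have "\<dots> \<le> 1" using nrm unfolding korobov_norm_def fk c_def[symmetric] by simp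
    finally show ?thesis .
  qed
  have smb: "(\<lambda>h. decay d g h powr (2 * \<alpha>)) summable_on int_vecs d"
    using decay_powr_summable[of g "2 * \<alpha> - 1" d] g01 \<alpha> by simp
  \<comment> \<open>Finite Korobov norm and \<open>2 * \<alpha> > 1\<close> give absolute
    convergence, the input for the pointwise Fourier expansion.\<close>
  have csum: "(\<lambda>h. cmod (c h)) summable_on int_vecs d"
  proof (rule Cauchy_Schwarz_infsum(1)[OF sm' _ smb])
    fix h
    show "(cmod (c h))\<^sup>2 \<le> (cmod (c h))\<^sup>2 * decay d g h powr - (2 * \<alpha>) * decay d g h powr (2 * \<alpha>)"
      using decay_bounds(1)[of h] by (simp add: powr_minus mult.assoc)
  qed auto
  have ser: "complex_of_real (f y) = (\<Sum>\<^sub>\<infinity>h\<in>int_vecs d. c h * echar d h y)" if "y \<in> cube d" for y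
    unfolding c_def using fourier_series_pointwise[OF f csum[unfolded c_def] that] by simp
  have \<theta>: "0 < \<theta>" using Pi_ge1 N3' x1 by (simp add: \<theta>_def)
  interpret M: median_params d N g L e \<alpha> \<theta> R z c f
    by unfold_locales (use e_bounds \<theta> R z le1 ser in \<open>auto simp: good_vectors_def\<close>)
  have x_le: "x \<le> K * ?n powr (\<beta> / (2 * \<alpha>))" using x1 Kx by linarith
  note C = error_constants[OF \<alpha> \<tau> K N3' \<beta> P_ge1 KP Pi_ge1 KQ less_imp_le[OF x1(1)] x_le,
      folded e_def L_eq \<theta>_def, folded c\<^sub>2_def c\<^sub>3_def]
  have T: "M.T \<le> c\<^sub>2 * ?n powr (- 2 * \<alpha> + 2 * \<beta>)" unfolding M.T_def by (rule C(1))
  \<comment> \<open>One number for two norms: \<open>a\<close> bounds the mean-square error and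
    \<open>a * sqrt N\<close> the uniform error, the form in which the interpolation lemma takes
    them.\<close>
  define a where "a = (sqrt (real R * c\<^sub>2) + sqrt c\<^sub>3) * ?n powr (- \<alpha> + \<beta>)"
  have c0: "0 \<le> real R * c\<^sub>2" "0 < c\<^sub>3" using K by (auto simp: c\<^sub>2_def c\<^sub>3_def)
  have a: "0 < a" using c0 N3' by (simp add: a_def add_nonneg_pos)
  have nsq: "(?n powr s)\<^sup>2 = ?n powr (2 * s)" for s by (simp add: powr_powr mult.commute flip: powr_numeral)
  let ?u = "\<lambda>y. complex_of_real (f y) - median_lattice d N R z A f y"
  have RT: "real R * M.T \<le> real R * c\<^sub>2 * ?n powr (- 2 * \<alpha> + 2 * \<beta>)"
    using mult_left_mono[OF T, of "real R"] by (simp add: mult.assoc)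
  have Q: "(\<Sum>k\<in>F. (cmod (M.c' k))\<^sup>2) \<le> a\<^sup>2" if F: "finite F" "F \<subseteq> int_vecs d" for F
  proof -
    have "(\<Sum>k\<in>F. (cmod (M.c' k))\<^sup>2) \<le> real R * M.T + L powr - (2 * \<alpha>)" by (rule M.sum_c'_square_le[OF F])
    also have "\<dots> \<le> real R * c\<^sub>2 * ?n powr (- 2 * \<alpha> + 2 * \<beta>) + c\<^sub>3 * ?n powr (- 2 * \<alpha> + 2 * \<beta>)"
      by (intro add_mono RT C(2))
    also have "\<dots> = (real R * c\<^sub>2 + c\<^sub>3) * ?n powr (- 2 * \<alpha> + 2 * \<beta>)" by (simp add: distrib_right)
    also have "\<dots> \<le> (sqrt (real R * c\<^sub>2) + sqrt c\<^sub>3)\<^sup>2 * ?n powr (- 2 * \<alpha> + 2 * \<beta>)"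
      using c0 by (intro mult_right_mono) (auto simp: power2_sum)
    also have "\<dots> = a\<^sup>2" unfolding a_def power_mult_distrib nsq by (simp add: algebra_simps)
    finally show ?thesis .
  qed
  have sup: "cmod (?u y) \<le> a * ?n powr (1 / 2)" if y: "y \<in> cube d" for y
  proof -
    have "cmod (?u y) \<le> (\<Sum>\<^sub>\<infinity>k\<in>int_vecs d. cmod (M.c' k))"
      unfolding M.error_series[OF y]
      using norm_infsum_bound[of "\<lambda>k. M.c' k * echar d k y" "int_vecs d"] M.infsum_c'_le(1) by (simp add: norm_mult)
    also have "\<dots> \<le> sqrt (real (card A) * (real R * M.T)) + sqrt (L powr - (2 * \<alpha> - 1 - e) * \<Pi>\<^sub>e)"
      by (rule M.infsum_c'_le(2))
    also have "\<dots> \<le> sqrt (?n * (real R * c\<^sub>2 * ?n powr (- 2 * \<alpha> + 2 * \<beta>))) + sqrt (c\<^sub>3 * ?n powr (1 - 2 * \<alpha> + 2 * \<beta>))"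
      by (intro add_mono real_sqrt_le_mono mult_mono[OF card_A_le_N RT] C(3)) (simp_all add: M.T_nonneg)
    also have "?n * (real R * c\<^sub>2 * ?n powr (- 2 * \<alpha> + 2 * \<beta>)) = real R * c\<^sub>2 * ?n powr (1 - 2 * \<alpha> + 2 * \<beta>)"
    proof -
      have "?n * ?n powr (- 2 * \<alpha> + 2 * \<beta>) = ?n powr (1 + (- 2 * \<alpha> + 2 * \<beta>))"
        using N3' by (intro powr_mult_base) auto
      also have "1 + (- 2 * \<alpha> + 2 * \<beta>) = 1 - 2 * \<alpha> + 2 * \<beta>" by simp
      finally show ?thesis by (simp only: mult.left_commute[of ?n])
    qed
    also have "sqrt (real R * c\<^sub>2 * ?n powr (1 - 2 * \<alpha> + 2 * \<beta>)) + sqrt (c\<^sub>3 * ?n powr (1 - 2 * \<alpha> + 2 * \<beta>))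
        = (sqrt (real R * c\<^sub>2) + sqrt c\<^sub>3) * sqrt (?n powr (1 - 2 * \<alpha> + 2 * \<beta>))"
      by (simp only: real_sqrt_mult distrib_right)
    also have "sqrt (?n powr (1 - 2 * \<alpha> + 2 * \<beta>)) = ?n powr (- \<alpha> + \<beta>) * ?n powr (1 / 2)"
      unfolding powr_add[symmetric] by (rule real_sqrt_unique) (simp_all add: nsq algebra_simps)
    finally show ?thesis by (simp add: a_def mult.assoc)
  qed
  have meas: "?u \<in> borel_measurable (cube_measure d)"
    unfolding median_lattice_def exp_eq_echar
    by (intro borel_measurable_diff borel_measurable_sum borel_measurable_times
        borel_measurable_const echar_measurable measurable_compose[OF f(1)]) simp
  have "Lp_norm d p ?u \<le> ennreal (a * ?n powr max (1 / 2 - enn2real (1 / p)) 0)"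
    using N3' by (intro Lp_norm_le meas a p sup parseval_le[OF meas M.error_series M.infsum_c'_le(1) Q]) auto
  also have "a * ?n powr max (1 / 2 - enn2real (1 / p)) 0
     = (sqrt (real R * c\<^sub>2) + sqrt c\<^sub>3) * ?n powr (- \<alpha> + max (1 / 2 - enn2real (1 / p)) 0 + \<beta>)"
    unfolding a_def mult.assoc powr_add[symmetric] by (simp add: algebra_simps)
  finally show "Lp_norm d p ?u \<le> ennreal ((sqrt (real R * c\<^sub>2) + sqrt c\<^sub>3) *
          ?n powr (- \<alpha> + max (1 / 2 - enn2real (1 / p)) 0 + \<beta>))" .
qed

end

theorem theorem1p1:
  fixes \<alpha> \<tau> :: real and R :: nat and \<gamma> :: "nat \<Rightarrow> real"
  assumes "\<alpha> > 1 / 2" and "\<tau> > 0" and "R > 1" and "odd R"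
    and "\<And>i j. 1 \<le> i \<Longrightarrow> i \<le> j \<Longrightarrow> \<gamma> j \<le> \<gamma> i"
    and "\<And>j. 1 \<le> j \<Longrightarrow> 0 < \<gamma> j \<and> \<gamma> j \<le> 1"
  shows "\<exists>C :: nat \<Rightarrow> ennreal \<Rightarrow> real \<Rightarrow> real.
    (\<forall>d p \<beta>. 1 \<le> d \<longrightarrow> 1 \<le> p \<longrightarrow> 0 < \<beta> \<longrightarrow> 0 < C d p \<beta>) \<and>
    (\<forall>(d::nat) (p::ennreal) N::nat.
       1 \<le> d \<longrightarrow> 1 \<le> p \<longrightarrow> prime N \<longrightarrow> odd N \<longrightarrow> N2 N d \<tau> \<alpha> \<gamma> > 1 \<longrightarrow> eps2 N d R \<tau> \<alpha> \<gamma> \<le> 1 \<longrightarrow>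
       measure_pmf.prob (generating_vectors d N R)
         {z. \<forall>\<beta>>0. worst_case_error d \<alpha> \<gamma> p
                       (median_lattice d N R z (freq_set d \<alpha> \<gamma> (N2 N d \<tau> \<alpha> \<gamma>)))
                     \<le> ennreal (C d p \<beta> *
                         real N powr (- \<alpha> + max (1 / 2 - enn2real (1 / p)) 0 + \<beta>))}
       \<ge> 1 - eps2 N d R \<tau> \<alpha> \<gamma>) \<and>
    (summable (\<lambda>j. \<gamma> (Suc j) powr (1 / (2 * \<alpha>))) \<longrightarrow>
       (\<forall>d d' \<beta>. 1 \<le> d \<longrightarrow> 1 \<le> d' \<longrightarrow> 0 < \<beta> \<longrightarrow> C d \<infinity> \<beta> = C d' \<infinity> \<beta>))"
proof -
  define g where "g = (\<lambda>j. \<gamma> j powr (1 / (2 * \<alpha>)))"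
  \<comment> \<open>Makes \<open>1 + 1 / e\<close> equal to \<open>1 + \<tau>' * ln N\<close>, so
    the product from the tail sums grows like \<open>P_fac\<close>.\<close>
  define \<tau>' where "\<tau>' = 1 / (2 * \<alpha> - 1)"
  note g_eq = g_def
  have g: "0 < g j \<and> g j \<le> 1" if "1 \<le> j" for j
    using assms(1) assms(6)[OF that] by (auto simp: g_def powr_le1)
  have \<tau>': "0 < \<tau>'" using assms(1) by (simp add: \<tau>'_def)
  have "\<exists>K :: nat \<Rightarrow> real \<Rightarrow> real.
     (\<forall>d b. 0 < b \<longrightarrow> 1 \<le> K d b \<and> (\<forall>x\<ge>1.
        Pi_fac d g (1 + \<tau> * ln x) \<le> K d b * x powr b \<and>
        Pi_fac d g (1 + \<tau>' * ln x) \<le> K d b * x powr b \<and>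
        1 + \<tau> * ln x \<le> K d b * x powr b)) \<and>
     (summable (\<lambda>j. g (Suc j)) \<longrightarrow> (\<forall>d d' b. K d b = K d' b))" (is "\<exists>K. ?bound K \<and> ?unif K")
    by (rule growth_constants[OF g assms(2) \<tau>'])
  then obtain K where KK: "?bound K" and Ksum: "?unif K" by (elim exE conjE)
  have K: "1 \<le> K d b"
      "1 \<le> x \<Longrightarrow> Pi_fac d g (1 + \<tau> * ln x) \<le> K d b * x powr b"
      "1 \<le> x \<Longrightarrow> Pi_fac d g (1 + \<tau>' * ln x) \<le> K d b * x powr b"
      "1 \<le> x \<Longrightarrow> 1 + \<tau> * ln x \<le> K d b * x powr b" if "0 < b" for d b x
    using KK that by auto
  define c where "c = (\<lambda>k. sqrt (real R * ((6 * k\<^sup>2) powr (2 * \<alpha>) * exp (2 * \<alpha> * (2 * \<alpha> - 1))))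
      + sqrt ((2 * exp (1 / \<tau>) * k) powr (2 * \<alpha>) * exp (2 * \<alpha> - 1) * k))"
  \<comment> \<open>The dimension enters only through \<open>K\<close>, and \<open>p\<close> does
    not enter at all.\<close>
  define C where "C = (\<lambda>d (p::ennreal) \<beta>. c (K d (\<beta> / (2 * \<alpha>))))"
  have b: "0 < \<beta> / (2 * \<alpha>)" if "0 < \<beta>" for \<beta> using that assms(1) by simp
  have "0 < C d p \<beta>" if "0 < \<beta>" for d p \<beta>
    using K(1)[OF b[OF that], of d] unfolding C_def c_def by (intro add_nonneg_pos) auto
  moreover have "1 - eps2 N d R \<tau> \<alpha> \<gamma> \<le> measure_pmf.prob (generating_vectors d N R)
         {z. \<forall>\<beta>>0. worst_case_error d \<alpha> \<gamma> p
                       (median_lattice d N R z (freq_set d \<alpha> \<gamma> (N2 N d \<tau> \<alpha> \<gamma>)))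
                     \<le> ennreal (C d p \<beta> *
                         real N powr (- \<alpha> + max (1 / 2 - enn2real (1 / p)) 0 + \<beta>))}"
    if p: "1 \<le> p" and N: "prime N" "odd N" "1 < N2 N d \<tau> \<alpha> \<gamma>" for d N and p :: ennreal
  proof -
    interpret algorithm_params \<alpha> \<tau> R d N \<gamma> by unfold_locales (use assms N in auto)
    have gg: "algorithm_params.g \<alpha> \<gamma> = g" by (simp add: fun_eq_iff g_eq g_def)
    have N1: "1 \<le> real N" using N3' by simp
    have ie: "1 + 1 / e = 1 + \<tau>' * ln (real N)" using assms(1) ln_N by (simp add: e_def \<tau>'_def)
    \<comment> \<open>Since \<open>good_vectors\<close> is chosen before \<beta>, the quantifier
      over \<beta> inside the event costs no probability.\<close>
    have "good_vectors \<subseteq> {z. \<forall>\<beta>>0. worst_case_error d \<alpha> \<gamma> p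
                       (median_lattice d N R z (freq_set d \<alpha> \<gamma> (N2 N d \<tau> \<alpha> \<gamma>)))
                     \<le> ennreal (C d p \<beta> *
                         real N powr (- \<alpha> + max (1 / 2 - enn2real (1 / p)) 0 + \<beta>))}"
    proof (clarify)
      fix z :: "nat \<Rightarrow> nat \<Rightarrow> nat" and \<beta> :: real assume z: "z \<in> good_vectors" and \<beta>: "0 < \<beta>"
      show "worst_case_error d \<alpha> \<gamma> p (median_lattice d N R z (freq_set d \<alpha> \<gamma> (N2 N d \<tau> \<alpha> \<gamma>)))
          \<le> ennreal (C d p \<beta> * real N powr (- \<alpha> + max (1 / 2 - enn2real (1 / p)) 0 + \<beta>))"
        unfolding C_def c_def L_def[symmetric] A_eq[symmetric]
        by (rule worst_case_error_good[OF z \<beta> p K(1)])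
           (use b[OF \<beta>] K(2-4)[OF b[OF \<beta>] N1] in \<open>simp_all add: P_eq gg ie\<close>)
    qed
    then have "measure_pmf.prob (generating_vectors d N R) good_vectors \<le> measure_pmf.prob (generating_vectors d N R)
         {z. \<forall>\<beta>>0. worst_case_error d \<alpha> \<gamma> p
                       (median_lattice d N R z (freq_set d \<alpha> \<gamma> (N2 N d \<tau> \<alpha> \<gamma>)))
                     \<le> ennreal (C d p \<beta> *
                         real N powr (- \<alpha> + max (1 / 2 - enn2real (1 / p)) 0 + \<beta>))}"
      by (intro measure_pmf.finite_measure_mono) auto
    then show ?thesis using prob_good_vectors by linarith
  qed
  moreover have "C d \<infinity> \<beta> = C d' \<infinity> \<beta>" if "summable (\<lambda>j. \<gamma> (Suc j) powr (1 / (2 * \<alpha>)))" for d d' \<beta>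
    using Ksum[rule_format, of d "\<beta> / (2 * \<alpha>)" d'] that unfolding C_def by (simp add: g_eq)
  ultimately show ?thesis by (intro exI[of _ C]) blast
qed

end
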